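(* For every $(v_0,H_0)\in L^2_\sigma(\mathbb T^d)\times L^2_\sigma(\mathbb T^d)$ there exists an energy-variational solution $(v,H,E)$ to the incompressible ideal magnetohydrodynamical equations with initial datum $(v_0,H_0)$, in the sense defined in the context, such that $E(0)=\mathcal E(v_0,H_0)$ and $(v,H)\in C_w([0,T];L^2_\sigma(\mathbb T^d)\times L^2_\sigma(\mathbb T^d))$, and the initial values are attained in the strong sense, i.e. $(v(t),H(t))\to(v_0,H_0)$ strongly in $L^2(\mathbb T^d)$ as $t\searrow0$.
   Context: $d\in\mathbb N$, $T\in(0,\infty)$, $\mu\in(0,\infty)$, $\mathbb T^d=\mathbb R^d/\mathbb Z^d$ is the flat torus with Lebesgue measure. The equations are $\partial_tv+(v\cdot\nabla)v-\mu(H\cdot\nabla)H+\nabla p+\nabla\frac{\mu}{2}|H|^2=0$, $\partial_tH-\nabla\times(v\times H)=0$, $\operatorname{div}v=0$, $\operatorname{div}H=0$ in $\mathbb T^d\times(0,T)$, with $v(0)=v_0$, $H(0)=H_0$. $L^q_\sigma(\mathbb T^d)=\{v\in L^q(\mathbb T^d;\mathbb R^d):\int_{\mathbb T^d}v\cdot\nabla\varphi\,dx=0\ \forall\varphi\in C^1(\mathbb T^d)\}$. $\mathcal E(v,H)=\frac12\|v\|_{L^2(\mathbb T^d)}^2+\frac\mu2\|H\|_{L^2(\mathbb T^d)}^2$. $A:B=\sum_{i,j}A_{ij}B_{ij}$, $(a\otimes b)_{ij}=a_ib_j$, $(\nabla\varphi)_{ij}=\partial_{x_j}\varphi_i$,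 $(A)_{\rm sym}=\frac12(A+A^T)$, $(A)_{\rm skw}=\frac12(A-A^T)$. $|A|_2$ is the spectral norm (square root of the largest eigenvalue of $A^TA$) and $\|\Phi\|_{L^\infty(\mathbb T^d;\mathbb R^{d\times d})}=\operatorname{ess\,sup}_x|\Phi(x)|_2$. $BV([0,T])$ is the space of integrable functions of bounded variation on $[0,T]$. $C_w([0,T];X)$ denotes functions continuous with respect to the weak topology of $X$. Definition. A tuple $(v,H,E)\in L^\infty(0,T;L^2_\sigma(\mathbb T^d))^2\times BV([0,T])$ is an energy-variational solution with initial datum $(v_0,H_0)$ if $\mathcal E(v(t),H(t))\le E(t)$ for a.a. $t\in(0,T)$ and $$\Big[E-\int_{\mathbb T^d}(v\cdot\varphi+H\cdot\psi)\,dx\Big]\Big|_s^t+\int_s^t\Big[\int_{\mathbb T^d}v\cdot\partial_t\varphi+(v\otimes v-\mu H\otimes H):\nabla\varphi+H\cdot\partial_t\psi+(H\otimes v-v\otimes H):\nabla\psi\,dx+\mathcal K(\varphi,\psi)[\mathcal E(v,H)-E]\Big]d\tau\le0$$ for a.e. $s<t$ in $(0,T)$, including $s=0$ with $(v(0),H(0))=(v_0,H_0)$, and all $(\varphi,\psi)\in C^1(\mathbb T^d\times[0,T];\mathbb R^d)^2$ with $\operatorname{div}\varphi=\operatorname{div}\psi=0$, where $$\mathcal K(\varphi,\psi)=2\|(\nabla\varphi)_{\rm sym}\|_{L^\infty(\mathbb T^d;\mathbb R^{d\times d})}+\frac{2}{\sqrt\mu}\|(\nabla\psi)_{\rm skw}\|_{L^\infty(\mathbb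 T^d;\mathbb R^{d\times d})}.$$ $E(0)$ is understood as $E(0+)$. *)

theory Defs
  imports "HOL-Analysis.Analysis" "HOL-Probability.Essential_Supremum"
begin

section \<open>Functions on the flat torus\<close>

text \<open>Functions on \<open>\<real>\<^sup>d/\<int>\<^sup>d\<close> are identified with \<open>\<int>\<^sup>d\<close>-periodic functions on \<open>\<real>\<^sup>d\<close>;
  integrals over the torus are Lebesgue integrals over the unit cube. Here
  \<open>d = CARD('n)\<close>.\<close>

definition torus_periodic :: "(real^'n \<Rightarrow> 'b) \<Rightarrow> bool" where
  "torus_periodic f \<longleftrightarrow> (\<forall>x k. (\<forall>i. k $ i \<in> \<int>) \<longrightarrow> f (x + k) = f x)"

definition torus :: "(real^'n) measure" where
  "torus = lebesgue_on (cbox 0 1)"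

text \<open>Elements of \<open>L\<^sup>2\<close> are represented by functions, equality in \<open>L\<^sup>2\<close> being equality almost
  everywhere.\<close>

definition L2 :: "(real^'n \<Rightarrow> real^'n) set" where
  "L2 = {f. torus_periodic f \<and> f \<in> borel_measurable torus \<and> integrable torus (\<lambda>x. (norm (f x))\<^sup>2)}"

definition L2_norm :: "(real^'n \<Rightarrow> real^'n) \<Rightarrow> real" where
  "L2_norm f = sqrt (LINT x|torus. (norm (f x))\<^sup>2)"

definition L2_sigma :: "(real^'n \<Rightarrow> real^'n) set" where
  "L2_sigma = {f \<in> L2. \<forall>\<phi> g. torus_periodic \<phi> \<and> (\<forall>x. GDERIV \<phi> x :> g x) \<and> continuous_on UNIV g
      \<longrightarrow> (LINT x|torus. f x \<bullet> g x) = 0}"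

section \<open>Time-dependent functions\<close>

text \<open>Bochner (strong) measurability on \<open>(0,T)\<close>: almost everywhere limit, in the \<open>L\<^sup>2\<close> norm, of
  simple functions with values in \<open>L\<^sup>2\<^sub>\<sigma>\<close>.\<close>

definition Linfty_L2_sigma :: "real \<Rightarrow> (real \<Rightarrow> real^'n \<Rightarrow> real^'n) set" where
  "Linfty_L2_sigma T = {v.
     (AE t in lebesgue_on {0<..<T}. v t \<in> L2_sigma) \<and>
     (\<exists>s. (\<forall>k. simple_function (lebesgue_on {0<..<T}) (s k)) \<and>
          (\<forall>k. \<forall>t\<in>{0<..<T}. s k t \<in> L2_sigma) \<and>
          (AE t in lebesgue_on {0<..<T}. (\<lambda>k. L2_norm (\<lambda>x. s k t x - v t x)) \<longlonglongrightarrow> 0)) \<and>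
     (\<exists>C. AE t in lebesgue_on {0<..<T}. L2_norm (v t) \<le> C)}"

definition BV :: "real \<Rightarrow> (real \<Rightarrow> real) set" where
  "BV T = {E. integrable (lebesgue_on {0..T}) E \<and>
     (\<exists>B. \<forall>n (p :: nat \<Rightarrow> real). mono p \<and> range p \<subseteq> {0..T} \<longrightarrow>
        (\<Sum>i<n. \<bar>E (p (Suc i)) - E (p i)\<bar>) \<le> B)}"

text \<open>Continuous linear functionals on \<open>L\<^sup>2\<^sub>\<sigma> \<times> L\<^sup>2\<^sub>\<sigma>\<close>; boundedness makes them respect
  equality almost everywhere.\<close>

definition L2_sigma_pair_functional ::
    "((real^'n \<Rightarrow> real^'n) \<times> (real^'n \<Rightarrow> real^'n) \<Rightarrow> real) \<Rightarrow> bool" where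
  "L2_sigma_pair_functional l \<longleftrightarrow>
     (\<forall>f\<in>L2_sigma. \<forall>g\<in>L2_sigma. \<forall>f'\<in>L2_sigma. \<forall>g'\<in>L2_sigma. \<forall>a b.
        l (\<lambda>x. a *\<^sub>R f x + b *\<^sub>R f' x, \<lambda>x. a *\<^sub>R g x + b *\<^sub>R g' x) = a * l (f, g) + b * l (f', g')) \<and>
     (\<exists>C. \<forall>f\<in>L2_sigma. \<forall>g\<in>L2_sigma. \<bar>l (f, g)\<bar> \<le> C * sqrt ((L2_norm f)\<^sup>2 + (L2_norm g)\<^sup>2))"

definition Cw_L2_sigma_pair ::
    "real \<Rightarrow> (real \<Rightarrow> (real^'n \<Rightarrow> real^'n) \<times> (real^'n \<Rightarrow> real^'n)) set" where
  "Cw_L2_sigma_pair T = {u. (\<forall>t\<in>{0..T}. u t \<in> L2_sigma \<times> L2_sigma) \<and>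
     (\<forall>l. L2_sigma_pair_functional l \<longrightarrow> continuous_on {0..T} (\<lambda>t. l (u t)))}"

section \<open>Matrices\<close>

text \<open>The contraction \<open>A : B\<close> is the inner product \<open>A \<bullet> B\<close> of \<^typ>\<open>real^'n^'n\<close>, and
  \<open>(\<nabla>\<phi>)\<^sub>i\<^sub>j = \<partial>\<^sub>j \<phi>\<^sub>i\<close> is the library's \<^const>\<open>jacobian\<close>.\<close>

definition tensor :: "real^'n \<Rightarrow> real^'n \<Rightarrow> real^'n^'n" (infixl "\<otimes>\<^sub>v" 75) where
  "a \<otimes>\<^sub>v b = (\<chi> i j. a $ i * b $ j)"

definition sym_part :: "real^'n^'n \<Rightarrow> real^'n^'n" where
  "sym_part A = (1/2) *\<^sub>R (A + transpose A)"

definition skw_part :: "real^'n^'n \<Rightarrow> real^'n^'n" where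
  "skw_part A = (1/2) *\<^sub>R (A - transpose A)"

definition spectral_norm :: "real^'n^'n \<Rightarrow> real" where
  "spectral_norm A =
     sqrt (GREATEST l. \<exists>x. x \<noteq> 0 \<and> (transpose A ** A) *v x = l *\<^sub>R x)"

definition Linfty_norm :: "(real^'n \<Rightarrow> real^'n^'n) \<Rightarrow> real" where
  "Linfty_norm \<Phi> = real_of_ereal (esssup torus (\<lambda>x. ereal (spectral_norm (\<Phi> x))))"

section \<open>Energy-variational solutions\<close>

definition time_deriv :: "real \<Rightarrow> (real \<Rightarrow> real^'n \<Rightarrow> real^'n) \<Rightarrow> real \<Rightarrow> real^'n \<Rightarrow> real^'n" where
  "time_deriv T \<phi> t x = vector_derivative (\<lambda>\<tau>. \<phi> \<tau> x) (at t within {0..T})"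

definition grad :: "(real^'n \<Rightarrow> real^'n) \<Rightarrow> real^'n \<Rightarrow> real^'n^'n" where
  "grad \<phi> x = jacobian \<phi> (at x)"

text \<open>Divergence-free fields of class \<open>C\<^sup>1\<close> on the product of the torus and the closed interval
  \<open>[0,T]\<close>; time derivatives at the end points are one-sided.\<close>

definition test_fields :: "real \<Rightarrow> (real \<Rightarrow> real^'n \<Rightarrow> real^'n) set" where
  "test_fields T = {\<phi>.
     (\<forall>t\<in>{0..T}. torus_periodic (\<phi> t)) \<and>
     (\<forall>t\<in>{0..T}. \<forall>x. \<phi> t differentiable (at x)) \<and>
     (\<forall>t\<in>{0..T}. \<forall>x. (\<lambda>\<tau>. \<phi> \<tau> x) differentiable (at t within {0..T})) \<and>
     continuous_on ({0..T} \<times> UNIV) (\<lambda>(t, x). grad (\<phi> t) x) \<and>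
     continuous_on ({0..T} \<times> UNIV) (\<lambda>(t, x). time_deriv T \<phi> t x) \<and>
     (\<forall>t\<in>{0..T}. \<forall>x. trace (grad (\<phi> t) x) = 0)}"

definition energy :: "real \<Rightarrow> (real^'n \<Rightarrow> real^'n) \<Rightarrow> (real^'n \<Rightarrow> real^'n) \<Rightarrow> real" where
  "energy \<mu> v H = 1/2 * (L2_norm v)\<^sup>2 + \<mu>/2 * (L2_norm H)\<^sup>2"

definition regularity_weight :: "real \<Rightarrow> (real^'n \<Rightarrow> real^'n) \<Rightarrow> (real^'n \<Rightarrow> real^'n) \<Rightarrow> real" where
  "regularity_weight \<mu> \<phi> \<psi> =
     2 * Linfty_norm (\<lambda>x. sym_part (grad \<phi> x)) + 2 / sqrt \<mu> * Linfty_norm (\<lambda>x. skw_part (grad \<psi> x))"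

definition shifted_energy ::
    "real \<Rightarrow> (real^'n \<Rightarrow> real^'n) \<Rightarrow> (real^'n \<Rightarrow> real^'n) \<Rightarrow> (real^'n \<Rightarrow> real^'n) \<Rightarrow> (real^'n \<Rightarrow> real^'n) \<Rightarrow> real" where
  "shifted_energy e v H \<phi> \<psi> = e - (LINT x|torus. v x \<bullet> \<phi> x + H x \<bullet> \<psi> x)"

definition ev_integrand where
  "ev_integrand \<mu> T v H E \<phi> \<psi> \<tau> =
     (LINT x|torus.
        v \<tau> x \<bullet> time_deriv T \<phi> \<tau> x
        + (v \<tau> x \<otimes>\<^sub>v v \<tau> x - \<mu> *\<^sub>R (H \<tau> x \<otimes>\<^sub>v H \<tau> x)) \<bullet> grad (\<phi> \<tau>) x
        + H \<tau> x \<bullet> time_deriv T \<psi> \<tau> x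
        + (H \<tau> x \<otimes>\<^sub>v v \<tau> x - v \<tau> x \<otimes>\<^sub>v H \<tau> x) \<bullet> grad (\<psi> \<tau>) x)
     + regularity_weight \<mu> (\<phi> \<tau>) (\<psi> \<tau>) * (energy \<mu> (v \<tau>) (H \<tau>) - E \<tau>)"

text \<open>The inequality between the times \<open>s < t\<close>. The triple \<open>(e, w, G)\<close> is the value of
  \<open>(E, v, H)\<close> at time \<open>s\<close>, kept separate because for \<open>s = 0\<close> it is
  \<open>(E(0+), v\<^sub>0, H\<^sub>0)\<close>.\<close>

definition ev_inequality where
  "ev_inequality \<mu> T v H E s e w G t \<longleftrightarrow>
     (\<forall>\<phi>\<in>test_fields T. \<forall>\<psi>\<in>test_fields T.
        shifted_energy (E t) (v t) (H t) (\<phi> t) (\<psi> t) - shifted_energy e w G (\<phi> s) (\<psi> s)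
        + (LINT \<tau>|lebesgue_on {s..t}. ev_integrand \<mu> T v H E \<phi> \<psi> \<tau>) \<le> 0)"

text \<open>\<^term>\<open>Lim (at_right 0) E\<close> exists for every \<^term>\<open>E \<in> BV T\<close> with \<^term>\<open>0 < T\<close>.\<close>

definition energy_variational_solution ::
    "real \<Rightarrow> real \<Rightarrow> (real^'n \<Rightarrow> real^'n) \<Rightarrow> (real^'n \<Rightarrow> real^'n) \<Rightarrow>
     (real \<Rightarrow> real^'n \<Rightarrow> real^'n) \<Rightarrow> (real \<Rightarrow> real^'n \<Rightarrow> real^'n) \<Rightarrow> (real \<Rightarrow> real) \<Rightarrow> bool" where
  "energy_variational_solution \<mu> T v0 H0 v H E \<longleftrightarrow>
     v \<in> Linfty_L2_sigma T \<and> H \<in> Linfty_L2_sigma T \<and> E \<in> BV T \<and>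
     (AE t in lebesgue_on {0<..<T}. energy \<mu> (v t) (H t) \<le> E t) \<and>
     (\<exists>N \<in> null_sets lebesgue.
        (\<forall>s\<in>{0<..<T} - N. \<forall>t\<in>{0<..<T} - N. s < t \<longrightarrow>
           ev_inequality \<mu> T v H E s (E s) (v s) (H s) t) \<and>
        (\<forall>t\<in>{0<..<T} - N.
           ev_inequality \<mu> T v H E 0 (Lim (at_right 0) E) v0 H0 t))"

end

theory Submission
  imports Defs "HOL-Complex_Analysis.Great_Picard"
begin

text \<open>The energy bound \<open>E\<close> can be taken constant, equal to the initial energy. With the rescaled
  state \<open>u = (v, sqrt \<mu> * H)\<close> the energy is half the squared norm, and adding
  \<open>\<K>(\<phi>, \<psi>)\<close> times the energy makes the nonlinearity tested with \<open>(\<phi>, \<psi>)\<close> a convex,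
  hence weakly lower semicontinuous, function of \<open>u\<close>; this is why the inequality, unlike the weak
  formulation, survives weak limits. The approximations are explicit Euler steps of Galerkin systems
  for a basis of solenoidal \<open>C\<^sup>1\<close> fields: the Galerkin drift is orthogonal to the state, so that
  energy is created only at second order in the step size. For test fields depending on time, freeze
  them on short time intervals and add up. Strong attainment of the initial values follows from weak
  continuity together with the bound of the norm by its initial value.\<close>

section \<open>Orthonormal systems in Hilbert spaces\<close>

text \<open>Only the energy of the approximations is bounded, not their gradients, so they converge
  merely weakly and quadratic terms do not pass to the limit. For the approximations the term with
  the weight is harmless: their energy exceeds the constant \<open>E\<close> at most by an error
  that vanishes. The compactness argument lives in an abstract Hilbert space. Its vectors are
  classes modulo equality almost everywhere, whereas the form and the weight see gradients of test
  fields; a class has at most one \<open>C1\<close> representative, which makes both well defined on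
  a subspace of test vectors. The basis comes from a countable family dense in \<open>C1\<close> and
  not just in the energy norm: since the weight is a supremum of gradients, an inequality known for
  the basis extends to all test fields only under uniform convergence of gradients. The cancellation
  behind the energy balance pairs the state \<open>(v, H)\<close> with the test fields
  \<open>v\<close> and \<open>\<mu> * H\<close>.\<close>

fun gram_schmidt :: "(nat \<Rightarrow> 'h::real_inner) \<Rightarrow> nat \<Rightarrow> 'h" where
  "gram_schmidt w n =
     sgn (w n - sum_list (map (\<lambda>j. inner (w n) (gram_schmidt w j) *\<^sub>R gram_schmidt w j) [0..<n]))"

declare gram_schmidt.simps [simp del]

lemma gram_schmidt_eq:
  "gram_schmidt w n = sgn (w n - (\<Sum>j<n. inner (w n) (gram_schmidt w j) *\<^sub>R gram_schmidt w j))"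
  by (subst gram_schmidt.simps) (simp add: sum_list_distinct_conv_sum_set atLeast0LessThan)

text \<open>Zero vectors are admitted, so that linearly dependent sequences need no special treatment.\<close>

definition orthonormal0 :: "(nat \<Rightarrow> 'h::real_inner) \<Rightarrow> bool" where
  "orthonormal0 e \<longleftrightarrow> (\<forall>i j. i \<noteq> j \<longrightarrow> inner (e i) (e j) = 0) \<and> (\<forall>i. e i = 0 \<or> norm (e i) = 1)"

lemma orthonormal0_inner:
  assumes "orthonormal0 e"
  shows "inner (e i) (e j) = (if i = j \<and> e i \<noteq> 0 then 1 else 0)"
  using assms by (auto simp: orthonormal0_def norm_eq_1)

lemma orthonormal0_cases: "orthonormal0 e \<Longrightarrow> e i = 0 \<or> norm (e i) = 1"
  by (simp add: orthonormal0_def)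

lemma orthonormal0_inner_sum:
  assumes "orthonormal0 e" "finite A"
  shows "inner (\<Sum>i\<in>A. c i *\<^sub>R e i) (e j) = (if j \<in> A \<and> e j \<noteq> 0 then c j else 0)"
proof -
  have "inner (\<Sum>i\<in>A. c i *\<^sub>R e i) (e j) = (\<Sum>i\<in>A. if i = j then (if e j \<noteq> 0 then c j else 0) else 0)"
    unfolding inner_sum_left inner_scaleR_left
    by (rule sum.cong) (auto simp: orthonormal0_inner[OF assms(1)])
  then show ?thesis using assms(2) by (simp add: sum.delta)
qed

lemma orthonormal0_norm_sum:
  assumes "orthonormal0 e" "finite A"
  shows "(norm (\<Sum>i\<in>A. c i *\<^sub>R e i))\<^sup>2 = (\<Sum>i\<in>A. (c i)\<^sup>2 * (norm (e i))\<^sup>2)"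
proof -
  have "(norm (\<Sum>i\<in>A. c i *\<^sub>R e i))\<^sup>2 = (\<Sum>j\<in>A. c j * inner (\<Sum>i\<in>A. c i *\<^sub>R e i) (e j))"
    by (simp add: power2_norm_eq_inner inner_sum_right)
  also have "\<dots> = (\<Sum>j\<in>A. (c j)\<^sup>2 * (norm (e j))\<^sup>2)"
  proof (rule sum.cong)
    show "c j * inner (\<Sum>i\<in>A. c i *\<^sub>R e i) (e j) = (c j)\<^sup>2 * (norm (e j))\<^sup>2" if "j \<in> A" for j
      using orthonormal0_cases[OF assms(1), of j] that
      by (auto simp: orthonormal0_inner_sum[OF assms] power2_eq_square)
  qed simp
  finally show ?thesis .
qed

lemma orthonormal0_norm_le_1: "orthonormal0 e \<Longrightarrow> norm (e i) \<le> 1"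
  by (metis norm_zero orthonormal0_def order_refl zero_le_one)

lemma orthonormal0_norm_sum_le:
  assumes "orthonormal0 e" "finite A"
  shows "(norm (\<Sum>i\<in>A. c i *\<^sub>R e i))\<^sup>2 \<le> (\<Sum>i\<in>A. (c i)\<^sup>2)"
  unfolding orthonormal0_norm_sum[OF assms]
  by (intro sum_mono) (simp add: mult_left_le power_le_one orthonormal0_norm_le_1[OF assms(1)])

lemma orthonormal0_Bessel:
  assumes "orthonormal0 e" "finite A"
  shows "(\<Sum>i\<in>A. (inner x (e i))\<^sup>2) \<le> (norm x)\<^sup>2"
proof -
  let ?p = "\<Sum>i\<in>A. inner x (e i) *\<^sub>R e i"
  have n: "(norm ?p)\<^sup>2 = (\<Sum>i\<in>A. (inner x (e i))\<^sup>2)"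
    unfolding orthonormal0_norm_sum[OF assms]
  proof (rule sum.cong)
    show "(inner x (e i))\<^sup>2 * (norm (e i))\<^sup>2 = (inner x (e i))\<^sup>2" for i
      using orthonormal0_cases[OF assms(1), of i] by auto
  qed simp
  have i: "inner x ?p = (\<Sum>i\<in>A. (inner x (e i))\<^sup>2)"
    by (simp add: inner_sum_right power2_eq_square)
  have "0 \<le> (norm (x - ?p))\<^sup>2" by simp
  also have "\<dots> = (norm x)\<^sup>2 - 2 * inner x ?p + (norm ?p)\<^sup>2"
    by (simp add: power2_norm_eq_inner inner_diff_left inner_diff_right inner_commute algebra_simps)
  finally show ?thesis using n i by simp
qed

lemma gram_schmidt_orthonormal0: "orthonormal0 (gram_schmidt w)"
proof -
  let ?e = "gram_schmidt w"
  have nrm: "?e i = 0 \<or> norm (?e i) = 1" for i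
    by (subst (1 2) gram_schmidt_eq) (simp add: norm_sgn sgn_zero_iff)
  have lt: "\<forall>i<n. \<forall>j<n. i \<noteq> j \<longrightarrow> inner (?e i) (?e j) = 0" for n
  proof (induction n)
    case (Suc n)
    have "inner (?e n) (?e j) = 0" if "j < n" for j
    proof -
      let ?r = "w n - (\<Sum>i<n. inner (w n) (?e i) *\<^sub>R ?e i)"
      have "inner (\<Sum>i<n. inner (w n) (?e i) *\<^sub>R ?e i) (?e j)
          = (\<Sum>i<n. if i = j then inner (w n) (?e j) * inner (?e j) (?e j) else 0)"
        unfolding inner_sum_left inner_scaleR_left
        using Suc that by (intro sum.cong) auto
      also have "\<dots> = inner (w n) (?e j) * inner (?e j) (?e j)" using that by simp
      also have "\<dots> = inner (w n) (?e j)"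
        using nrm[of j] by (auto simp: norm_eq_1)
      finally have "inner ?r (?e j) = 0" by (simp add: inner_diff_left)
      then show ?thesis by (subst gram_schmidt_eq) (simp add: sgn_div_norm)
    qed
    then show ?case using Suc by (auto simp: less_Suc_eq inner_commute)
  qed simp
  have "inner (?e i) (?e j) = 0" if "i \<noteq> j" for i j
    using lt[of "Suc (max i j)"] that by (auto simp: less_Suc_eq_le)
  with nrm show ?thesis by (auto simp: orthonormal0_def)
qed

text \<open>Keeps the orthonormal vectors inside every subspace that contains the original sequence;
  later this is the subspace of pairs of \<open>C1\<close> fields, on which the form is
  defined.\<close>

lemma gram_schmidt_in_span: "gram_schmidt w n \<in> span (w ` {..n})"
proof (induction n rule: less_induct)
  case (less n)
  have "gram_schmidt w j \<in> span (w ` {..n})" if "j < n" for j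
  proof -
    have "w ` {..j} \<subseteq> w ` {..n}" using that by auto
    then show ?thesis using less[OF that] span_mono by blast
  qed
  then show ?case
    by (subst gram_schmidt_eq, unfold sgn_div_norm)
      (intro span_scale span_diff span_sum, auto intro: span_base)
qed

text \<open>The residual normalised by \<open>sgn\<close> is recovered by multiplying with its norm,
  also when it is zero. Thus \<open>w n\<close> is a combination of the first \<open>n + 1\<close>
  orthonormal vectors.\<close>

lemma in_span_gram_schmidt: "w n \<in> span (gram_schmidt w ` {..n})"
proof -
  define p where "p = (\<Sum>j<n. inner (w n) (gram_schmidt w j) *\<^sub>R gram_schmidt w j)"
  have "gram_schmidt w n = sgn (w n - p)" unfolding p_def by (rule gram_schmidt_eq)
  then have eq: "w n = p + norm (w n - p) *\<^sub>R gram_schmidt w n" by (cases "w n = p") (simp_all add: sgn_div_norm)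
  have "p \<in> span (gram_schmidt w ` {..n})"
    unfolding p_def by (intro span_sum span_scale span_base) auto
  moreover have "norm (w n - p) *\<^sub>R gram_schmidt w n \<in> span (gram_schmidt w ` {..n})"
    by (intro span_scale span_base) auto
  ultimately show ?thesis using eq span_add by metis
qed

text \<open>A block of the series has squared norm at most the same block of the scalar series, so
  the Cauchy criterion is inherited.\<close>

lemma orthonormal0_summable:
  fixes e :: "nat \<Rightarrow> 'h::{real_inner,banach}"
  assumes "orthonormal0 e" and "summable (\<lambda>i. (c i)\<^sup>2)"
  shows "summable (\<lambda>i. c i *\<^sub>R e i)"
proof (subst summable_Cauchy, intro allI impI)
  fix \<epsilon> :: real assume "0 < \<epsilon>"
  then obtain N where N: "\<And>m n. m \<ge> N \<Longrightarrow> norm (\<Sum>i\<in>{m..<n}. (c i)\<^sup>2) < \<epsilon>\<^sup>2"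
    using assms(2)[unfolded summable_Cauchy] by (meson zero_less_power)
  have "norm (\<Sum>i\<in>{m..<n}. c i *\<^sub>R e i) < \<epsilon>" if "m \<ge> N" for m n
    using orthonormal0_norm_sum_le[OF assms(1), of "{m..<n}" c] N[OF that, of n] \<open>0 < \<epsilon>\<close>
    by (intro power2_less_imp_less[of _ \<epsilon>]) (auto simp: abs_less_iff)
  then show "\<exists>N. \<forall>m\<ge>N. \<forall>n. norm (\<Sum>i\<in>{m..<n}. c i *\<^sub>R e i) < \<epsilon>" by blast
qed

lemma orthonormal0_inner_suminf:
  fixes e :: "nat \<Rightarrow> 'h::{real_inner,banach}"
  assumes "orthonormal0 e" and "summable (\<lambda>i. (c i)\<^sup>2)"
  shows "inner (\<Sum>i. c i *\<^sub>R e i) (e j) = (if e j \<noteq> 0 then c j else 0)"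
proof -
  have "(\<lambda>n. inner (\<Sum>i<n. c i *\<^sub>R e i) (e j)) \<longlonglongrightarrow> inner (\<Sum>i. c i *\<^sub>R e i) (e j)"
    by (intro tendsto_inner summable_LIMSEQ orthonormal0_summable assms tendsto_const)
  moreover have "(\<lambda>n. inner (\<Sum>i<n. c i *\<^sub>R e i) (e j)) \<longlonglongrightarrow> (if e j \<noteq> 0 then c j else 0)"
    by (rule tendsto_eventually, rule eventually_sequentiallyI[of "Suc j"])
      (simp add: orthonormal0_inner_sum[OF assms(1)])
  ultimately show ?thesis by (rule LIMSEQ_unique)
qed

text \<open>Stated through the orthogonal complement, because orthogonality to all test fields is
  what harmonic analysis on the torus can exploit; expansions then follow from completeness.\<close>

definition total_sequence :: "(nat \<Rightarrow> 'h::real_inner) \<Rightarrow> bool" where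
  "total_sequence w \<longleftrightarrow> (\<forall>x. (\<forall>n. inner x (w n) = 0) \<longrightarrow> x = 0)"

lemma total_sequence_gram_schmidt:
  assumes "total_sequence w" shows "total_sequence (gram_schmidt w)"
  unfolding total_sequence_def
proof (intro allI impI)
  fix x assume x: "\<forall>n. inner x (gram_schmidt w n) = 0"
  have "inner x (w n) = 0" for n
    using in_span_gram_schmidt[of w n]
    by (rule span_induct) (auto simp: subspace_def inner_add_right x)
  then show "x = 0" using assms by (auto simp: total_sequence_def)
qed

section \<open>Fourier expansions, Riesz representation and weak limits\<close>

locale orthobasis =
  fixes e :: "nat \<Rightarrow> 'h::{real_inner,banach}"
  assumes on: "orthonormal0 e" and total: "total_sequence e"
begin

lemma summable_coeff: "summable (\<lambda>i. (inner x (e i))\<^sup>2)"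
  by (rule bounded_imp_summable[where B = "(norm x)\<^sup>2"])
    (auto intro: orthonormal0_Bessel[OF on])

lemma expansion: "(\<lambda>i. inner x (e i) *\<^sub>R e i) sums x"
proof -
  let ?y = "\<Sum>i. inner x (e i) *\<^sub>R e i"
  \<comment> \<open>The remainder is orthogonal to every \<open>e j\<close>, the zero vectors
    included, so totality annihilates it.\<close>
  have "\<forall>j. inner (x - ?y) (e j) = 0"
    using orthonormal0_inner_suminf[OF on summable_coeff, of x] by (auto simp: inner_diff_left)
  then have "x - ?y = 0" using total unfolding total_sequence_def by blast
  then have "?y = x" by simp
  with summable_sums[OF orthonormal0_summable[OF on summable_coeff[of x]]] show ?thesis by simp
qed

definition partial :: "nat \<Rightarrow> 'h \<Rightarrow> 'h" where
  "partial n x = (\<Sum>i<n. inner x (e i) *\<^sub>R e i)"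

lemma partial_tendsto: "(\<lambda>n. partial n x) \<longlonglongrightarrow> x"
  using expansion[of x] by (simp add: sums_def partial_def)

lemma norm_partial: "(norm (partial n x))\<^sup>2 = (\<Sum>i<n. (inner x (e i))\<^sup>2)"
  unfolding partial_def orthonormal0_norm_sum[OF on finite_lessThan]
proof (rule sum.cong)
  show "(inner x (e i))\<^sup>2 * (norm (e i))\<^sup>2 = (inner x (e i))\<^sup>2" for i
    using orthonormal0_cases[OF on, of i] by auto
qed simp

lemma norm_partial_le: "norm (partial n x) \<le> norm x"
proof (rule power2_le_imp_le)
  show "(norm (partial n x))\<^sup>2 \<le> (norm x)\<^sup>2"
    unfolding norm_partial by (rule orthonormal0_Bessel[OF on finite_lessThan])
qed simp

text \<open>Let \<open>s\<close> be the sum of the squares of the first coefficients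
  \<open>l (e i)\<close>. Applying \<open>l\<close> to the vector with these coefficients gives
  \<open>s\<^sup>2 \<le> s * C\<^sup>2\<close>, so the coefficients are square summable and define
  the representing vector.\<close>

lemma Riesz:
  fixes l :: "'h \<Rightarrow> real"
  assumes "bounded_linear l"
  obtains y where "\<And>x. l x = inner x y"
proof -
  interpret bounded_linear l by fact
  obtain C where C: "\<And>x. \<bar>l x\<bar> \<le> norm x * C" "0 < C" using pos_bounded by (auto simp: real_norm_def)
  have bound: "(\<Sum>i<n. (l (e i))\<^sup>2) \<le> C\<^sup>2" for n
  proof -
    let ?s = "\<Sum>i<n. (l (e i))\<^sup>2" and ?x = "\<Sum>i<n. l (e i) *\<^sub>R e i"
    have "?s = l ?x" by (simp add: sum scaleR power2_eq_square)
    also have "\<dots> \<le> norm ?x * C" using C(1)[of ?x] by simp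
    finally have "?s \<le> norm ?x * C" .
    then have "?s\<^sup>2 \<le> (norm ?x)\<^sup>2 * C\<^sup>2"
      unfolding power_mult_distrib[symmetric] by (intro power_mono sum_nonneg) auto
    also have "\<dots> \<le> ?s * C\<^sup>2"
      by (intro mult_right_mono orthonormal0_norm_sum_le[OF on]) auto
    finally have *: "?s * ?s \<le> ?s * C\<^sup>2" by (simp add: power2_eq_square)
    have "0 \<le> ?s" by (simp add: sum_nonneg)
    show ?thesis
    proof (cases "?s = 0")
      case False
      then have "0 < ?s" using \<open>0 \<le> ?s\<close> by linarith
      then show ?thesis using * mult_le_cancel_left_pos by blast
    qed simp
  qed
  have sm: "summable (\<lambda>i. (l (e i))\<^sup>2)"
    by (rule bounded_imp_summable[where B = "C\<^sup>2"]) (simp_all only: bound lessThan_Suc_atMost[symmetric] zero_le_power2)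
  define y where "y = (\<Sum>i. l (e i) *\<^sub>R e i)"
  have ly: "l (e j) = inner (e j) y" for j
    using orthonormal0_inner_suminf[OF on sm, of j] zero by (auto simp: y_def inner_commute)
  have "l x = inner x y" for x
  proof (rule LIMSEQ_unique)
    show "(\<lambda>n. l (partial n x)) \<longlonglongrightarrow> l x" by (intro tendsto partial_tendsto)
    have "l (partial n x) = inner (partial n x) y" for n
      by (simp add: partial_def sum scaleR ly inner_sum_left)
    then show "(\<lambda>n. l (partial n x)) \<longlonglongrightarrow> inner x y"
      by (simp add: tendsto_inner partial_tendsto)
  qed
  then show ?thesis by (rule that)
qed

text \<open>Split \<open>y\<close> into a partial sum, where the coefficients decide, and a small
  rest, controlled by the bound. The general filter serves both sequences of approximations and
  limits in time.\<close>

lemma weak_convergence: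
  assumes bdd: "\<forall>\<^sub>F i in F. norm (X i) \<le> R"
    and conv: "\<And>j. ((\<lambda>i. inner (X i) (e j)) \<longlongrightarrow> inner x (e j)) F"
  shows "((\<lambda>i. inner (X i) y) \<longlongrightarrow> inner x y) F"
  unfolding tendsto_iff
proof (intro allI impI)
  fix \<epsilon> :: real assume e: "0 < \<epsilon>"
  \<comment> \<open>\<open>K\<close> bounds \<open>norm (X i - x)\<close>; the final 1 keeps it
    positive.\<close>
  define K where "K = \<bar>R\<bar> + norm x + 1"
  have K: "K > 0" by (simp add: K_def add_nonneg_pos)
  obtain n where n: "norm (y - partial n y) < \<epsilon> / (2 * K)"
    using partial_tendsto[of y, unfolded tendsto_iff, rule_format, of "\<epsilon> / (2*K)"] e K
    by (auto simp: eventually_sequentially dist_norm norm_minus_commute)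
  have "((\<lambda>i. inner (X i) (partial n y)) \<longlongrightarrow> inner x (partial n y)) F"
    unfolding partial_def inner_sum_right inner_scaleR_right
    by (intro tendsto_intros conv)
  then have "\<forall>\<^sub>F i in F. dist (inner (X i) (partial n y)) (inner x (partial n y)) < \<epsilon> / 2"
    using e unfolding tendsto_iff by (meson half_gt_zero)
  with bdd show "\<forall>\<^sub>F i in F. dist (inner (X i) y) (inner x y) < \<epsilon>"
  proof eventually_elim
    case (elim i)
    let ?d = "y - partial n y"
    have "norm (X i - x) \<le> K"
      using elim(1) norm_triangle_ineq4[of "X i" x] by (simp add: K_def)
    then have "\<bar>inner (X i - x) ?d\<bar> \<le> K * (\<epsilon> / (2 * K))"
      using Cauchy_Schwarz_ineq2[of "X i - x" ?d] n K e
      by (intro order_trans[OF _ mult_mono[of "norm (X i - x)" K "norm ?d" "\<epsilon> / (2*K)"]]) auto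
    then have "\<bar>inner (X i - x) ?d\<bar> \<le> \<epsilon> / 2" using K by simp
    moreover have "inner (X i) y - inner x y
        = (inner (X i) (partial n y) - inner x (partial n y)) + inner (X i - x) ?d"
      by (simp add: algebra_simps)
    ultimately show ?case using elim(2) unfolding dist_real_def by linarith
  qed
qed

lemma weak_convergence_functional:
  fixes l :: "'h \<Rightarrow> real"
  assumes "\<forall>\<^sub>F i in F. norm (X i) \<le> R"
    and "\<And>j. ((\<lambda>i. inner (X i) (e j)) \<longlongrightarrow> inner x (e j)) F" and "bounded_linear l"
  shows "((\<lambda>i. l (X i)) \<longlongrightarrow> l x) F"
proof -
  obtain y where "\<And>x. l x = inner x y" using Riesz[OF assms(3)] by blast
  then show ?thesis using weak_convergence[OF assms(1,2)] by simp
qed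

end


section \<open>Step functions of explicit schemes\<close>

lemma abs_integral_le:
  fixes f :: "real \<Rightarrow> real"
  assumes "f integrable_on {a..b}" "a \<le> b" "\<And>x. x \<in> {a..b} \<Longrightarrow> \<bar>f x\<bar> \<le> A"
  shows "\<bar>integral {a..b} f\<bar> \<le> A * (b - a)"
  using integral_norm_bound_integral[OF assms(1), of "\<lambda>_. A"] assms by (auto simp: mult.commute)

lemma step_has_integral:
  fixes a :: "nat \<Rightarrow> real"
  assumes "0 < h"
  shows "((\<lambda>\<tau>. a (nat \<lfloor>\<tau> / h\<rfloor>)) has_integral (\<Sum>k<n. h * a k)) {0..real n * h}"
proof (induction n)
  case (Suc n)
  have "((\<lambda>\<tau>. a n) has_integral h * a n) {real n * h..real (Suc n) * h}"
    using has_integral_const_real[of "a n" "real n * h" "real (Suc n) * h"] assms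
    by (simp add: algebra_simps)
  then have "((\<lambda>\<tau>. a (nat \<lfloor>\<tau> / h\<rfloor>)) has_integral h * a n) {real n * h..real (Suc n) * h}"
  proof (rule has_integral_spike_finite[rotated 2])
    \<comment> \<open>Only at the right end point has the floor already jumped to
      \<open>n + 1\<close>, and one point does not affect the integral.\<close>
    show "finite {real (Suc n) * h}" by simp
    fix \<tau> assume \<tau>: "\<tau> \<in> {real n * h..real (Suc n) * h} - {real (Suc n) * h}"
    then have "real n \<le> \<tau> / h" "\<tau> / h < real n + 1"
      using assms by (auto simp: field_simps)
    then have "\<lfloor>\<tau> / h\<rfloor> = int n" by (simp add: floor_eq_iff)
    then show "a (nat \<lfloor>\<tau> / h\<rfloor>) = a n" by simp
  qed
  with Suc show ?case
    using has_integral_combine[of 0 "real n * h" "real (Suc n) * h"] assms by simp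
qed (simp add: has_integral_refl(2)[of _ "0::real", simplified])

lemma step_integrable:
  fixes a :: "nat \<Rightarrow> real" and h s t :: real
  assumes "0 < h" "0 \<le> s"
  shows "(\<lambda>\<tau>. a (nat \<lfloor>\<tau> / h\<rfloor>)) integrable_on {s..t}"
proof -
  have "t \<le> real (nat \<lceil>t / h\<rceil>) * h"
    using assms(1) real_nat_ceiling_ge[of "t / h"] by (simp add: field_simps)
  then show ?thesis
    using has_integral_integrable[OF step_has_integral[OF assms(1), of a "nat \<lceil>t / h\<rceil>"]] assms(2)
    by (rule_tac integrable_on_subinterval[where S = "{0..real (nat \<lceil>t / h\<rceil>) * h}"]) auto
qed

lemma floor_step_bounds:
  fixes h t :: real
  assumes "0 < h" "0 \<le> t"
  shows "real (nat \<lfloor>t / h\<rfloor>) * h \<le> t" "t - real (nat \<lfloor>t / h\<rfloor>) * h \<le> h"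
proof -
  have r: "real (nat \<lfloor>t / h\<rfloor>) = of_int \<lfloor>t / h\<rfloor>" using assms by simp
  have "of_int \<lfloor>t / h\<rfloor> \<le> t / h" "t / h \<le> of_int \<lfloor>t / h\<rfloor> + 1" by linarith+
  then have "of_int \<lfloor>t / h\<rfloor> * h \<le> t" "t \<le> (of_int \<lfloor>t / h\<rfloor> + 1) * h"
    using assms(1) by (simp_all only: pos_le_divide_eq pos_divide_le_eq)
  then show "real (nat \<lfloor>t / h\<rfloor>) * h \<le> t" "t - real (nat \<lfloor>t / h\<rfloor>) * h \<le> h"
    unfolding r by (simp_all add: algebra_simps)
qed

text \<open>Up to the last node the sum is the integral; what remains is an incomplete step of
  length at most \<open>h\<close>. The bound on \<open>a\<close> is asked only at nodes up to
  \<open>T\<close>, where the scheme is controlled.\<close>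

lemma step_sum_integral:
  fixes a :: "nat \<Rightarrow> real"
  assumes h: "0 < h" and t: "0 \<le> t" "t \<le> T" and A: "\<And>k. real k * h \<le> T \<Longrightarrow> \<bar>a k\<bar> \<le> A"
  shows "\<bar>(\<Sum>k<nat \<lfloor>t / h\<rfloor>. h * a k) - integral {0..t} (\<lambda>\<tau>. a (nat \<lfloor>\<tau> / h\<rfloor>))\<bar> \<le> h * A"
proof -
  let ?n = "nat \<lfloor>t / h\<rfloor>" and ?f = "\<lambda>\<tau>. a (nat \<lfloor>\<tau> / h\<rfloor>)"
  have n: "0 \<le> real ?n * h" "real ?n * h \<le> t" "t - real ?n * h \<le> h"
    using floor_step_bounds[OF h t(1)] h by auto
  have A0: "0 \<le> A" using A[of 0] t by force
  have "integral {0..t} ?f = integral {0..real ?n * h} ?f + integral {real ?n * h..t} ?f"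
    by (rule Henstock_Kurzweil_Integration.integral_combine[symmetric]) (use n step_integrable[OF h] in auto)
  also have "integral {0..real ?n * h} ?f = (\<Sum>k<?n. h * a k)"
    by (rule integral_unique[OF step_has_integral[OF h]])
  finally have "\<bar>(\<Sum>k<?n. h * a k) - integral {0..t} ?f\<bar> = \<bar>integral {real ?n * h..t} ?f\<bar>" by simp
  also have "\<dots> \<le> A * (t - real ?n * h)"
  proof -
    have "\<bar>?f \<tau>\<bar> \<le> A" if "\<tau> \<in> {real ?n * h..t}" for \<tau>
    proof (rule A)
      show "real (nat \<lfloor>\<tau> / h\<rfloor>) * h \<le> T"
        using that n t floor_step_bounds(1)[OF h, of \<tau>] unfolding atLeastAtMost_iff by linarith
    qed
    then show ?thesis by (rule abs_integral_le[OF step_integrable[OF h n(1)] n(2)])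
  qed
  also have "\<dots> \<le> A * h" by (intro mult_left_mono n A0)
  finally show ?thesis by (simp add: mult.commute)
qed

section \<open>Existence by Galerkin approximation\<close>

text \<open>The form \<open>B \<Phi> u u\<close> is the nonlinearity tested with \<open>\<Phi>\<close>; the weight \<open>K \<Phi>\<close> makes
  \<open>u \<mapsto> B \<Phi> u u + K \<Phi> / 2 * |u|\<^sup>2\<close> convex, hence weakly lower semicontinuous.\<close>

locale galerkin = orthobasis e for e :: "nat \<Rightarrow> 'h::{real_inner,banach}" +
  fixes V :: "'h set" and B :: "'h \<Rightarrow> 'h \<Rightarrow> 'h \<Rightarrow> real" and K :: "'h \<Rightarrow> real"
  assumes V: "subspace V" and e_in_V: "e j \<in> V"
    and bilinear: "\<Phi> \<in> V \<Longrightarrow> bounded_bilinear (B \<Phi>)"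
    and B_add: "\<Phi> \<in> V \<Longrightarrow> \<Psi> \<in> V \<Longrightarrow> B (\<Phi> + \<Psi>) u w = B \<Phi> u w + B \<Psi> u w"
    and B_scale: "\<Phi> \<in> V \<Longrightarrow> B (c *\<^sub>R \<Phi>) u w = c * B \<Phi> u w"
    and cancel: "u \<in> V \<Longrightarrow> B u u u = 0"
    and K_nonneg: "\<Phi> \<in> V \<Longrightarrow> 0 \<le> K \<Phi>"
    and convex: "\<Phi> \<in> V \<Longrightarrow> 0 \<le> B \<Phi> u u + K \<Phi> / 2 * (norm u)\<^sup>2"
begin

section \<open>Galerkin systems and their explicit time discretisation\<close>

definition trial :: "nat \<Rightarrow> 'h set" where "trial N = span (e ` {..<N})"

lemma trial_subset_V: "trial N \<subseteq> V"
  unfolding trial_def by (rule span_minimal) (use e_in_V V in auto)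

lemma trial_mono: "M \<le> N \<Longrightarrow> trial M \<subseteq> trial N"
  unfolding trial_def by (rule span_mono) auto

definition drift :: "nat \<Rightarrow> 'h \<Rightarrow> 'h" where
  "drift N u = (\<Sum>j<N. B (e j) u u *\<^sub>R e j)"

text \<open>Both sides are linear in \<open>\<Phi>\<close>, so it is enough to compare them on the
  basis; for a vanishing basis vector both are 0 because \<open>B 0 u u = 0\<close>.\<close>

lemma inner_drift:
  assumes "\<Phi> \<in> trial N" shows "inner (drift N u) \<Phi> = B \<Phi> u u"
proof -
  let ?S = "{\<Phi> \<in> V. inner (drift N u) \<Phi> = B \<Phi> u u}"
  have B0: "B 0 u u = 0" using B_scale[OF e_in_V, of 0] by simp
  have "subspace ?S"
    using V B0 by (auto simp: subspace_def inner_add_right B_add B_scale)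
  moreover have "e ` {..<N} \<subseteq> ?S"
    using e_in_V by (auto simp: drift_def orthonormal0_inner_sum[OF on] B0)
  ultimately have "span (e ` {..<N}) \<subseteq> ?S" by (intro span_minimal)
  then show ?thesis using assms by (auto simp: trial_def)
qed

lemma inner_drift_self: "u \<in> trial N \<Longrightarrow> inner (drift N u) u = 0"
  using inner_drift[of u N u] cancel trial_subset_V by auto

lemma B_bound:
  assumes "\<Phi> \<in> V"
  obtains C where "0 < C" "\<And>u w. \<bar>B \<Phi> u w\<bar> \<le> C * norm u * norm w"
  using bounded_bilinear.pos_bounded[OF bilinear[OF assms]] by (auto simp: algebra_simps)

lemma drift_bound: "\<exists>C\<ge>0. \<forall>u. norm (drift N u) \<le> C * (norm u)\<^sup>2"
proof -
  have "\<forall>j. \<exists>C>0. \<forall>u. \<bar>B (e j) u u\<bar> \<le> C * (norm u)\<^sup>2"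
    using B_bound[OF e_in_V] by (metis mult.assoc power2_eq_square)
  then obtain C where C: "\<And>j. 0 < C j" "\<And>j u. \<bar>B (e j) u u\<bar> \<le> C j * (norm u)\<^sup>2" by metis
  have "norm (drift N u) \<le> (\<Sum>j<N. C j) * (norm u)\<^sup>2" for u
  proof -
    have "norm (drift N u) \<le> (\<Sum>j<N. \<bar>B (e j) u u\<bar> * norm (e j))"
      unfolding drift_def by (rule sum_norm_le) simp
    also have "\<dots> \<le> (\<Sum>j<N. C j * (norm u)\<^sup>2 * 1)"
      by (intro sum_mono mult_mono C orthonormal0_norm_le_1[OF on]) (use C(1) in \<open>auto simp: less_imp_le\<close>)
    finally show ?thesis by (simp add: sum_distrib_right)
  qed
  moreover have "0 \<le> (\<Sum>j<N. C j)" using C(1) by (simp add: sum_nonneg less_imp_le)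
  ultimately show ?thesis by blast
qed

text \<open>An explicit scheme makes the approximation a finite recursion, so no solution theory for
  ordinary differential equations enters. It starts from the projection of the datum, which keeps it
  in the trial space.\<close>

primrec euler :: "nat \<Rightarrow> real \<Rightarrow> 'h \<Rightarrow> nat \<Rightarrow> 'h" where
  "euler N h u0 0 = partial N u0"
| "euler N h u0 (Suc k) = euler N h u0 k + h *\<^sub>R drift N (euler N h u0 k)"

lemma euler_in_trial: "euler N h u0 k \<in> trial N"
proof (induction k)
  case 0
  show ?case unfolding trial_def by (auto simp: partial_def intro!: span_sum span_scale intro: span_base)
next
  case (Suc k)
  have "drift N (euler N h u0 k) \<in> trial N"
    unfolding trial_def drift_def by (auto intro!: span_sum span_scale intro: span_base)
  with Suc show ?case unfolding trial_def by (auto intro!: span_add span_scale)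
qed

lemma inner_euler:
  assumes "\<Phi> \<in> trial N"
  shows "inner (euler N h u0 n - euler N h u0 0) \<Phi>
    = (\<Sum>k<n. h * B \<Phi> (euler N h u0 k) (euler N h u0 k))"
  by (induction n) (simp_all add: inner_diff_left inner_add_left inner_drift[OF assms] algebra_simps)

text \<open>The explicit scheme creates energy only at second order in the step size, since the drift is
  orthogonal to the state.\<close>

lemma euler_energy:
  assumes "0 < T" "0 < \<epsilon>"
  shows "\<exists>h>0. h \<le> \<epsilon> \<and> (\<forall>k. real k * h \<le> T \<longrightarrow> (norm (euler N h u0 k))\<^sup>2 \<le> (norm u0)\<^sup>2 + \<epsilon>)"
proof -
  obtain C where C: "C \<ge> 0" "\<And>u. norm (drift N u) \<le> C * (norm u)\<^sup>2" using drift_bound by blast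
  \<comment> \<open>All states up to time \<open>T\<close> will stay in the ball of squared radius
    \<open>R\<close>, on which \<open>A\<close> bounds the squared drift. The step is chosen so that
    the total gain \<open>T * h * A\<close> is at most \<open>\<epsilon>\<close>;
    \<open>A + 1\<close> keeps the divisor positive.\<close>
  define R where "R = (norm u0)\<^sup>2 + \<epsilon>"
  define A where "A = (C * R)\<^sup>2"
  define h where "h = min \<epsilon> (\<epsilon> / (T * (A + 1)))"
  have R: "0 < R" using assms by (simp add: R_def add_nonneg_pos)
  have A: "0 \<le> A" by (simp add: A_def)
  have h: "0 < h" "h \<le> \<epsilon>" using assms A by (auto simp: h_def)
  have "h * (T * (A + 1)) \<le> \<epsilon>"
    using assms A by (subst pos_le_divide_eq[symmetric]) (auto simp: h_def)
  moreover have "h * (T * A) \<le> h * (T * (A + 1))"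
    using h assms by (intro mult_left_mono) auto
  ultimately have hT: "T * h * A \<le> \<epsilon>" by (simp add: mult_ac)
  \<comment> \<open>The accumulated gain must be carried explicitly through the induction: it places
    the current state in the ball, only there does the drift bound apply, and this yields the next
    gain \<open>h\<^sup>2 * A\<close>.\<close>
  have "real k * h \<le> T \<Longrightarrow> (norm (euler N h u0 k))\<^sup>2 \<le> (norm u0)\<^sup>2 + real k * h\<^sup>2 * A" for k
  proof (induction k)
    case 0
    show ?case using norm_partial_le[of N u0] by (simp add: power_mono)
  next
    case (Suc k)
    let ?x = "euler N h u0 k"
    have kT: "real k * h \<le> T" using Suc.prems h(1) by (simp add: algebra_simps)
    have "real k * h\<^sup>2 * A = (real k * h) * (h * A)" by (simp add: power2_eq_square)
    also have "\<dots> \<le> T * (h * A)" using kT h A by (intro mult_right_mono) auto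
    finally have "(norm ?x)\<^sup>2 \<le> R" using Suc.IH[OF kT] hT by (simp add: R_def mult.assoc)
    then have "norm (drift N ?x) \<le> C * R"
      using C(2)[of ?x] C(1) by (meson mult_left_mono order_trans)
    then have d: "(norm (drift N ?x))\<^sup>2 \<le> A" unfolding A_def by (rule power_mono) simp
    have "(norm (?x + h *\<^sub>R drift N ?x))\<^sup>2 = (norm ?x)\<^sup>2 + h\<^sup>2 * (norm (drift N ?x))\<^sup>2"
      using inner_drift_self[OF euler_in_trial, of N h u0 k]
      unfolding power2_norm_eq_inner
      by (simp add: inner_add_left inner_add_right inner_commute power2_eq_square)
    also have "\<dots> \<le> (norm u0)\<^sup>2 + real k * h\<^sup>2 * A + h\<^sup>2 * A"
      using Suc.IH[OF kT] d by (intro add_mono mult_left_mono) auto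
    finally show ?case by (simp add: algebra_simps)
  qed
  moreover have "real k * h\<^sup>2 * A \<le> \<epsilon>" if "real k * h \<le> T" for k
  proof -
    have "real k * h\<^sup>2 * A = (real k * h) * (h * A)" by (simp add: power2_eq_square)
    also have "\<dots> \<le> T * (h * A)" using that h A by (intro mult_right_mono) auto
    finally show ?thesis using hT by (simp add: mult.assoc)
  qed
  ultimately show ?thesis using h by (intro exI[of _ h]) force
qed

text \<open>One index \<open>N\<close> controls trial space, step size and energy error together.
  Each \<open>X N\<close> is a step function in time, which explains integrability for arbitrary
  \<open>g\<close>.\<close>

lemma approximants:
  assumes T: "0 < T"
  obtains X :: "nat \<Rightarrow> real \<Rightarrow> 'h" where
    "\<And>N t. t \<in> {0..T} \<Longrightarrow> (norm (X N t))\<^sup>2 \<le> (norm u0)\<^sup>2 + inverse (real (Suc N))"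
    "\<And>N. X N 0 = partial N u0"
    "\<And>N g s t. 0 \<le> s \<Longrightarrow> (\<lambda>\<tau>. (g :: 'h \<Rightarrow> real) (X N \<tau>)) integrable_on {s..t}"
    "\<And>N \<Phi> A t. \<Phi> \<in> trial N \<Longrightarrow> t \<in> {0..T} \<Longrightarrow>
       (\<And>u. (norm u)\<^sup>2 \<le> (norm u0)\<^sup>2 + 1 \<Longrightarrow> \<bar>B \<Phi> u u\<bar> \<le> A) \<Longrightarrow>
       \<bar>inner (X N t - X N 0) \<Phi> - integral {0..t} (\<lambda>\<tau>. B \<Phi> (X N \<tau>) (X N \<tau>))\<bar> \<le> inverse (real (Suc N)) * A"
proof -
  have "\<forall>N. \<exists>h>0. h \<le> inverse (real (Suc N)) \<and>
      (\<forall>k. real k * h \<le> T \<longrightarrow> (norm (euler N h u0 k))\<^sup>2 \<le> (norm u0)\<^sup>2 + inverse (real (Suc N)))"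
    using euler_energy[OF T] by simp
  then obtain h where h: "\<And>N. 0 < h N" "\<And>N. h N \<le> inverse (real (Suc N))"
    and E: "\<And>N k. real k * h N \<le> T \<Longrightarrow>
        (norm (euler N (h N) u0 k))\<^sup>2 \<le> (norm u0)\<^sup>2 + inverse (real (Suc N))" by metis
  define X where "X N t = euler N (h N) u0 (nat \<lfloor>t / h N\<rfloor>)" for N t
  show ?thesis
  proof
    show "(norm (X N t))\<^sup>2 \<le> (norm u0)\<^sup>2 + inverse (real (Suc N))" if "t \<in> {0..T}" for N t
      unfolding X_def using that floor_step_bounds(1)[OF h(1)[of N], of t] by (intro E) auto
    show X0: "X N 0 = partial N u0" for N by (simp add: X_def)
    show "(\<lambda>\<tau>. g (X N \<tau>)) integrable_on {s..t}" if "0 \<le> s" for N s t and g :: "'h \<Rightarrow> real"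
      unfolding X_def by (rule step_integrable[OF h(1) that])
    fix N \<Phi> A t
    assume \<Phi>: "\<Phi> \<in> trial N" and t: "t \<in> {0..T}"
      and A: "\<And>u. (norm u)\<^sup>2 \<le> (norm u0)\<^sup>2 + 1 \<Longrightarrow> \<bar>B \<Phi> u u\<bar> \<le> A"
    let ?a = "\<lambda>k. B \<Phi> (euler N (h N) u0 k) (euler N (h N) u0 k)"
    have a: "\<bar>?a k\<bar> \<le> A" if "real k * h N \<le> T" for k
    proof (rule A)
      have "inverse (real (Suc N)) \<le> 1" by (simp add: field_simps)
      then show "(norm (euler N (h N) u0 k))\<^sup>2 \<le> (norm u0)\<^sup>2 + 1" using E[OF that] by linarith
    qed
    have "inner (X N t - X N 0) \<Phi> = (\<Sum>k<nat \<lfloor>t / h N\<rfloor>. h N * ?a k)"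
      using inner_euler[OF \<Phi>, of "h N" u0 "nat \<lfloor>t / h N\<rfloor>"] by (simp add: X_def)
    then have "\<bar>inner (X N t - X N 0) \<Phi> - integral {0..t} (\<lambda>\<tau>. B \<Phi> (X N \<tau>) (X N \<tau>))\<bar> \<le> h N * A"
      using step_sum_integral[OF h(1), of t T N ?a A] t a by (simp add: X_def)
    also have "\<dots> \<le> inverse (real (Suc N)) * A"
      using a[of 0] T h(2) by (intro mult_right_mono) (auto intro: order_trans[OF abs_ge_zero])
    finally show "\<bar>inner (X N t - X N 0) \<Phi> - integral {0..t} (\<lambda>\<tau>. B \<Phi> (X N \<tau>) (X N \<tau>))\<bar>
        \<le> inverse (real (Suc N)) * A" .
  qed
qed

end


section \<open>Measurability along weakly continuous paths\<close>

context orthobasis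
begin

text \<open>The path need not be continuous in norm, but its finite partial sums are. Along these
  \<open>g\<close> is continuous in time, and it converges pointwise because each \<open>g t\<close>
  is continuous in norm.\<close>

lemma weakly_continuous_measurable:
  fixes g :: "real \<Rightarrow> 'h \<Rightarrow> real"
  assumes u: "\<And>j. continuous_on {a..b} (\<lambda>t. inner (u t) (e j))"
    and g: "continuous_on ({a..b} \<times> UNIV) (\<lambda>(t, x). g t x)"
  shows "(\<lambda>t. g t (u t)) \<in> borel_measurable (lebesgue_on {a..b})"
proof (rule borel_measurable_LIMSEQ_real)
  have c: "continuous_on {a..b} (\<lambda>t. partial n (u t))" for n
    unfolding partial_def by (intro continuous_intros u)
  have "continuous_on {a..b} ((\<lambda>(t, x). g t x) \<circ> (\<lambda>t. (t, partial n (u t))))" for n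
    by (intro continuous_on_compose continuous_intros c continuous_on_subset[OF g]) auto
  then show "(\<lambda>t. g t (partial n (u t))) \<in> borel_measurable (lebesgue_on {a..b})" for n
    by (intro continuous_imp_measurable_on_sets_lebesgue) (auto simp: o_def)
  fix t assume "t \<in> space (lebesgue_on {a..b})"
  then have t: "t \<in> {a..b}" by simp
  have "continuous_on UNIV (\<lambda>x. g t x)"
  proof -
    have "continuous_on UNIV (\<lambda>x. case (t, x) of (t, x) \<Rightarrow> g t x)"
      by (rule continuous_on_compose2[OF g]) (use t in \<open>auto intro!: continuous_on_Pair\<close>)
    then show ?thesis by simp
  qed
  then show "(\<lambda>n. g t (partial n (u t))) \<longlonglongrightarrow> g t (u t)"
    by (rule continuous_on_tendsto_compose[OF _ partial_tendsto]) auto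
qed

end

section \<open>Lower semicontinuity, compactness and the limit of the scheme\<close>

context galerkin
begin

definition cost :: "'h \<Rightarrow> 'h \<Rightarrow> real" where
  "cost \<Phi> u = B \<Phi> u u + K \<Phi> / 2 * (norm u)\<^sup>2"

lemma cost_continuous:
  assumes "\<Phi> \<in> V" shows "continuous_on A (cost \<Phi>)"
  unfolding cost_def
  by (intro continuous_intros bounded_bilinear.continuous_on[OF bilinear[OF assms]])

lemma cost_bound:
  assumes "\<Phi> \<in> V"
  shows "\<exists>A. \<forall>u. (norm u)\<^sup>2 \<le> R \<longrightarrow> \<bar>B \<Phi> u u\<bar> \<le> A \<and> \<bar>cost \<Phi> u\<bar> \<le> A"
proof -
  obtain C where C: "0 < C" "\<And>u w. \<bar>B \<Phi> u w\<bar> \<le> C * norm u * norm w"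
    using B_bound[OF assms] by blast
  have "\<bar>B \<Phi> u u\<bar> \<le> C * R + K \<Phi> / 2 * R \<and> \<bar>cost \<Phi> u\<bar> \<le> C * R + K \<Phi> / 2 * R" if "(norm u)\<^sup>2 \<le> R" for u
  proof -
    have "\<bar>B \<Phi> u u\<bar> \<le> C * (norm u)\<^sup>2" using C(2)[of u u] by (simp add: power2_eq_square mult.assoc)
    also have "\<dots> \<le> C * R" using C(1) that by simp
    finally have 1: "\<bar>B \<Phi> u u\<bar> \<le> C * R" .
    have 2: "0 \<le> K \<Phi> / 2 * (norm u)\<^sup>2" "K \<Phi> / 2 * (norm u)\<^sup>2 \<le> K \<Phi> / 2 * R"
      using that K_nonneg[OF assms] by (auto intro!: mult_left_mono)
    with 1 show ?thesis unfolding cost_def by linarith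
  qed
  then show ?thesis by blast
qed

text \<open>The remainder in the expansion of the quadratic function at \<open>u\<close> is
  \<open>cost \<Phi> (x - u)\<close>, which is nonnegative. This is the tangent inequality of a
  convex function.\<close>

lemma cost_lower:
  assumes "\<Phi> \<in> V"
  shows "cost \<Phi> u + B \<Phi> u (x - u) + B \<Phi> (x - u) u + K \<Phi> * inner u (x - u) \<le> cost \<Phi> x"
proof -
  interpret b: bounded_bilinear "B \<Phi>" by (rule bilinear[OF assms])
  define d where "d = x - u"
  have x: "x = u + d" by (simp add: d_def)
  have n: "(norm (u + d))\<^sup>2 = (norm u)\<^sup>2 + 2 * inner u d + (norm d)\<^sup>2"
    unfolding power2_norm_eq_inner by (simp add: inner_add_left inner_add_right inner_commute)
  have "cost \<Phi> x = cost \<Phi> u + B \<Phi> u d + B \<Phi> d u + K \<Phi> * inner u d + cost \<Phi> d"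
  proof -
    have "B \<Phi> (u + d) (u + d) = B \<Phi> u u + B \<Phi> u d + B \<Phi> d u + B \<Phi> d d"
      by (simp add: b.add_left b.add_right)
    moreover have "K \<Phi> / 2 * ((norm u)\<^sup>2 + 2 * inner u d + (norm d)\<^sup>2)
        = K \<Phi> / 2 * (norm u)\<^sup>2 + K \<Phi> * inner u d + K \<Phi> / 2 * (norm d)\<^sup>2"
      by (simp add: distrib_left)
    ultimately show ?thesis unfolding cost_def x n by linarith
  qed
  moreover have "0 \<le> cost \<Phi> d" unfolding cost_def by (rule convex[OF assms])
  ultimately show ?thesis by (simp add: d_def)
qed

text \<open>Lower semicontinuity is phrased as convergence of the minimum with the limit value, the
  form that dominated convergence can use directly.\<close>

lemma cost_lsc:
  assumes \<Phi>: "\<Phi> \<in> V" and "\<And>n. norm (X n) \<le> R"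
    and "\<And>j. (\<lambda>n. inner (X n) (e j)) \<longlonglongrightarrow> inner u (e j)"
  shows "(\<lambda>n. min (cost \<Phi> (X n)) (cost \<Phi> u)) \<longlonglongrightarrow> cost \<Phi> u"
proof -
  interpret b: bounded_bilinear "B \<Phi>" by (rule bilinear[OF \<Phi>])
  \<comment> \<open>\<open>l\<close> is the derivative of \<open>cost \<Phi>\<close> at
    \<open>u\<close>. It is bounded and linear, hence continuous for weak convergence.\<close>
  define l where "l x = B \<Phi> u x + B \<Phi> x u + K \<Phi> * inner u x" for x
  have "bounded_linear l"
    unfolding l_def
    by (intro bounded_linear_add b.bounded_linear_left b.bounded_linear_right
        bounded_linear_const_mult bounded_linear_inner_right)
  then have "(\<lambda>n. l (X n)) \<longlonglongrightarrow> l u"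
    using weak_convergence_functional[of X R sequentially u l] assms by auto
  then have "(\<lambda>n. cost \<Phi> u + (l (X n) - l u)) \<longlonglongrightarrow> cost \<Phi> u + (l u - l u)"
    by (intro tendsto_intros)
  then have lim: "(\<lambda>n. min (cost \<Phi> u + (l (X n) - l u)) (cost \<Phi> u)) \<longlonglongrightarrow> min (cost \<Phi> u) (cost \<Phi> u)"
    by (intro tendsto_min) auto
  have le: "cost \<Phi> u + (l (X n) - l u) \<le> cost \<Phi> (X n)" for n
  proof -
    have "l (X n) - l u = B \<Phi> u (X n - u) + B \<Phi> (X n - u) u + K \<Phi> * inner u (X n - u)"
      by (simp add: l_def b.diff_left b.diff_right inner_diff_right right_diff_distrib)
    then show ?thesis using cost_lower[OF \<Phi>, of u "X n"] by linarith
  qed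
  have min_le: "min (cost \<Phi> u + (l (X n) - l u)) (cost \<Phi> u) \<le> min (cost \<Phi> (X n)) (cost \<Phi> u)" for n
    using le[of n] by linarith
  show ?thesis
  proof (rule tendsto_sandwich)
    show "(\<lambda>n. min (cost \<Phi> u + (l (X n) - l u)) (cost \<Phi> u)) \<longlonglongrightarrow> cost \<Phi> u"
      using lim by simp
    show "\<forall>\<^sub>F n in sequentially. min (cost \<Phi> u + (l (X n) - l u)) (cost \<Phi> u) \<le> min (cost \<Phi> (X n)) (cost \<Phi> u)"
      by (rule always_eventually[OF allI[OF min_le]])
  qed (auto intro: tendsto_const)
qed

text \<open>Coefficients converge along a diagonal subsequence at rational times, approximate
  equicontinuity carries this to all times, and convexity passes the scheme to the limit. The
  inequality is kept on every subinterval, so that test fields can later be frozen on short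
  intervals.\<close>

theorem weak_solution_exists:
  assumes T: "0 < T"
  obtains u :: "real \<Rightarrow> 'h" where "u 0 = u0"
    "\<And>t. t \<in> {0..T} \<Longrightarrow> norm (u t) \<le> norm u0"
    "\<And>y. continuous_on {0..T} (\<lambda>t. inner (u t) y)"
    "\<And>N \<Phi> s t. \<Phi> \<in> trial N \<Longrightarrow> 0 \<le> s \<Longrightarrow> s \<le> t \<Longrightarrow> t \<le> T \<Longrightarrow>
       integral {s..t} (\<lambda>\<tau>. cost \<Phi> (u \<tau>)) - K \<Phi> / 2 * (norm u0)\<^sup>2 * (t - s) \<le> inner (u t - u s) \<Phi>"
proof -
  let ?R = "(norm u0)\<^sup>2 + 1" and ?\<epsilon> = "\<lambda>N. inverse (real (Suc N))"
  obtain X :: "nat \<Rightarrow> real \<Rightarrow> 'h" where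
    X_norm: "\<And>N t. t \<in> {0..T} \<Longrightarrow> (norm (X N t))\<^sup>2 \<le> (norm u0)\<^sup>2 + ?\<epsilon> N"
    and X_0: "\<And>N. X N 0 = partial N u0"
    and X_int: "\<And>N g s t. 0 \<le> s \<Longrightarrow> (\<lambda>\<tau>. (g :: 'h \<Rightarrow> real) (X N \<tau>)) integrable_on {s..t}"
    and X_eq: "\<And>N \<Phi> A t. \<Phi> \<in> trial N \<Longrightarrow> t \<in> {0..T} \<Longrightarrow>
       (\<And>u. (norm u)\<^sup>2 \<le> ?R \<Longrightarrow> \<bar>B \<Phi> u u\<bar> \<le> A) \<Longrightarrow>
       \<bar>inner (X N t - X N 0) \<Phi> - integral {0..t} (\<lambda>\<tau>. B \<Phi> (X N \<tau>) (X N \<tau>))\<bar> \<le> ?\<epsilon> N * A"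
    using approximants[OF T, of u0] by blast
  have \<epsilon>1: "?\<epsilon> N \<le> 1" for N by (simp add: field_simps)
  have X_R: "(norm (X N t))\<^sup>2 \<le> ?R" if "t \<in> {0..T}" for N t
    using X_norm[OF that, of N] \<epsilon>1[of N] by linarith
  have X_sqrt: "norm (X N t) \<le> sqrt ?R" if "t \<in> {0..T}" for N t
    using X_R[OF that] real_le_rsqrt by blast
  have \<epsilon>0: "?\<epsilon> \<longlonglongrightarrow> 0" by (rule LIMSEQ_inverse_real_of_nat)
  \<comment> \<open>The scheme is compared with time 0 only; subtracting the estimates at
    \<open>s\<close> and \<open>t\<close> doubles the error.\<close>
  have X_diff: "\<bar>inner (X N t - X N s) \<Phi> - integral {s..t} (\<lambda>\<tau>. B \<Phi> (X N \<tau>) (X N \<tau>))\<bar> \<le> 2 * ?\<epsilon> N * A"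
    if "\<Phi> \<in> trial N" "0 \<le> s" "s \<le> t" "t \<le> T" "\<And>u. (norm u)\<^sup>2 \<le> ?R \<Longrightarrow> \<bar>B \<Phi> u u\<bar> \<le> A" for N \<Phi> A s t
  proof -
    let ?f = "\<lambda>\<tau>. B \<Phi> (X N \<tau>) (X N \<tau>)"
    have "integral {0..s} ?f + integral {s..t} ?f = integral {0..t} ?f"
      using that by (intro Henstock_Kurzweil_Integration.integral_combine X_int) auto
    moreover have "inner (X N t - X N s) \<Phi> = inner (X N t - X N 0) \<Phi> - inner (X N s - X N 0) \<Phi>"
      by (simp add: inner_diff_left)
    ultimately show ?thesis
      using X_eq[OF that(1) _ that(5), of t] X_eq[OF that(1) _ that(5), of s] that(2-4)
      unfolding atLeastAtMost_iff by linarith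
  qed
  have e_trial: "e j \<in> trial N" if "j < N" for j N
    using that unfolding trial_def by (auto intro: span_base)
  have "\<exists>A. \<forall>u. (norm u)\<^sup>2 \<le> ?R \<longrightarrow> \<bar>B (e j) u u\<bar> \<le> A" for j
    using cost_bound[OF e_in_V, of ?R j] by blast
  then obtain A where A: "\<And>j u. (norm u)\<^sup>2 \<le> ?R \<Longrightarrow> \<bar>B (e j) u u\<bar> \<le> A j" by metis
  have A0: "0 \<le> A j" for j using A[of 0 j] by force
  \<comment> \<open>Equicontinuity up to an error that vanishes with \<open>N\<close>, since the
    approximations jump in time. The restriction \<open>j < N\<close> makes \<open>e j\<close>
    admissible as a test vector.\<close>
  have equi: "\<bar>inner (X N t) (e j) - inner (X N s) (e j)\<bar> \<le> A j * \<bar>t - s\<bar> + 2 * ?\<epsilon> N * A j"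
    if "j < N" "s \<in> {0..T}" "t \<in> {0..T}" for N j s t
    using that(2,3)
  proof (induction s t rule: linorder_wlog)
    case (le s t)
    let ?f = "\<lambda>\<tau>. B (e j) (X N \<tau>) (X N \<tau>)"
    have "\<bar>integral {s..t} ?f\<bar> \<le> A j * (t - s)"
      using le by (intro abs_integral_le X_int A X_R) auto
    show ?case
    proof -
      have "\<bar>inner (X N t - X N s) (e j) - integral {s..t} ?f\<bar> \<le> 2 * ?\<epsilon> N * A j"
        using le by (intro X_diff e_trial that(1) A) auto
      then show ?thesis
        using \<open>\<bar>integral {s..t} ?f\<bar> \<le> A j * (t - s)\<close> le(1) unfolding inner_diff_left by linarith
    qed
  qed (simp add: abs_minus_commute)
  \<comment> \<open>Basis indices and rational times together form a countable set, so one
    subsequence serves them all.\<close>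
  let ?D = "UNIV \<times> (\<rat> \<inter> {0..T}) :: (nat \<times> real) set"
  define f where "f N x = inner (X N (snd x)) (e (fst x))" for N and x :: "nat \<times> real"
  have cnt: "countable ?D" by (intro countable_SIGMA countable_Int1 countable_rat) auto
  have bnd: "norm (f N x) \<le> sqrt ?R" if xD: "x \<in> ?D" for N x
  proof -
    obtain j t where x: "x = (j, t)" "t \<in> {0..T}" using xD by (cases x) auto
    have "\<bar>inner (X N t) (e j)\<bar> \<le> norm (X N t) * norm (e j)" by (rule Cauchy_Schwarz_ineq2)
    also have "\<dots> \<le> norm (X N t) * 1"
      by (intro mult_left_mono orthonormal0_norm_le_1[OF on]) auto
    finally show ?thesis using X_sqrt[OF x(2), of N] x(1) by (simp add: f_def)
  qed
  obtain k where k: "strict_mono (k :: nat \<Rightarrow> nat)"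
    and conv: "\<And>x. x \<in> ?D \<Longrightarrow> \<exists>l. (\<lambda>n. f (k n) x) \<longlonglongrightarrow> l"
    by (rule function_convergent_subsequence[where f = f, OF cnt bnd]) auto
  have k0: "(\<lambda>n. ?\<epsilon> (k n)) \<longlonglongrightarrow> 0" using LIMSEQ_subseq_LIMSEQ[OF \<epsilon>0 k] by (simp add: o_def)
  have ev: "\<forall>\<^sub>F n in sequentially. j < k n" for j
    using seq_suble[OF k] by (intro eventually_sequentiallyI[of "Suc j"]) (meson Suc_le_lessD order_trans)
  have Cau: "Cauchy (\<lambda>n. inner (X (k n) t) (e j))" if t: "t \<in> {0..T}" for t j
  proof (rule metric_CauchyI)
    fix \<epsilon> :: real assume \<epsilon>: "0 < \<epsilon>"
    \<comment> \<open>One half of the allowance \<open>\<epsilon> / 4\<close> in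
      \<open>close\<close> goes to the time difference, the other to the error of the
      scheme.\<close>
    define \<delta> where "\<delta> = \<epsilon> / (8 * (A j + 1))"
    have \<delta>: "0 < \<delta>" "A j * \<delta> \<le> \<epsilon> / 8" using \<epsilon> A0[of j] by (auto simp: \<delta>_def field_simps)
    obtain s where s: "s \<in> \<rat>" "s \<in> {0..T}" "\<bar>t - s\<bar> < \<delta>"
    \<comment> \<open>\<open>T\<close> may be irrational: the rational neighbour lies to the right
      of \<open>t\<close> before \<open>T\<close>, and to the left at \<open>T\<close>
      itself.\<close>
    proof (cases "t < T")
      case True
      then obtain q :: real where "q \<in> \<rat>" "t < q" "q < min T (t + \<delta>)"
        using Rats_dense_in_real[of t "min T (t + \<delta>)"] \<delta> by auto
      then show ?thesis using t that[of q] by auto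
    next
      case False
      then have "t = T" using t by auto
      moreover obtain q :: real where "q \<in> \<rat>" "max 0 (T - \<delta>) < q" "q < T"
        using Rats_dense_in_real[of "max 0 (T - \<delta>)" T] \<delta> T by auto
      ultimately show ?thesis using that[of q] by auto
    qed
    have "Cauchy (\<lambda>n. inner (X (k n) s) (e j))"
      using conv[of "(j, s)"] s by (auto simp: f_def intro: LIMSEQ_imp_Cauchy)
    then obtain M where M: "\<And>m n. m \<ge> M \<Longrightarrow> n \<ge> M \<Longrightarrow>
        \<bar>inner (X (k m) s) (e j) - inner (X (k n) s) (e j)\<bar> < \<epsilon> / 4"
      using \<epsilon> unfolding Cauchy_def dist_real_def by (meson divide_pos_pos zero_less_numeral)
    have "(\<lambda>n. 2 * ?\<epsilon> (k n) * A j) \<longlonglongrightarrow> 2 * 0 * A j" by (intro tendsto_intros k0)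
    then have "\<forall>\<^sub>F n in sequentially. 2 * ?\<epsilon> (k n) * A j < \<epsilon> / 8"
      using \<epsilon> by (intro order_tendstoD) auto
    then have "\<forall>\<^sub>F n in sequentially. 2 * ?\<epsilon> (k n) * A j < \<epsilon> / 8 \<and> j < k n"
      using ev by (rule eventually_conj)
    then obtain M' where M': "\<And>n. n \<ge> M' \<Longrightarrow> 2 * ?\<epsilon> (k n) * A j < \<epsilon> / 8 \<and> j < k n"
      by (auto simp: eventually_sequentially)
    have close: "\<bar>inner (X (k n) t) (e j) - inner (X (k n) s) (e j)\<bar> \<le> \<epsilon> / 4" if "n \<ge> M'" for n
    proof -
      have "A j * \<bar>t - s\<bar> \<le> A j * \<delta>" using s(3) A0[of j] by (intro mult_left_mono) auto
      then show ?thesis using equi[of j "k n" s t] M'[OF that] s(2) t \<delta>(2) by linarith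
    qed
    have "dist (inner (X (k m) t) (e j)) (inner (X (k n) t) (e j)) < \<epsilon>"
      if "m \<ge> max M M'" "n \<ge> max M M'" for m n
    proof -
      have "M \<le> m" "M' \<le> m" "M \<le> n" "M' \<le> n" using that by auto
      then show ?thesis using close[of m] close[of n] M[of m n] unfolding dist_real_def by linarith
    qed
    then show "\<exists>M. \<forall>m\<ge>M. \<forall>n\<ge>M. dist (inner (X (k m) t) (e j)) (inner (X (k n) t) (e j)) < \<epsilon>" by blast
  qed
  define c where "c j t = lim (\<lambda>n. inner (X (k n) t) (e j))" for j t
  have c: "(\<lambda>n. inner (X (k n) t) (e j)) \<longlonglongrightarrow> c j t" if "t \<in> {0..T}" for j t
    unfolding c_def using Cau[OF that] by (simp add: Cauchy_convergent_iff convergent_LIMSEQ_iff)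
  \<comment> \<open>The energy error disappears in the limit. The bound by \<open>norm u0\<close>
    exactly is what a constant \<open>E\<close> equal to the initial energy and the strong initial
    limit both require.\<close>
  have c_sum: "(\<Sum>j<n. (c j t)\<^sup>2) \<le> (norm u0)\<^sup>2" if t: "t \<in> {0..T}" for n t
  proof (rule LIMSEQ_le)
    show "(\<lambda>i. \<Sum>j<n. (inner (X (k i) t) (e j))\<^sup>2) \<longlonglongrightarrow> (\<Sum>j<n. (c j t)\<^sup>2)"
      by (intro tendsto_intros c t)
    have "(\<lambda>i. (norm u0)\<^sup>2 + ?\<epsilon> (k i)) \<longlonglongrightarrow> (norm u0)\<^sup>2 + 0" by (intro tendsto_intros k0)
    then show "(\<lambda>i. (norm u0)\<^sup>2 + ?\<epsilon> (k i)) \<longlonglongrightarrow> (norm u0)\<^sup>2" by simp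
    show "\<exists>N. \<forall>i\<ge>N. (\<Sum>j<n. (inner (X (k i) t) (e j))\<^sup>2) \<le> (norm u0)\<^sup>2 + ?\<epsilon> (k i)"
      using orthonormal0_Bessel[OF on, of "{..<n}"] X_norm[OF t] by (meson finite_lessThan order_trans)
  qed
  have c_summable: "summable (\<lambda>j. (c j t)\<^sup>2)" if "t \<in> {0..T}" for t
    by (rule bounded_imp_summable[where B = "(norm u0)\<^sup>2"])
      (simp_all only: c_sum[OF that] lessThan_Suc_atMost[symmetric] zero_le_power2)
  define u where "u t = (\<Sum>j. c j t *\<^sub>R e j)" for t
  have u_e: "inner (u t) (e j) = c j t" if t: "t \<in> {0..T}" for t j
  proof -
    have "c j t = 0" if "e j = 0"
      using c[OF t, of j] that LIMSEQ_unique[OF tendsto_const[of "0::real"]] by auto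
    then show ?thesis
      using orthonormal0_inner_suminf[OF on c_summable[OF t], of j] by (auto simp: u_def)
  qed
  have u_norm: "norm (u t) \<le> norm u0" if t: "t \<in> {0..T}" for t
  proof (rule power2_le_imp_le)
    have "(\<lambda>n. (norm (partial n (u t)))\<^sup>2) \<longlonglongrightarrow> (norm (u t))\<^sup>2"
      by (intro tendsto_intros partial_tendsto)
    then show "(norm (u t))\<^sup>2 \<le> (norm u0)\<^sup>2"
      by (rule LIMSEQ_le_const2) (auto simp: norm_partial u_e[OF t] c_sum[OF t])
  qed simp
  have X_u: "(\<lambda>n. inner (X (k n) t) (e j)) \<longlonglongrightarrow> inner (u t) (e j)" if "t \<in> {0..T}" for t j
    using c[OF that] u_e[OF that] by simp
  have "inner (u 0) (e j) = inner u0 (e j)" for j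
  proof (rule LIMSEQ_unique)
    show "(\<lambda>n. inner (X (k n) 0) (e j)) \<longlonglongrightarrow> inner (u 0) (e j)" using X_u T by simp
    have "(\<lambda>n. partial (k n) u0) \<longlonglongrightarrow> u0"
      using LIMSEQ_subseq_LIMSEQ[OF partial_tendsto k] by (simp add: o_def)
    then show "(\<lambda>n. inner (X (k n) 0) (e j)) \<longlonglongrightarrow> inner u0 (e j)"
      unfolding X_0 by (intro tendsto_intros)
  qed
  then have u_0: "u 0 = u0"
    using total[unfolded total_sequence_def, rule_format, of "u 0 - u0"] by (simp add: inner_diff_left)
  have lip: "\<bar>inner (u t) (e j) - inner (u s) (e j)\<bar> \<le> A j * \<bar>t - s\<bar>"
    if st: "s \<in> {0..T}" "t \<in> {0..T}" for s t j
  proof (rule tendsto_le[OF sequentially_bot])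
    show "(\<lambda>n. \<bar>inner (X (k n) t) (e j) - inner (X (k n) s) (e j)\<bar>) \<longlonglongrightarrow> \<bar>inner (u t) (e j) - inner (u s) (e j)\<bar>"
      by (intro tendsto_intros X_u st)
    have "(\<lambda>n. A j * \<bar>t - s\<bar> + 2 * ?\<epsilon> (k n) * A j) \<longlonglongrightarrow> A j * \<bar>t - s\<bar> + 2 * 0 * A j"
      by (intro tendsto_intros k0)
    then show "(\<lambda>n. A j * \<bar>t - s\<bar> + 2 * ?\<epsilon> (k n) * A j) \<longlonglongrightarrow> A j * \<bar>t - s\<bar>" by simp
    show "\<forall>\<^sub>F n in sequentially. \<bar>inner (X (k n) t) (e j) - inner (X (k n) s) (e j)\<bar>
        \<le> A j * \<bar>t - s\<bar> + 2 * ?\<epsilon> (k n) * A j"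
      using ev[of j] by eventually_elim (rule equi[OF _ st])
  qed
  have u_cont_e: "continuous_on {0..T} (\<lambda>t. inner (u t) (e j))" for j
    by (rule lipschitz_on_continuous_on[where L = "A j"])
      (auto intro!: lipschitz_onI A0 lip simp: dist_real_def)
  have u_cont: "continuous_on {0..T} (\<lambda>t. inner (u t) y)" for y
    unfolding continuous_on_def
  proof
    fix t assume t: "t \<in> {0..T}"
    show "((\<lambda>s. inner (u s) y) \<longlongrightarrow> inner (u t) y) (at t within {0..T})"
    proof (rule weak_convergence)
      show "\<forall>\<^sub>F s in at t within {0..T}. norm (u s) \<le> norm u0"
        using u_norm by (auto simp: eventually_at_filter intro: always_eventually)
      show "((\<lambda>s. inner (u s) (e j)) \<longlongrightarrow> inner (u t) (e j)) (at t within {0..T})" for j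
        using u_cont_e[of j] t by (simp add: continuous_on_def)
    qed
  qed
  have main: "integral {s..t} (\<lambda>\<tau>. cost \<Phi> (u \<tau>)) - K \<Phi> / 2 * (norm u0)\<^sup>2 * (t - s) \<le> inner (u t - u s) \<Phi>"
    if N0: "\<Phi> \<in> trial N0" and st: "0 \<le> s" "s \<le> t" "t \<le> T" for N0 \<Phi> s t
  proof -
    have \<Phi>V: "\<Phi> \<in> V" using N0 trial_subset_V by auto
    obtain M where M: "\<And>u. (norm u)\<^sup>2 \<le> ?R \<Longrightarrow> \<bar>B \<Phi> u u\<bar> \<le> M" "\<And>u. (norm u)\<^sup>2 \<le> ?R \<Longrightarrow> \<bar>cost \<Phi> u\<bar> \<le> M"
      using cost_bound[OF \<Phi>V, of ?R] by blast
    have sub: "{s..t} \<subseteq> {0..T}" using st by auto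
    have uR: "(norm (u \<tau>))\<^sup>2 \<le> ?R" if "\<tau> \<in> {s..t}" for \<tau>
      using u_norm[of \<tau>] sub that by (smt (verit) norm_ge_zero power_mono subsetD)
    have meas_u: "(\<lambda>\<tau>. cost \<Phi> (u \<tau>)) \<in> borel_measurable (lebesgue_on {s..t})"
    proof (rule weakly_continuous_measurable)
      show "continuous_on {s..t} (\<lambda>\<tau>. inner (u \<tau>) (e j))" for j
        by (rule continuous_on_subset[OF u_cont sub])
      show "continuous_on ({s..t} \<times> UNIV) (\<lambda>(\<tau>, x). cost \<Phi> x)"
        unfolding case_prod_beta by (rule continuous_on_compose2[OF cost_continuous[OF \<Phi>V]]) (auto intro: continuous_intros)
    qed
    \<comment> \<open>The minimum is bounded on both sides by \<open>M\<close> and converges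
      pointwise, although the cost of the approximations alone need not converge.\<close>
    let ?m = "\<lambda>n \<tau>. min (cost \<Phi> (X (k n) \<tau>)) (cost \<Phi> (u \<tau>))"
    have m_int: "?m n integrable_on {s..t}" for n
    proof (rule measurable_bounded_by_integrable_imp_integrable_real[OF _ integrable_const_ivl])
      have "(\<lambda>\<tau>. cost \<Phi> (X (k n) \<tau>)) \<in> borel_measurable (lebesgue_on {s..t})"
        by (intro integrable_imp_measurable X_int st)
      with meas_u show "?m n \<in> borel_measurable (lebesgue_on {s..t})" by simp
      show "\<bar>?m n \<tau>\<bar> \<le> M" if "\<tau> \<in> {s..t}" for \<tau>
        using M(2)[OF uR[OF that]] M(2)[OF X_R, of \<tau> "k n"] sub that by (auto simp: min_def)
    qed auto
    have lim: "(\<lambda>n. integral {s..t} (?m n)) \<longlonglongrightarrow> integral {s..t} (\<lambda>\<tau>. cost \<Phi> (u \<tau>))"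
    proof (rule dominated_convergence(2)[where h = "\<lambda>_. M"])
      show "?m n integrable_on {s..t}" for n by (rule m_int)
      show "(\<lambda>_. M) integrable_on {s..t}" by (rule integrable_const_ivl)
      show "norm (?m n \<tau>) \<le> M" if "\<tau> \<in> {s..t}" for n \<tau>
        using M(2)[OF uR[OF that]] M(2)[OF X_R, of \<tau> "k n"] sub that by (auto simp: min_def)
      show "(\<lambda>n. ?m n \<tau>) \<longlonglongrightarrow> cost \<Phi> (u \<tau>)" if "\<tau> \<in> {s..t}" for \<tau>
        using cost_lsc[OF \<Phi>V X_sqrt X_u] sub that by blast
    qed
    show ?thesis
    proof (rule tendsto_le[OF sequentially_bot])
      show "(\<lambda>n. inner (X (k n) t - X (k n) s) \<Phi> + 2 * ?\<epsilon> (k n) * M) \<longlonglongrightarrow> inner (u t - u s) \<Phi>"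
      proof -
        have w: "(\<lambda>n. inner (X (k n) \<tau>) \<Phi>) \<longlonglongrightarrow> inner (u \<tau>) \<Phi>" if "\<tau> \<in> {0..T}" for \<tau>
          by (rule weak_convergence[where R = "sqrt ?R"]) (use X_sqrt X_u that in auto)
        have "(\<lambda>n. inner (X (k n) t) \<Phi> - inner (X (k n) s) \<Phi> + 2 * ?\<epsilon> (k n) * M)
            \<longlonglongrightarrow> inner (u t) \<Phi> - inner (u s) \<Phi> + 2 * 0 * M"
          using st by (intro tendsto_add tendsto_diff tendsto_mult tendsto_const w k0) auto
        then show ?thesis by (simp add: inner_diff_left)
      qed
      have "(\<lambda>n. integral {s..t} (?m n) - K \<Phi> / 2 * ((norm u0)\<^sup>2 + ?\<epsilon> (k n)) * (t - s))
        \<longlonglongrightarrow> integral {s..t} (\<lambda>\<tau>. cost \<Phi> (u \<tau>)) - K \<Phi> / 2 * ((norm u0)\<^sup>2 + 0) * (t - s)"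
        by (intro tendsto_intros lim k0)
      then show "(\<lambda>n. integral {s..t} (?m n) - K \<Phi> / 2 * ((norm u0)\<^sup>2 + ?\<epsilon> (k n)) * (t - s))
        \<longlonglongrightarrow> integral {s..t} (\<lambda>\<tau>. cost \<Phi> (u \<tau>)) - K \<Phi> / 2 * (norm u0)\<^sup>2 * (t - s)" by simp
      show "\<forall>\<^sub>F n in sequentially.
          integral {s..t} (?m n) - K \<Phi> / 2 * ((norm u0)\<^sup>2 + ?\<epsilon> (k n)) * (t - s)
          \<le> inner (X (k n) t - X (k n) s) \<Phi> + 2 * ?\<epsilon> (k n) * M"
        using ev[of N0]
      proof eventually_elim
        case (elim n)
        let ?f = "\<lambda>\<tau>. B \<Phi> (X (k n) \<tau>) (X (k n) \<tau>)" and ?c = "K \<Phi> / 2 * ((norm u0)\<^sup>2 + ?\<epsilon> (k n))"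
        have "\<Phi> \<in> trial (k n)" using N0 trial_mono[of N0 "k n"] elim by auto
        then have 1: "integral {s..t} ?f \<le> inner (X (k n) t - X (k n) s) \<Phi> + 2 * ?\<epsilon> (k n) * M"
          using X_diff[OF _ st M(1), of "k n"] by (simp add: abs_le_iff)
        \<comment> \<open>\<open>B\<close> is the cost minus the weighted squared norm. The cost is
          bounded below by the minimum and the norm above by its energy estimate; here the equation
          of the scheme becomes an inequality.\<close>
        have "integral {s..t} (\<lambda>\<tau>. ?m n \<tau> - ?c) \<le> integral {s..t} ?f"
        proof (rule integral_le)
          show "(\<lambda>\<tau>. ?m n \<tau> - ?c) integrable_on {s..t}" by (intro integrable_diff m_int integrable_const_ivl)
          show "?f integrable_on {s..t}" by (intro X_int st)
          fix \<tau> assume \<tau>: "\<tau> \<in> {s..t}"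
          have "K \<Phi> / 2 * (norm (X (k n) \<tau>))\<^sup>2 \<le> ?c"
            using X_norm[of \<tau> "k n"] \<tau> sub K_nonneg[OF \<Phi>V] by (intro mult_left_mono) auto
          then show "?m n \<tau> - ?c \<le> ?f \<tau>" unfolding cost_def by linarith
        qed
        moreover have "integral {s..t} (\<lambda>\<tau>. ?m n \<tau> - ?c) = integral {s..t} (?m n) - ?c * (t - s)"
          using st by (subst Henstock_Kurzweil_Integration.integral_diff[OF m_int integrable_const_ivl]) simp
        ultimately show ?case using 1 by linarith
      qed
    qed
  qed
  show ?thesis by (rule that[OF u_0 u_norm u_cont main])
qed

end


section \<open>The Hilbert space of square integrable solenoidal fields\<close>

lemma space_torus [simp]: "space torus = cbox 0 1"
  by (simp add: torus_def)

lemma finite_measure_torus: "finite_measure (torus :: (real^'n) measure)"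
  unfolding torus_def by (rule finite_measure_lebesgue_on) simp

lemma measure_torus: "measure torus (cbox 0 1 :: (real^'n) set) = 1"
proof -
  have "measure torus (cbox 0 1 :: (real^'n) set) = measure lborel (cbox 0 1 :: (real^'n) set)"
    by (simp add: torus_def measure_restrict_space)
  also have "\<dots> = 1"
    by (subst content_cbox_cart) (auto simp: mem_box_cart box_ne_empty Basis_vec_def inner_axis)
  finally show ?thesis .
qed

text \<open>\<open>L2\<close> without periodicity and with general values, so that norms, components
  and scalar test functions fall under the same estimates.\<close>

definition square_integrable :: "(real^'n \<Rightarrow> 'b::euclidean_space) \<Rightarrow> bool" where
  "square_integrable f \<longleftrightarrow> f \<in> borel_measurable torus \<and> integrable torus (\<lambda>x. (norm (f x))\<^sup>2)"

lemma square_integrable_inner: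
  assumes "square_integrable f" "square_integrable g"
  shows "integrable torus (\<lambda>x. f x \<bullet> g x)"
proof (rule Bochner_Integration.integrable_bound)
  show "integrable torus (\<lambda>x. (norm (f x))\<^sup>2 + (norm (g x))\<^sup>2)"
    using assms by (simp add: square_integrable_def)
  show "(\<lambda>x. f x \<bullet> g x) \<in> borel_measurable torus"
    using assms by (auto simp: square_integrable_def)
  have "\<bar>a \<bullet> b\<bar> \<le> (norm a)\<^sup>2 + (norm b)\<^sup>2" for a b :: 'b
  proof -
    have "\<bar>a \<bullet> b\<bar> \<le> norm a * norm b" by (rule Cauchy_Schwarz_ineq2)
    also have "\<dots> \<le> (norm a)\<^sup>2 + (norm b)\<^sup>2"
      using sum_squares_bound[of "norm a" "norm b"] zero_le_power2[of "norm a"] zero_le_power2[of "norm b"]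
        mult_nonneg_nonneg[OF norm_ge_zero[of a] norm_ge_zero[of b]] by linarith
    finally show ?thesis .
  qed
  then show "AE x in torus. norm (f x \<bullet> g x) \<le> norm ((norm (f x))\<^sup>2 + (norm (g x))\<^sup>2)" by auto
qed

lemma square_integrable_add:
  assumes "square_integrable f" "square_integrable g"
  shows "square_integrable (\<lambda>x. f x + g x)"
proof -
  have "(norm (f x + g x))\<^sup>2 = (norm (f x))\<^sup>2 + 2 * (f x \<bullet> g x) + (norm (g x))\<^sup>2" for x
    unfolding power2_norm_eq_inner by (simp add: inner_add_left inner_add_right inner_commute)
  then show ?thesis
    using assms square_integrable_inner[OF assms] by (auto simp: square_integrable_def)
qed

lemma square_integrable_scaleR:
  "square_integrable f \<Longrightarrow> square_integrable (\<lambda>x. c *\<^sub>R f x)"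
  by (auto simp: square_integrable_def power_mult_distrib)

lemma square_integrable_diff:
  assumes "square_integrable f" "square_integrable g"
  shows "square_integrable (\<lambda>x. f x - g x)"
  using square_integrable_add[OF assms(1) square_integrable_scaleR[OF assms(2), of "-1"]] by simp

lemma square_integrable_continuous:
  assumes "continuous_on (cbox 0 1) f" shows "square_integrable f"
  unfolding square_integrable_def torus_def
proof
  show "f \<in> borel_measurable (lebesgue_on (cbox 0 1))"
    using assms by (rule continuous_imp_measurable_on_sets_lebesgue) simp
  show "integrable (lebesgue_on (cbox 0 1)) (\<lambda>x. (norm (f x))\<^sup>2)"
    by (rule continuous_imp_integrable) (intro continuous_intros assms)
qed

lemma square_integrable_norm:
  "square_integrable f \<Longrightarrow> square_integrable (\<lambda>x. norm (f x))"
  by (auto simp: square_integrable_def)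

lemma square_integrable_Cauchy_Schwarz:
  assumes f: "square_integrable f" and g: "square_integrable g"
  shows "(LINT x|torus. norm (f x) * norm (g x))
    \<le> sqrt (LINT x|torus. (norm (f x))\<^sup>2) * sqrt (LINT x|torus. (norm (g x))\<^sup>2)"
proof -
  let ?A = "LINT x|torus. (norm (f x))\<^sup>2" and ?B = "LINT x|torus. (norm (g x))\<^sup>2"
    and ?I = "LINT x|torus. norm (f x) * norm (g x)"
  have int: "integrable torus (\<lambda>x. (norm (f x))\<^sup>2)" "integrable torus (\<lambda>x. (norm (g x))\<^sup>2)"
      "integrable torus (\<lambda>x. norm (f x) * norm (g x))"
    using f g square_integrable_inner[OF square_integrable_norm square_integrable_norm]
    by (auto simp: square_integrable_def)
  \<comment> \<open>A polynomial in \<open>t\<close> that is nonnegative everywhere; its minimiser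
    \<open>- ?I / ?A\<close> yields the claim unless it degenerates.\<close>
  have q: "0 \<le> t\<^sup>2 * ?A + 2 * t * ?I + ?B" for t
  proof -
    have "0 \<le> (LINT x|torus. (t * norm (f x) + norm (g x))\<^sup>2)" by (rule Bochner_Integration.integral_nonneg) simp
    also have "\<dots> = (LINT x|torus. t\<^sup>2 * (norm (f x))\<^sup>2 + 2 * t * (norm (f x) * norm (g x)) + (norm (g x))\<^sup>2)"
      by (simp add: power2_eq_square algebra_simps)
    also have "\<dots> = t\<^sup>2 * ?A + 2 * t * ?I + ?B" using int by simp
    finally show ?thesis .
  qed
  have nonneg: "0 \<le> ?A" "0 \<le> ?B" "0 \<le> ?I" by (auto intro!: Bochner_Integration.integral_nonneg)
  have "?I\<^sup>2 \<le> ?A * ?B"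
  proof (cases "?A = 0")
    case True
    have "?I = 0"
    proof (rule ccontr)
      assume I: "?I \<noteq> 0"
      \<comment> \<open>For \<open>?A = 0\<close> the polynomial is affine, and this choice would
        give it the value -1.\<close>
      define t where "t = - (?B + 1) / (2 * ?I)"
      have "2 * t * ?I = - ?B - 1" using I by (simp add: t_def)
      moreover have "0 \<le> 2 * t * ?I + ?B" using q[of t] True by simp
      ultimately show False by linarith
    qed
    then show ?thesis using True by simp
  next
    case False
    then have A: "0 < ?A" using nonneg by (simp add: order_less_le)
    have "0 \<le> ?A * ((- ?I / ?A)\<^sup>2 * ?A + 2 * (- ?I / ?A) * ?I + ?B)"
      using q[of "- ?I / ?A"] A by simp
    also have "\<dots> = ?A * ?B - ?I\<^sup>2" using A by (simp add: power2_eq_square field_simps)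
    finally show ?thesis by simp
  qed
  then have "?I \<le> sqrt (?A * ?B)" by (rule real_le_rsqrt)
  then show ?thesis by (simp add: real_sqrt_mult)
qed

text \<open>Cauchy-Schwarz against the constant 1, whose norm is 1 because the cube has unit
  volume.\<close>

lemma square_integrable_integral_norm:
  assumes f: "square_integrable f"
  shows "integrable torus (\<lambda>x. norm (f x))"
    and "(LINT x|torus. norm (f x)) \<le> sqrt (LINT x|torus. (norm (f x))\<^sup>2)"
proof -
  have one: "square_integrable (\<lambda>_. 1 :: real)" by (rule square_integrable_continuous) simp
  show "integrable torus (\<lambda>x. norm (f x))"
    using square_integrable_inner[OF square_integrable_norm[OF f] one] by simp
  show "(LINT x|torus. norm (f x)) \<le> sqrt (LINT x|torus. (norm (f x))\<^sup>2)"
    using square_integrable_Cauchy_Schwarz[OF f one] by (simp add: measure_torus)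
qed

lemma L2_square_integrable: "f \<in> L2 \<Longrightarrow> square_integrable f"
  by (simp add: L2_def square_integrable_def)

lemma L2_sigma_L2: "f \<in> L2_sigma \<Longrightarrow> f \<in> L2"
  by (simp add: L2_sigma_def)

lemma L2_sigma_square_integrable: "f \<in> L2_sigma \<Longrightarrow> square_integrable f"
  using L2_square_integrable L2_sigma_L2 by blast

lemma L2_sigma_periodic: "f \<in> L2_sigma \<Longrightarrow> torus_periodic f"
  by (simp add: L2_sigma_def L2_def)

lemma L2_sigma_orthogonal:
  fixes f :: "real^'n \<Rightarrow> real^'n"
  assumes "f \<in> L2_sigma" "torus_periodic \<phi>" "\<And>x. GDERIV \<phi> x :> g x" "continuous_on UNIV g"
  shows "(LINT x|torus. f x \<bullet> g x) = 0"
  using assms unfolding L2_sigma_def by blast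

lemma L2_sigmaI:
  fixes f :: "real^'n \<Rightarrow> real^'n"
  assumes "torus_periodic f" "square_integrable f"
    and "\<And>\<phi> g. torus_periodic \<phi> \<Longrightarrow> (\<And>x. GDERIV \<phi> x :> g x) \<Longrightarrow> continuous_on UNIV g
      \<Longrightarrow> (LINT x|torus. f x \<bullet> g x) = 0"
  shows "f \<in> L2_sigma"
  using assms by (auto simp: L2_sigma_def L2_def square_integrable_def)

lemma L2_sigma_lincomb:
  fixes f g :: "real^'n \<Rightarrow> real^'n"
  assumes f: "f \<in> L2_sigma" and g: "g \<in> L2_sigma"
  shows "(\<lambda>x. a *\<^sub>R f x + b *\<^sub>R g x) \<in> L2_sigma"
proof (rule L2_sigmaI)
  show "torus_periodic (\<lambda>x. a *\<^sub>R f x + b *\<^sub>R g x)"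
    using L2_sigma_periodic[OF f] L2_sigma_periodic[OF g] by (simp add: torus_periodic_def)
  show "square_integrable (\<lambda>x. a *\<^sub>R f x + b *\<^sub>R g x)"
    by (intro square_integrable_add square_integrable_scaleR L2_sigma_square_integrable f g)
  fix \<phi> :: "real^'n \<Rightarrow> real" and h assume h: "torus_periodic \<phi>" "\<And>x. GDERIV \<phi> x :> h x" "continuous_on UNIV h"
  have "square_integrable h"
    using h(3) by (intro square_integrable_continuous) (rule continuous_on_subset, auto)
  then have "integrable torus (\<lambda>x. f x \<bullet> h x)" "integrable torus (\<lambda>x. g x \<bullet> h x)"
    using square_integrable_inner L2_sigma_square_integrable f g by blast+
  then show "(LINT x|torus. (a *\<^sub>R f x + b *\<^sub>R g x) \<bullet> h x) = 0"
    using L2_sigma_orthogonal[OF f h] L2_sigma_orthogonal[OF g h] by (simp add: inner_add_left)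
qed

lemma zero_L2_sigma: "(\<lambda>_. 0) \<in> L2_sigma"
  by (rule L2_sigmaI) (auto simp: torus_periodic_def square_integrable_def)

section \<open>The Hilbert space of classes modulo null sets\<close>

definition sfield_rel :: "(real^'n \<Rightarrow> real^'n) \<Rightarrow> (real^'n \<Rightarrow> real^'n) \<Rightarrow> bool" where
  "sfield_rel f g \<longleftrightarrow> f \<in> L2_sigma \<and> g \<in> L2_sigma \<and> (AE x in torus. f x = g x)"

\<comment> \<open>The quotient is partial because the carrier \<open>L2_sigma\<close> is only a set
  of functions. Passing to classes makes the norm definite, so that the abstract Hilbert space
  results apply.\<close>
quotient_type 'n sfield = "real^'n \<Rightarrow> real^'n" / partial: sfield_rel
proof (rule part_equivpI)
  show "\<exists>x. sfield_rel x x" using zero_L2_sigma by (auto simp: sfield_rel_def)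
  show "symp sfield_rel" by (auto simp: symp_def sfield_rel_def)
  show "transp sfield_rel" by (auto simp: transp_def sfield_rel_def)
qed

lemma sfield_rel_lincomb:
  assumes "sfield_rel f f'" "sfield_rel g g'"
  shows "sfield_rel (\<lambda>x. a *\<^sub>R f x + b *\<^sub>R g x) (\<lambda>x. a *\<^sub>R f' x + b *\<^sub>R g' x)"
  using assms by (auto simp: sfield_rel_def L2_sigma_lincomb)

instantiation sfield :: (finite) real_vector
begin

lift_definition zero_sfield :: "'a sfield" is "\<lambda>_. 0"
  using zero_L2_sigma by (simp add: sfield_rel_def)

lift_definition plus_sfield :: "'a sfield \<Rightarrow> 'a sfield \<Rightarrow> 'a sfield" is "\<lambda>f g x. f x + g x"
  using sfield_rel_lincomb[of _ _ _ _ 1 1] by simp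

lift_definition minus_sfield :: "'a sfield \<Rightarrow> 'a sfield \<Rightarrow> 'a sfield" is "\<lambda>f g x. f x - g x"
  using sfield_rel_lincomb[of _ _ _ _ 1 "-1"] by simp

lift_definition uminus_sfield :: "'a sfield \<Rightarrow> 'a sfield" is "\<lambda>f x. - f x"
  subgoal for f g using sfield_rel_lincomb[of f g f g "-1" 0] by simp
  done

lift_definition scaleR_sfield :: "real \<Rightarrow> 'a sfield \<Rightarrow> 'a sfield" is "\<lambda>c f x. c *\<^sub>R f x"
  subgoal for c f g using sfield_rel_lincomb[of f g f g c 0] by simp
  done

instance
proof
  fix x y z :: "'a sfield" and a b :: real
  show "x + y + z = x + (y + z)" by transfer (auto simp: sfield_rel_def add.assoc intro: L2_sigma_lincomb[of _ _ 1 1, simplified])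
  show "x + y = y + x" by transfer (auto simp: sfield_rel_def add.commute intro: L2_sigma_lincomb[of _ _ 1 1, simplified])
  show "0 + x = x" by transfer (auto simp: sfield_rel_def)
  show "- x + x = 0" by transfer (auto simp: sfield_rel_def zero_L2_sigma)
  show "x - y = x + - y" by transfer (auto simp: sfield_rel_def intro: L2_sigma_lincomb[of _ _ 1 "-1", simplified])
  show "a *\<^sub>R (x + y) = a *\<^sub>R x + a *\<^sub>R y"
    by transfer (auto simp: sfield_rel_def scaleR_add_right intro: L2_sigma_lincomb)
  show "(a + b) *\<^sub>R x = a *\<^sub>R x + b *\<^sub>R x"
    by transfer (auto simp: sfield_rel_def scaleR_add_left intro: L2_sigma_lincomb)
  show "a *\<^sub>R b *\<^sub>R x = (a * b) *\<^sub>R x"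
    by transfer (auto simp: sfield_rel_def intro: L2_sigma_lincomb[of _ _ _ 0, simplified])
  show "1 *\<^sub>R x = x" by transfer (auto simp: sfield_rel_def)
qed

end

instantiation sfield :: (finite) real_inner
begin

lift_definition inner_sfield :: "'a sfield \<Rightarrow> 'a sfield \<Rightarrow> real" is "\<lambda>f g. LINT x|torus. f x \<bullet> g x"
  subgoal for f f' g g'
    by (rule integral_cong_AE)
      (auto simp: sfield_rel_def square_integrable_def dest!: L2_sigma_square_integrable)
  done

definition norm_sfield :: "'a sfield \<Rightarrow> real" where "norm_sfield x = sqrt (inner x x)"
definition dist_sfield :: "'a sfield \<Rightarrow> 'a sfield \<Rightarrow> real" where "dist_sfield x y = norm (x - y)"
definition sgn_sfield :: "'a sfield \<Rightarrow> 'a sfield" where "sgn_sfield x = scaleR (inverse (norm x)) x"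
definition uniformity_sfield :: "('a sfield \<times> 'a sfield) filter" where
  "uniformity_sfield = (INF e\<in>{0<..}. principal {(x, y). dist x y < e})"
definition open_sfield :: "'a sfield set \<Rightarrow> bool" where
  "open_sfield U = (\<forall>x\<in>U. \<forall>\<^sub>F (x', y) in uniformity. x' = x \<longrightarrow> y \<in> U)"

instance
proof
  fix x y z :: "'a sfield" and r :: real and U :: "'a sfield set"
  show "dist x y = norm (x - y)" by (rule dist_sfield_def)
  show "sgn x = x /\<^sub>R norm x" by (rule sgn_sfield_def)
  show "uniformity = (INF e\<in>{0<..}. principal {(x :: 'a sfield, y). dist x y < e})"
    by (rule uniformity_sfield_def)
  show "open U = (\<forall>x\<in>U. \<forall>\<^sub>F (x', y) in uniformity. x' = x \<longrightarrow> y \<in> U)" by (rule open_sfield_def)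
  show "inner x y = inner y x" by transfer (simp add: inner_commute)
  show "inner (x + y) z = inner x z + inner y z"
    by transfer (auto simp: sfield_rel_def inner_add_left square_integrable_inner L2_sigma_square_integrable)
  show "inner (r *\<^sub>R x) y = r * inner x y" by transfer simp
  show "0 \<le> inner x x" by transfer (simp add: Bochner_Integration.integral_nonneg)
  show "inner x x = 0 \<longleftrightarrow> x = 0"
  proof transfer
    fix f :: "real^'a \<Rightarrow> real^'a" assume "sfield_rel f f"
    then have f: "f \<in> L2_sigma" "integrable torus (\<lambda>x. f x \<bullet> f x)"
      by (auto simp: sfield_rel_def square_integrable_inner L2_sigma_square_integrable)
    show "((LINT x|torus. f x \<bullet> f x) = 0) = sfield_rel f (\<lambda>_. 0)"
      using integral_nonneg_eq_0_iff_AE[OF f(2)] f(1) by (simp add: sfield_rel_def zero_L2_sigma)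
  qed
  show "norm x = sqrt (inner x x)" by (rule norm_sfield_def)
qed

end

text \<open>The quotient map and a chosen representative. The choice \<open>rep\<close> respects
  linear combinations only almost everywhere, so integrals of representatives are always compared up
  to null sets.\<close>

definition cls :: "(real^'n \<Rightarrow> real^'n) \<Rightarrow> 'n sfield" where "cls = abs_sfield"
definition rep :: "'n sfield \<Rightarrow> real^'n \<Rightarrow> real^'n" where "rep = rep_sfield"

lemma rep_L2_sigma: "rep x \<in> L2_sigma"
  using Quotient_rep_reflp[OF Quotient_sfield, of x] by (simp add: rep_def sfield_rel_def)

lemma cls_rep [simp]: "cls (rep x) = x"
  by (simp add: cls_def rep_def Quotient_abs_rep[OF Quotient_sfield])

lemma cls_eq_iff:
  assumes "f \<in> L2_sigma" "g \<in> L2_sigma"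
  shows "cls f = cls g \<longleftrightarrow> (AE x in torus. f x = g x)"
  using Quotient_rel[OF Quotient_sfield, of f g] assms by (auto simp: cls_def sfield_rel_def)

lemma rep_cls:
  assumes "f \<in> L2_sigma" shows "AE x in torus. rep (cls f) x = f x"
  using cls_eq_iff[OF rep_L2_sigma assms, of "cls f"] by simp

lemma cls_lincomb:
  assumes "f \<in> L2_sigma" "g \<in> L2_sigma"
  shows "cls (\<lambda>x. a *\<^sub>R f x + b *\<^sub>R g x) = a *\<^sub>R cls f + b *\<^sub>R cls g"
proof -
  have r: "sfield_rel f f" "sfield_rel g g" using assms by (auto simp: sfield_rel_def)
  then have s: "sfield_rel (\<lambda>x. a *\<^sub>R f x) (\<lambda>x. a *\<^sub>R f x)" "sfield_rel (\<lambda>x. b *\<^sub>R g x) (\<lambda>x. b *\<^sub>R g x)"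
    using sfield_rel_lincomb[of _ _ _ _ _ 0] by force+
  show ?thesis
    unfolding cls_def
    using plus_sfield.abs_eq[OF s] scaleR_sfield.abs_eq[OF r(1), of a] scaleR_sfield.abs_eq[OF r(2), of b] by simp
qed

lemma rep_lincomb: "AE x in torus. rep (a *\<^sub>R u + b *\<^sub>R w) x = a *\<^sub>R rep u x + b *\<^sub>R rep w x"
  using rep_cls[OF L2_sigma_lincomb[OF rep_L2_sigma rep_L2_sigma], of a u b w]
  by (simp add: cls_lincomb rep_L2_sigma)

lemma inner_cls:
  assumes "f \<in> L2_sigma" "g \<in> L2_sigma"
  shows "inner (cls f) (cls g) = (LINT x|torus. f x \<bullet> g x)"
  using inner_sfield.abs_eq[of f g] assms by (simp add: cls_def sfield_rel_def)

lemma inner_rep: "inner u w = (LINT x|torus. rep u x \<bullet> rep w x)"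
  using inner_cls[OF rep_L2_sigma rep_L2_sigma, of u w] by simp

lemma norm_cls: "f \<in> L2_sigma \<Longrightarrow> norm (cls f) = L2_norm f"
  unfolding norm_eq_sqrt_inner by (simp add: inner_cls L2_norm_def power2_norm_eq_inner)

lemma norm_rep: "norm u = L2_norm (rep u)"
  using norm_cls[OF rep_L2_sigma, of u] by simp

lemma norm_diff_rep:
  "integrable torus (\<lambda>x. (norm (rep u x - rep w x))\<^sup>2)"
  "(LINT x|torus. (norm (rep u x - rep w x))\<^sup>2) = (norm (u - w))\<^sup>2"
proof -
  have sq: "square_integrable (\<lambda>x. rep u x - rep w x)"
    by (intro square_integrable_diff L2_sigma_square_integrable rep_L2_sigma)
  then show "integrable torus (\<lambda>x. (norm (rep u x - rep w x))\<^sup>2)"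
    by (simp add: square_integrable_def)
  have "AE x in torus. rep (u - w) x = rep u x - rep w x"
    using rep_lincomb[of 1 u "-1" w] by simp
  then have "(LINT x|torus. rep (u - w) x \<bullet> rep (u - w) x) = (LINT x|torus. (norm (rep u x - rep w x))\<^sup>2)"
    using sq L2_sigma_square_integrable[OF rep_L2_sigma, of "u - w"]
    by (intro integral_cong_AE) (auto simp: power2_norm_eq_inner square_integrable_def)
  then show "(LINT x|torus. (norm (rep u x - rep w x))\<^sup>2) = (norm (u - w))\<^sup>2"
    by (simp add: power2_norm_eq_inner inner_rep)
qed

text \<open>Riesz-Fischer: a subsequence with geometrically small gaps converges almost everywhere,
  and Fatou's lemma turns this into convergence in norm. In addition the limit has to be periodic
  and solenoidal.\<close>

instance sfield :: (finite) banach
proof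
  fix X :: "nat \<Rightarrow> 'a sfield" assume X: "Cauchy X"
  have "\<forall>k. \<exists>N. \<forall>m\<ge>N. \<forall>n\<ge>N. norm (X m - X n) < (1/2)^k"
    using X unfolding Cauchy_def dist_norm by simp
  then obtain N where N: "\<And>k m n. m \<ge> N k \<Longrightarrow> n \<ge> N k \<Longrightarrow> norm (X m - X n) < (1/2)^k" by metis
  \<comment> \<open>Summing the thresholds makes \<open>r k\<close> at least as large as every
    \<open>N i\<close> with \<open>i \<le> k\<close>.\<close>
  define r where "r k = (\<Sum>i\<le>k. N i)" for k
  have r: "N k \<le> r m" if "k \<le> m" for k m
    unfolding r_def using that by (intro member_le_sum) auto
  define g where "g k = rep (X (r k))" for k
  have gs: "g k \<in> L2_sigma" for k by (simp add: g_def rep_L2_sigma)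
  have gsq: "square_integrable (g k)" for k by (rule L2_sigma_square_integrable[OF gs])
  have g_int: "integrable torus (\<lambda>x. (norm (g j x - g k x))\<^sup>2)" for j k
    by (simp add: g_def norm_diff_rep)
  have g_le: "(LINT x|torus. (norm (g j x - g k x))\<^sup>2) \<le> ((1/2)^k)\<^sup>2" if "k \<le> j" for j k
    unfolding g_def norm_diff_rep
    by (intro power_mono less_imp_le[OF N[of k]] r that order_refl norm_ge_zero)
  define d where "d k x = norm (g (Suc k) x - g k x)" for k x
  have d_sq: "square_integrable (\<lambda>x. g (Suc k) x - g k x)" for k
    by (intro square_integrable_diff gsq)
  have d_int: "integrable torus (d k)" for k
    unfolding d_def by (rule square_integrable_integral_norm(1)[OF d_sq])
  have d_le: "(LINT x|torus. d k x) \<le> (1/2)^k" for k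
  proof -
    have "sqrt (LINT x|torus. (norm (g (Suc k) x - g k x))\<^sup>2) \<le> (1/2)^k"
      using g_le[of k "Suc k"] by (intro real_le_lsqrt) auto
    then show ?thesis
      unfolding d_def by (rule order_trans[OF square_integrable_integral_norm(2)[OF d_sq]])
  qed
  \<comment> \<open>Defined at every point, even where no limit exists: periodicity is required
    everywhere, and the sequences at \<open>x\<close> and at its integer translates
    coincide.\<close>
  define F where "F x = lim (\<lambda>k. g k x)" for x
  have "AE x in torus. (\<Sum>k. ennreal (d k x)) \<noteq> \<infinity>"
  proof (rule nn_integral_noteq_infinite)
    have meas: "d k \<in> borel_measurable torus" for k using d_int[of k] by auto
    then show "(\<lambda>x. \<Sum>k. ennreal (d k x)) \<in> borel_measurable torus" by simp
    have "(\<integral>\<^sup>+ x. (\<Sum>k. ennreal (d k x)) \<partial>torus) = (\<Sum>k. \<integral>\<^sup>+ x. ennreal (d k x) \<partial>torus)"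
      using meas by (intro nn_integral_suminf) simp
    also have "\<dots> = (\<Sum>k. ennreal (LINT x|torus. d k x))"
      by (subst nn_integral_eq_integral[OF d_int]) (auto simp: d_def)
    also have "\<dots> \<le> (\<Sum>k. ennreal ((1/2)^k))"
      by (intro suminf_le ennreal_leI d_le) auto
    also have "\<dots> = ennreal (\<Sum>k. (1/2)^k)" by (intro suminf_ennreal2) auto
    finally show "(\<integral>\<^sup>+ x. (\<Sum>k. ennreal (d k x)) \<partial>torus) \<noteq> \<infinity>" by (auto simp: top_unique)
  qed
  then have conv: "AE x in torus. (\<lambda>k. g k x) \<longlonglongrightarrow> F x"
  proof eventually_elim
    case (elim x)
    then have "summable (\<lambda>k. d k x)" by (intro summable_suminf_not_top) (auto simp: d_def)
    then have "summable (\<lambda>k. g (Suc k) x - g k x)" unfolding d_def by (rule summable_norm_cancel)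
    then have "convergent (\<lambda>n. \<Sum>k<n. g (Suc k) x - g k x)" by (simp add: summable_iff_convergent)
    then have "convergent (\<lambda>n. g n x - g 0 x)" by (simp only: sum_lessThan_telescope[of "\<lambda>k. g k x"])
    then have "convergent (\<lambda>n. g n x)" by (simp only: convergent_diff_const_right_iff)
    then show ?case by (simp add: F_def convergent_LIMSEQ_iff)
  qed
  have F_meas: "F \<in> borel_measurable torus"
    unfolding F_def by (rule borel_measurable_lim_metric) (use gsq in \<open>simp add: square_integrable_def\<close>)
  have g_meas [measurable]: "g k \<in> borel_measurable torus" for k using gsq by (simp add: square_integrable_def)
  \<comment> \<open>Fatou's lemma in the index \<open>j\<close> with \<open>k\<close> fixed: the
    geometric bound survives the pointwise limit.\<close>
  have Fg: "(\<integral>\<^sup>+ x. ennreal ((norm (F x - g k x))\<^sup>2) \<partial>torus) \<le> ennreal (((1/2)^k)\<^sup>2)" for k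
  proof -
    have "(\<integral>\<^sup>+ x. ennreal ((norm (F x - g k x))\<^sup>2) \<partial>torus)
        = (\<integral>\<^sup>+ x. liminf (\<lambda>j. ennreal ((norm (g j x - g k x))\<^sup>2)) \<partial>torus)"
    proof (rule nn_integral_cong_AE)
      show "AE x in torus. ennreal ((norm (F x - g k x))\<^sup>2) = liminf (\<lambda>j. ennreal ((norm (g j x - g k x))\<^sup>2))"
        using conv
      proof eventually_elim
        case (elim x)
        have "(\<lambda>j. ennreal ((norm (g j x - g k x))\<^sup>2)) \<longlonglongrightarrow> ennreal ((norm (F x - g k x))\<^sup>2)"
          by (intro tendsto_ennrealI tendsto_intros elim)
        then show ?case by (rule lim_imp_Liminf[OF sequentially_bot, symmetric])
      qed
    qed
    also have "\<dots> \<le> liminf (\<lambda>j. \<integral>\<^sup>+ x. ennreal ((norm (g j x - g k x))\<^sup>2) \<partial>torus)"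
      by (rule nn_integral_liminf) measurable
    also have "\<dots> \<le> ennreal (((1/2)^k)\<^sup>2)"
    proof (rule Liminf_le)
      show "\<forall>\<^sub>F j in sequentially. (\<integral>\<^sup>+ x. ennreal ((norm (g j x - g k x))\<^sup>2) \<partial>torus) \<le> ennreal (((1/2)^k)\<^sup>2)"
        by (rule eventually_sequentiallyI[of k])
          (subst nn_integral_eq_integral[OF g_int], auto intro!: ennreal_leI g_le)
    qed simp
    finally show ?thesis .
  qed
  have Fg_sq: "square_integrable (\<lambda>x. F x - g k x)" for k
    unfolding square_integrable_def
  proof (intro conjI integrableI_bounded)
    have "(\<integral>\<^sup>+ x. ennreal (norm ((norm (F x - g k x))\<^sup>2)) \<partial>torus) \<le> ennreal (((1/2)^k)\<^sup>2)"
      using Fg[of k] by simp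
    then show "(\<integral>\<^sup>+ x. ennreal (norm ((norm (F x - g k x))\<^sup>2)) \<partial>torus) < \<infinity>"
      by (rule order_le_less_trans) simp
  qed (use F_meas in measurable)
  have Fg_le: "(LINT x|torus. (norm (F x - g k x))\<^sup>2) \<le> ((1/2)^k)\<^sup>2" for k
    using Fg[of k] Fg_sq[of k] by (subst (asm) nn_integral_eq_integral) (auto simp: square_integrable_def)
  have F_sigma: "F \<in> L2_sigma"
  proof (rule L2_sigmaI)
    show "torus_periodic F"
      using L2_sigma_periodic[OF gs] by (simp add: torus_periodic_def F_def)
    show sqF: "square_integrable F"
      using square_integrable_add[OF Fg_sq[of 0] gsq[of 0]] by simp
    fix \<phi> :: "real^'a \<Rightarrow> real" and h
    assume h: "torus_periodic \<phi>" "\<And>x. GDERIV \<phi> x :> h x" "continuous_on UNIV h"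
    have sqh: "square_integrable h"
      using h(3) by (intro square_integrable_continuous) (rule continuous_on_subset, auto)
    let ?H = "sqrt (LINT x|torus. (norm (h x))\<^sup>2)"
    \<comment> \<open>Orthogonality to gradients is a closed condition: \<open>g k\<close> satisfies
      it, and the difference to \<open>F\<close> is geometrically small.\<close>
    have "\<bar>LINT x|torus. F x \<bullet> h x\<bar> \<le> (1/2)^k * ?H" for k
    proof -
      have "(LINT x|torus. F x \<bullet> h x) = (LINT x|torus. (F x - g k x) \<bullet> h x) + (LINT x|torus. g k x \<bullet> h x)"
        using Bochner_Integration.integral_add[OF square_integrable_inner[OF Fg_sq sqh]
            square_integrable_inner[OF gsq sqh], of k k]
        by (simp only: inner_diff_left diff_add_cancel)
      also have "(LINT x|torus. g k x \<bullet> h x) = 0" by (rule L2_sigma_orthogonal[OF gs h])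
      finally have "\<bar>LINT x|torus. F x \<bullet> h x\<bar> = \<bar>LINT x|torus. (F x - g k x) \<bullet> h x\<bar>" by simp
      also have "\<dots> \<le> (LINT x|torus. norm (F x - g k x) * norm (h x))"
        using square_integrable_inner[OF Fg_sq sqh] square_integrable_inner[OF square_integrable_norm[OF Fg_sq] square_integrable_norm[OF sqh]]
        by (intro order_trans[OF integral_abs_bound] integral_mono) (auto simp: Cauchy_Schwarz_ineq2)
      also have "\<dots> \<le> sqrt (LINT x|torus. (norm (F x - g k x))\<^sup>2) * ?H"
        by (rule square_integrable_Cauchy_Schwarz[OF Fg_sq sqh])
      also have "\<dots> \<le> (1/2)^k * ?H"
        using Fg_le[of k] by (intro mult_right_mono real_le_lsqrt) auto
      finally show ?thesis .
    qed
    moreover have "(\<lambda>k. (1/2)^k * ?H) \<longlonglongrightarrow> 0 * ?H"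
      by (intro tendsto_intros LIMSEQ_power_zero) auto
    ultimately have "\<bar>LINT x|torus. F x \<bullet> h x\<bar> \<le> 0 * ?H"
      by (intro LIMSEQ_le_const) auto
    then show "(LINT x|torus. F x \<bullet> h x) = 0" by simp
  qed
  have "norm (X (r k) - cls F) \<le> (1/2)^k" for k
  proof (rule power2_le_imp_le)
    have "(norm (X (r k) - cls F))\<^sup>2 = (LINT x|torus. (norm (g k x - rep (cls F) x))\<^sup>2)"
      by (simp add: g_def norm_diff_rep)
    also have "\<dots> = (LINT x|torus. (norm (F x - g k x))\<^sup>2)"
      using rep_cls[OF F_sigma] F_meas L2_sigma_square_integrable[OF rep_L2_sigma, of "cls F"]
      by (intro integral_cong_AE) (auto simp: norm_minus_commute square_integrable_def)
    finally show "(norm (X (r k) - cls F))\<^sup>2 \<le> ((1/2)^k)\<^sup>2" using Fg_le by simp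
  qed simp
  then have sub: "norm (X n - cls F) \<le> (1/2)^k + (1/2)^k" if "r k \<le> n" for n k
    using less_imp_le[OF N[of k n "r k"]] r[of k k] that by (intro norm_diff_triangle_le) auto
  have "X \<longlonglongrightarrow> cls F"
    unfolding LIMSEQ_iff
  proof (intro allI impI)
    fix \<epsilon> :: real assume "0 < \<epsilon>"
    then obtain k where "(1/2)^k < \<epsilon> / 2" using real_arch_pow_inv[of "\<epsilon>/2" "1/2"] by auto
    then show "\<exists>M. \<forall>n\<ge>M. norm (X n - cls F) < \<epsilon>"
      using sub[of k] by (intro exI[of _ "r k"]) fastforce
  qed
  then show "convergent X" by (rule convergentI)
qed


section \<open>Solenoidal fields of class C1\<close>

lemma integral_cbox_shift:
  fixes f :: "'a::euclidean_space \<Rightarrow> real"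
  assumes "f integrable_on cbox (a + c) (b + c)"
  shows "integral (cbox a b) (\<lambda>x. f (x + c)) = integral (cbox (a + c) (b + c)) f"
  using has_integral_affinity'[OF integrable_integral[OF assms], of 1 c] by (auto intro: integral_unique)

lemma LINT_torus_integral:
  fixes f :: "real^'n \<Rightarrow> real"
  assumes "continuous_on UNIV f"
  shows "(LINT x|torus. f x) = integral (cbox 0 1) f"
  unfolding torus_def
  by (rule lebesgue_integral_eq_integral)
    (auto intro!: continuous_imp_integrable continuous_on_subset[OF assms])

lemma torus_periodic_axis:
  "torus_periodic f \<Longrightarrow> f (x + axis j 1) = f x"
  unfolding torus_periodic_def by (auto simp: axis_def)

text \<open>Cut the translated cube where the \<open>j\<close>-th coordinate is 1 and move the
  protruding slab back by one period; it fills exactly the part of the cube that was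
  vacated.\<close>

lemma integral_torus_translate:
  fixes h :: "real^'n \<Rightarrow> real"
  assumes per: "torus_periodic h" and cont: "continuous_on UNIV h" and s: "0 \<le> s" "s \<le> 1"
  shows "integral (cbox 0 1) (\<lambda>x. h (x + s *\<^sub>R axis j 1)) = integral (cbox 0 1) h"
proof -
  let ?e = "axis j 1 :: real^'n"
  have int: "h integrable_on cbox a b" for a b
    by (intro integrable_continuous continuous_on_subset[OF cont]) simp
  have e: "?e \<in> Basis" by (auto simp: Basis_vec_def)
  have c: "cbox (s *\<^sub>R ?e) (1 + s *\<^sub>R ?e) \<inter> {x. x \<bullet> ?e \<le> 1} = cbox (s *\<^sub>R ?e) 1"
          "cbox (s *\<^sub>R ?e) (1 + s *\<^sub>R ?e) \<inter> {x. x \<bullet> ?e \<ge> 1} = cbox (0 + ?e) ((1 - (1 - s) *\<^sub>R ?e) + ?e)"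
          "cbox 0 1 \<inter> {x. x \<bullet> ?e \<le> s} = cbox 0 (1 - (1 - s) *\<^sub>R ?e)"
          "cbox 0 1 \<inter> {x. x \<bullet> ?e \<ge> s} = cbox (s *\<^sub>R ?e) 1"
  proof -
    have m: "x \<in> cbox a b \<longleftrightarrow> (a $ j \<le> x $ j \<and> x $ j \<le> b $ j) \<and> (\<forall>i. i \<noteq> j \<longrightarrow> a $ i \<le> x $ i \<and> x $ i \<le> b $ i)"
      for x a b :: "real^'n" by (auto simp: mem_box_cart)
    have ax: "x \<bullet> ?e = x $ j" "?e $ i = (if i = j then 1 else 0)" for x i
      by (simp add: inner_axis) (simp add: axis_def)
    show "cbox (s *\<^sub>R ?e) (1 + s *\<^sub>R ?e) \<inter> {x. x \<bullet> ?e \<le> 1} = cbox (s *\<^sub>R ?e) 1"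
         "cbox (s *\<^sub>R ?e) (1 + s *\<^sub>R ?e) \<inter> {x. x \<bullet> ?e \<ge> 1} = cbox (0 + ?e) ((1 - (1 - s) *\<^sub>R ?e) + ?e)"
         "cbox 0 1 \<inter> {x. x \<bullet> ?e \<le> s} = cbox 0 (1 - (1 - s) *\<^sub>R ?e)"
         "cbox 0 1 \<inter> {x. x \<bullet> ?e \<ge> s} = cbox (s *\<^sub>R ?e) 1"
      using s by (auto simp: set_eq_iff m ax)
  qed
  have "integral (cbox 0 1) (\<lambda>x. h (x + s *\<^sub>R ?e)) = integral (cbox (s *\<^sub>R ?e) (1 + s *\<^sub>R ?e)) h"
    using integral_cbox_shift[OF int, where a = 0 and b = 1 and c = "s *\<^sub>R ?e"] by simp
  also have "\<dots> = integral (cbox (s *\<^sub>R ?e) 1) h + integral (cbox (0 + ?e) ((1 - (1 - s) *\<^sub>R ?e) + ?e)) h"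
    by (subst integral_split[OF int e, of _ _ 1]) (simp only: c)
  also have "integral (cbox (0 + ?e) ((1 - (1 - s) *\<^sub>R ?e) + ?e)) h = integral (cbox 0 (1 - (1 - s) *\<^sub>R ?e)) (\<lambda>x. h (x + ?e))"
    by (rule integral_cbox_shift[OF int, symmetric])
  also have "\<dots> = integral (cbox 0 (1 - (1 - s) *\<^sub>R ?e)) h"
    by (simp add: torus_periodic_axis[OF per])
  also have "integral (cbox (s *\<^sub>R ?e) 1) h + \<dots> = integral (cbox 0 1) h"
    by (subst (3) integral_split[OF int e, of _ _ s]) (simp only: c add.commute)
  finally show ?thesis .
qed

text \<open>The integral over the translated cube does not depend on the translation; differentiate
  under the integral sign.\<close>

lemma integral_partial_derivative_periodic:
  fixes h :: "real^'n \<Rightarrow> real"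
  assumes per: "torus_periodic h" and der: "\<And>x. GDERIV h x :> g x" and cont: "continuous_on UNIV g"
  shows "(LINT x|torus. g x $ j) = 0"
proof -
  let ?e = "axis j 1 :: real^'n"
  have ch: "continuous_on UNIV h"
    using der by (intro differentiable_imp_continuous_on) (auto simp: differentiable_on_def gderiv_def differentiable_def intro: has_derivative_at_withinI)
  \<comment> \<open>The derivative at 0 is one-sided, since translation invariance is available for
    \<open>s\<close> in \<open>[0,1]\<close>; one-sided derivatives are still unique there.\<close>
  have "((\<lambda>s. integral (cbox 0 1) (\<lambda>x. h (x + s *\<^sub>R ?e))) has_field_derivative
      integral (cbox 0 1) (\<lambda>x. g (x + 0 *\<^sub>R ?e) \<bullet> ?e)) (at 0 within {0..1})"
  proof (rule leibniz_rule_field_derivative)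
    fix s :: real and x :: "real^'n" assume "s \<in> {0..1}"
    have "((\<lambda>s. h (x + s *\<^sub>R ?e)) has_derivative (\<lambda>d. (d *\<^sub>R ?e) \<bullet> g (x + s *\<^sub>R ?e))) (at s within {0..1})"
      by (rule has_derivative_compose[OF _ der[unfolded gderiv_def], where f = "\<lambda>s. x + s *\<^sub>R ?e"])
        (auto intro!: derivative_eq_intros)
    then show "((\<lambda>s. h (x + s *\<^sub>R ?e)) has_field_derivative g (x + s *\<^sub>R ?e) \<bullet> ?e) (at s within {0..1})"
      by (simp add: has_field_derivative_def inner_commute mult.commute[of _ "g _ \<bullet> _"] mult_commute_abs)
  next
    show "(\<lambda>x. h (x + s *\<^sub>R ?e)) integrable_on cbox 0 1" for s
      by (intro integrable_continuous continuous_on_compose2[OF ch] continuous_intros) auto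
    show "continuous_on ({0..1} \<times> cbox 0 1) (\<lambda>(s, x). g (x + s *\<^sub>R ?e) \<bullet> ?e)"
      unfolding case_prod_beta
      by (intro continuous_intros continuous_on_compose2[OF cont]) auto
  qed auto
  moreover have "((\<lambda>s. integral (cbox 0 1) (\<lambda>x. h (x + s *\<^sub>R ?e))) has_field_derivative 0) (at 0 within {0..1})"
    by (rule has_field_derivative_transform_within[OF DERIV_const[of "integral (cbox 0 1) h"], where d = 1])
      (auto simp: integral_torus_translate[OF per ch])
  ultimately have "integral (cbox 0 1) (\<lambda>x. g (x + 0 *\<^sub>R ?e) \<bullet> ?e) = 0"
    unfolding has_real_derivative_iff_has_vector_derivative
    by (intro vector_derivative_unique_within_closed_interval[of 0 1 0]) auto
  then have "integral (cbox 0 1) (\<lambda>x. g x $ j) = 0" by (simp add: inner_axis)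
  then show ?thesis
    by (subst LINT_torus_integral) (auto intro!: continuous_intros cont)
qed

text \<open>The class of time slices of \<open>test_fields\<close>, and the source of the Galerkin
  basis.\<close>

definition C1_sigma :: "(real^'n \<Rightarrow> real^'n) set" where
  "C1_sigma = {\<phi>. torus_periodic \<phi> \<and> (\<forall>x. \<phi> differentiable (at x)) \<and> continuous_on UNIV (grad \<phi>) \<and>
     (\<forall>x. trace (grad \<phi> x) = 0)}"

lemma has_derivative_grad:
  "\<phi> differentiable (at x) \<Longrightarrow> (\<phi> has_derivative (\<lambda>h. grad \<phi> x *v h)) (at x)"
  by (simp add: grad_def jacobian_works)

lemma grad_eqI:
  assumes "(\<phi> has_derivative (\<lambda>h. A *v h)) (at x)" shows "grad \<phi> x = A"
proof -
  have "\<phi> differentiable (at x)" using assms by (auto simp: differentiable_def)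
  then have "(\<lambda>h. grad \<phi> x *v h) = (\<lambda>h. A *v h)"
    using has_derivative_unique[OF has_derivative_grad assms] by simp
  then show ?thesis by (metis matrix_eq)
qed

lemma C1_sigma_continuous:
  assumes "\<phi> \<in> C1_sigma" shows "continuous_on S \<phi>"
proof -
  have "continuous_on UNIV \<phi>"
    using assms by (intro differentiable_imp_continuous_on) (auto simp: C1_sigma_def differentiable_on_def intro: differentiable_at_withinI)
  then show ?thesis by (rule continuous_on_subset) simp
qed

lemma C1_sigma_grad_continuous: "\<phi> \<in> C1_sigma \<Longrightarrow> continuous_on S (grad \<phi>)"
  by (auto simp: C1_sigma_def intro: continuous_on_subset)

lemma C1_sigma_has_derivative:
  "\<phi> \<in> C1_sigma \<Longrightarrow> (\<phi> has_derivative (\<lambda>h. grad \<phi> x *v h)) (at x)"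
  by (rule has_derivative_grad) (simp add: C1_sigma_def)

lemma GDERIV_component:
  assumes "(\<phi> has_derivative (\<lambda>h. A *v h)) (at x)"
  shows "GDERIV (\<lambda>x. \<phi> x $ j) x :> A $ j"
  unfolding gderiv_def
  using bounded_linear.has_derivative[OF bounded_linear_vec_nth[of j] assms]
  by (simp add: matrix_vector_mul_component inner_commute)

text \<open>For a periodic potential \<open>q\<close> the divergence of \<open>q \<phi>\<close> is
  \<open>\<phi> \<bullet> \<nabla> q\<close> because \<open>\<phi>\<close> is solenoidal, and the
  integral of a periodic divergence vanishes.\<close>

lemma C1_sigma_subset_L2_sigma: "C1_sigma \<subseteq> L2_sigma"
proof
  fix \<phi> :: "real^'n \<Rightarrow> real^'n" assume \<phi>: "\<phi> \<in> C1_sigma"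
  show "\<phi> \<in> L2_sigma"
  proof (rule L2_sigmaI)
    show per\<phi>: "torus_periodic \<phi>" using \<phi> by (simp add: C1_sigma_def)
    show "square_integrable \<phi>" by (intro square_integrable_continuous C1_sigma_continuous[OF \<phi>])
    fix q :: "real^'n \<Rightarrow> real" and g
    assume q: "torus_periodic q" "\<And>x. GDERIV q x :> g x" "continuous_on UNIV g"
    have cq: "continuous_on UNIV q"
      using q(2) by (intro differentiable_imp_continuous_on) (auto simp: differentiable_on_def gderiv_def differentiable_def intro: has_derivative_at_withinI)
    \<comment> \<open>The gradient of \<open>q\<close> times the \<open>j\<close>-th component of
      \<open>\<phi>\<close>; the sum of its \<open>j\<close>-th entries over \<open>j\<close> is the
      divergence.\<close>
    let ?G = "\<lambda>j x. q x *\<^sub>R (grad \<phi> x $ j) + \<phi> x $ j *\<^sub>R g x"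
    have cG: "continuous_on UNIV (?G j)" for j
      by (intro continuous_intros cq q(3) C1_sigma_continuous[OF \<phi>] C1_sigma_grad_continuous[OF \<phi>])
    have "(LINT x|torus. ?G j x $ j) = 0" for j
    proof (rule integral_partial_derivative_periodic)
      show "torus_periodic (\<lambda>x. q x * \<phi> x $ j)" using q(1) per\<phi> by (simp add: torus_periodic_def)
      show "GDERIV (\<lambda>x. q x * \<phi> x $ j) x :> ?G j x" for x
        by (rule GDERIV_mult[OF q(2) GDERIV_component[OF C1_sigma_has_derivative[OF \<phi>]]])
    qed (rule cG)
    then have "(\<Sum>j\<in>UNIV. (LINT x|torus. ?G j x $ j)) = 0" by simp
    also have "(\<Sum>j\<in>UNIV. (LINT x|torus. ?G j x $ j)) = (LINT x|torus. (\<Sum>j\<in>UNIV. ?G j x $ j))"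
      unfolding torus_def
      by (rule Bochner_Integration.integral_sum[symmetric])
        (intro continuous_imp_integrable continuous_on_subset[OF continuous_on_component[OF cG]], simp)
    also have "(\<lambda>x. \<Sum>j\<in>UNIV. ?G j x $ j) = (\<lambda>x. \<phi> x \<bullet> g x)"
    proof
      fix x
      have "(\<Sum>j\<in>UNIV. grad \<phi> x $ j $ j) = 0" using \<phi> by (simp add: C1_sigma_def trace_def)
      then show "(\<Sum>j\<in>UNIV. ?G j x $ j) = \<phi> x \<bullet> g x"
        by (simp add: sum.distrib inner_vec_def sum_distrib_left[symmetric])
    qed
    finally show "(LINT x|torus. \<phi> x \<bullet> g x) = 0" .
  qed
qed

lemma grad_lincomb:
  assumes "\<phi> \<in> C1_sigma" "\<psi> \<in> C1_sigma"
  shows "grad (\<lambda>x. a *\<^sub>R \<phi> x + b *\<^sub>R \<psi> x) x = a *\<^sub>R grad \<phi> x + b *\<^sub>R grad \<psi> x"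
  by (rule grad_eqI)
    (use C1_sigma_has_derivative[OF assms(1), of x] C1_sigma_has_derivative[OF assms(2), of x] in
      \<open>auto intro!: derivative_eq_intros simp: matrix_vector_mult_add_rdistrib scaleR_matrix_vector_assoc\<close>)

lemma C1_sigma_lincomb:
  assumes "\<phi> \<in> C1_sigma" "\<psi> \<in> C1_sigma"
  shows "(\<lambda>x. a *\<^sub>R \<phi> x + b *\<^sub>R \<psi> x) \<in> C1_sigma"
proof -
  have "grad (\<lambda>x. a *\<^sub>R \<phi> x + b *\<^sub>R \<psi> x) = (\<lambda>x. a *\<^sub>R grad \<phi> x + b *\<^sub>R grad \<psi> x)"
    using grad_lincomb[OF assms] by auto
  moreover have "trace (a *\<^sub>R grad \<phi> x + b *\<^sub>R grad \<psi> x) = a * trace (grad \<phi> x) + b * trace (grad \<psi> x)" for x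
    by (simp add: trace_def sum.distrib sum_distrib_left)
  ultimately show ?thesis
    using assms by (auto simp: C1_sigma_def torus_periodic_def intro!: continuous_intros)
qed

text \<open>Cauchy-Schwarz in each row; \<open>norm A\<close> is the Frobenius norm.\<close>

lemma norm_matrix_vector_le:
  fixes A :: "real^'n^'m" shows "norm (A *v x) \<le> norm A * norm x"
proof (rule power2_le_imp_le)
  have "(norm (A *v x))\<^sup>2 = (\<Sum>i\<in>UNIV. (A $ i \<bullet> x)\<^sup>2)"
    unfolding power2_norm_eq_inner by (simp add: inner_vec_def[of "A *v x"] matrix_vector_mul_component power2_eq_square)
  also have "\<dots> \<le> (\<Sum>i\<in>UNIV. (A $ i \<bullet> A $ i) * (x \<bullet> x))"
    by (intro sum_mono Cauchy_Schwarz_ineq)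
  also have "\<dots> = (norm A * norm x)\<^sup>2"
    by (simp add: power_mult_distrib power2_norm_eq_inner inner_vec_def[of A] sum_distrib_right)
  finally show "(norm (A *v x))\<^sup>2 \<le> (norm A * norm x)\<^sup>2" .
qed simp

text \<open>The transport form: the integral of \<open>(f \<otimes> g) : \<nabla>\<phi>\<close>.\<close>

definition transport :: "(real^'n \<Rightarrow> real^'n) \<Rightarrow> (real^'n \<Rightarrow> real^'n) \<Rightarrow> (real^'n \<Rightarrow> real^'n) \<Rightarrow> real" where
  "transport f g \<phi> = (LINT x|torus. f x \<bullet> (grad \<phi> x *v g x))"

lemma transport_integrable:
  assumes f: "square_integrable f" and g: "square_integrable g" and A: "continuous_on (cbox 0 1) A"
  shows "integrable torus (\<lambda>x. f x \<bullet> (A x *v g x :: real^'n))"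
    and "(\<And>x. x \<in> cbox 0 1 \<Longrightarrow> norm (A x) \<le> C) \<Longrightarrow>
      \<bar>LINT x|torus. f x \<bullet> (A x *v g x)\<bar> \<le> C * (sqrt (LINT x|torus. (norm (f x))\<^sup>2) * sqrt (LINT x|torus. (norm (g x))\<^sup>2))"
proof -
  have bound: "\<bar>f x \<bullet> (A x *v g x)\<bar> \<le> C * (norm (f x) * norm (g x))"
    if "norm (A x) \<le> C" for C x
  proof -
    have "\<bar>f x \<bullet> (A x *v g x)\<bar> \<le> norm (f x) * (norm (A x) * norm (g x))"
      by (intro order_trans[OF Cauchy_Schwarz_ineq2] mult_left_mono norm_matrix_vector_le norm_ge_zero)
    also have "\<dots> \<le> norm (f x) * (C * norm (g x))"
      by (intro mult_left_mono mult_right_mono that norm_ge_zero)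
    finally show ?thesis by (simp add: mult_ac)
  qed
  have "compact (A ` cbox 0 1)" by (intro compact_continuous_image A compact_cbox)
  then obtain D where D: "\<And>x. x \<in> cbox 0 1 \<Longrightarrow> norm (A x) \<le> D"
    by (meson bounded_iff compact_imp_bounded imageI)
  have fg: "integrable torus (\<lambda>x. norm (f x) * norm (g x))"
    using square_integrable_inner[OF square_integrable_norm[OF f] square_integrable_norm[OF g]] by simp
  have mA: "A \<in> borel_measurable torus"
    unfolding torus_def using A by (rule continuous_imp_measurable_on_sets_lebesgue) simp
  have "(\<lambda>x. A x *v g x) \<in> borel_measurable torus"
  proof (rule borel_measurable_continuous_Pair[where H = "\<lambda>A x. A *v x", OF mA])
    show "g \<in> borel_measurable torus" using g by (simp add: square_integrable_def)
    show "continuous_on UNIV (\<lambda>p. fst p *v snd p :: real^'n)"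
      unfolding matrix_vector_mult_def by (intro continuous_intros)
  qed
  then have m: "(\<lambda>x. f x \<bullet> (A x *v g x)) \<in> borel_measurable torus"
    using f by (auto simp: square_integrable_def)
  show int: "integrable torus (\<lambda>x. f x \<bullet> (A x *v g x))"
  proof (rule Bochner_Integration.integrable_bound[OF _ m])
    show "integrable torus (\<lambda>x. D * (norm (f x) * norm (g x)))" using fg by simp
    have "norm (f x \<bullet> (A x *v g x)) \<le> norm (D * (norm (f x) * norm (g x)))" if "x \<in> cbox 0 1" for x
      using bound[OF D[OF that]] unfolding real_norm_def by (rule order_trans[OF _ abs_ge_self])
    then show "AE x in torus. norm (f x \<bullet> (A x *v g x)) \<le> norm (D * (norm (f x) * norm (g x)))"
      by (intro AE_I2) simp
  qed
  assume C: "\<And>x. x \<in> cbox 0 1 \<Longrightarrow> norm (A x) \<le> C"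
  have "norm (A 0) \<le> C" by (rule C) (simp add: mem_box_cart)
  then have C0: "0 \<le> C" using norm_ge_zero[of "A 0"] by linarith
  have "\<bar>LINT x|torus. f x \<bullet> (A x *v g x)\<bar> \<le> (LINT x|torus. \<bar>f x \<bullet> (A x *v g x)\<bar>)"
    by (rule integral_abs_bound)
  also have "\<dots> \<le> (LINT x|torus. C * (norm (f x) * norm (g x)))"
    by (rule integral_mono) (use int fg bound C in auto)
  also have "\<dots> \<le> C * (sqrt (LINT x|torus. (norm (f x))\<^sup>2) * sqrt (LINT x|torus. (norm (g x))\<^sup>2))"
    by (simp add: mult_left_mono[OF square_integrable_Cauchy_Schwarz[OF f g] C0])
  finally show "\<bar>LINT x|torus. f x \<bullet> (A x *v g x)\<bar> \<le> C * (sqrt (LINT x|torus. (norm (f x))\<^sup>2) * sqrt (LINT x|torus. (norm (g x))\<^sup>2))" .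
qed

text \<open>The sum of the two transport terms is the integral of \<open>g\<close> against the
  gradient of \<open>f \<bullet> \<phi>\<close>, which vanishes for solenoidal \<open>g\<close>. All
  cancellations in the energy balance come from this.\<close>

lemma transport_antisymmetric:
  assumes f: "f \<in> C1_sigma" and g: "g \<in> L2_sigma" and \<phi>: "\<phi> \<in> C1_sigma"
  shows "transport f g \<phi> = - transport \<phi> g f"
proof -
  let ?G = "\<lambda>x. transpose (grad f x) *v \<phi> x + transpose (grad \<phi> x) *v f x"
  have "(LINT x|torus. g x \<bullet> ?G x) = 0"
  proof (rule L2_sigma_orthogonal[OF g])
    show "torus_periodic (\<lambda>x. f x \<bullet> \<phi> x)"
      using f \<phi> by (simp add: C1_sigma_def torus_periodic_def)
    show "GDERIV (\<lambda>x. f x \<bullet> \<phi> x) x :> ?G x" for x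
      unfolding gderiv_def
      using has_derivative_inner[OF C1_sigma_has_derivative[OF f, of x] C1_sigma_has_derivative[OF \<phi>, of x]]
      by (simp add: inner_add_right dot_lmul_matrix[symmetric] inner_commute add.commute)
    show "continuous_on UNIV ?G"
      unfolding matrix_vector_mult_def transpose_def
      by (intro continuous_intros C1_sigma_continuous f \<phi> C1_sigma_grad_continuous)
  qed
  moreover have "(LINT x|torus. g x \<bullet> ?G x) = transport f g \<phi> + transport \<phi> g f"
    unfolding transport_def
    using transport_integrable(1)[OF L2_sigma_square_integrable L2_sigma_square_integrable[OF g] C1_sigma_grad_continuous[OF \<phi>], of f]
      transport_integrable(1)[OF L2_sigma_square_integrable L2_sigma_square_integrable[OF g] C1_sigma_grad_continuous[OF f], of \<phi>]
      f \<phi> C1_sigma_subset_L2_sigma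
    by (subst Bochner_Integration.integral_add[symmetric])
      (auto simp: inner_add_right dot_lmul_matrix[symmetric] inner_commute add.commute)
  ultimately show ?thesis by simp
qed


section \<open>Trigonometric polynomials on the torus\<close>

definition integer_vec :: "real^'n \<Rightarrow> bool" where
  "integer_vec k \<longleftrightarrow> (\<forall>i. k $ i \<in> \<int>)"

text \<open>The phase \<open>\<theta>\<close> covers sines and cosines at once.\<close>

definition wave :: "real^'n \<Rightarrow> real \<Rightarrow> real^'n \<Rightarrow> real" where
  "wave k \<theta> x = cos (2 * pi * (k \<bullet> x) + \<theta>)"

lemma wave_periodic: "integer_vec k \<Longrightarrow> torus_periodic (wave k \<theta>)"
proof -
  assume k: "integer_vec k"
  have "wave k \<theta> (x + m) = wave k \<theta> x" if "\<forall>i. m $ i \<in> \<int>" for x m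
  proof -
    have "k \<bullet> m \<in> \<int>" using k that by (auto simp: inner_vec_def integer_vec_def)
    then obtain n where n: "k \<bullet> m = of_int n" by (auto elim: Ints_cases)
    have "2 * pi * (k \<bullet> (x + m)) + \<theta> = (2 * pi * (k \<bullet> x) + \<theta>) + 2 * pi * of_int n"
      by (simp add: inner_add_right n algebra_simps)
    then show ?thesis unfolding wave_def by (simp only: cos_add cos_int_2pin sin_int_2pin) simp
  qed
  then show ?thesis by (simp add: torus_periodic_def)
qed

lemma wave_has_derivative:
  "(wave k \<theta> has_derivative (\<lambda>h. - sin (2 * pi * (k \<bullet> x) + \<theta>) * (2 * pi * (k \<bullet> h)))) (at x)"
  unfolding wave_def by (auto intro!: derivative_eq_intros)

lemma wave_continuous: "continuous_on S (wave k \<theta>)"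
  unfolding wave_def by (intro continuous_intros)

text \<open>The gradient is a scalar multiple of the rank one matrix of \<open>a\<close> and
  \<open>k\<close>, whose trace is \<open>a \<bullet> k\<close>.\<close>

lemma wave_C1_sigma:
  fixes k a :: "real^'n"
  assumes "integer_vec k" "a \<bullet> k = 0"
  shows "(\<lambda>x. wave k \<theta> x *\<^sub>R a) \<in> C1_sigma"
proof -
  let ?A = "\<lambda>x. (- sin (2 * pi * (k \<bullet> x) + \<theta>) * 2 * pi) *\<^sub>R (\<chi> i j. a $ i * k $ j) :: real^'n^'n"
  have mv: "(\<chi> i j. a $ i * k $ j) *v h = (k \<bullet> h) *\<^sub>R a" for h
    by (simp add: vec_eq_iff matrix_vector_mult_def inner_vec_def sum_distrib_left sum_distrib_right mult_ac)
  have der: "((\<lambda>x. wave k \<theta> x *\<^sub>R a) has_derivative (\<lambda>h. ?A x *v h)) (at x)" for x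
    using has_derivative_scaleR_left[OF wave_has_derivative[of k \<theta> x], of a]
    by (simp only: scaleR_matrix_vector_assoc[symmetric] mv scaleR_scaleR mult.assoc)
  have g: "grad (\<lambda>x. wave k \<theta> x *\<^sub>R a) = ?A" using grad_eqI[OF der] by auto
  have "continuous_on UNIV ?A" by (intro continuous_intros)
  moreover have "(\<Sum>i\<in>UNIV. a $ i * k $ i) = 0" using assms(2) by (simp add: inner_vec_def)
  moreover have "trace (?A x) = (- sin (2 * pi * (k \<bullet> x) + \<theta>) * 2 * pi) * (\<Sum>i\<in>UNIV. a $ i * k $ i)" for x
    unfolding trace_def sum_distrib_left by simp
  moreover have "(\<lambda>x. wave k \<theta> x *\<^sub>R a) differentiable (at x)" for x
    unfolding differentiable_def using der by blast
  ultimately show ?thesis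
    using wave_periodic[OF assms(1), of \<theta>] by (auto simp: C1_sigma_def g torus_periodic_def)
qed

text \<open>The part of \<open>a\<close> along \<open>k\<close> gives a gradient, the part orthogonal to \<open>k\<close> a solenoidal field.\<close>

lemma orthogonal_waves:
  fixes f :: "real^'n \<Rightarrow> real^'n"
  assumes f: "f \<in> L2_sigma" and orth: "\<And>\<phi>. \<phi> \<in> C1_sigma \<Longrightarrow> (LINT x|torus. f x \<bullet> \<phi> x) = 0"
    and k: "integer_vec k"
  shows "(LINT x|torus. (f x \<bullet> a) * wave k \<theta> x) = 0"
proof (cases "k = 0")
  \<comment> \<open>For \<open>k = 0\<close> the wave is constant, and a constant field in any
    direction is solenoidal.\<close>
  case True
  then show ?thesis using orth[OF wave_C1_sigma[OF k, of a \<theta>]] by (simp add: mult.commute)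
next
  case False
  define l where "l = (a \<bullet> k) / (k \<bullet> k)"
  define b where "b = a - l *\<^sub>R k"
  have "b \<bullet> k = 0" using False by (simp add: b_def l_def inner_diff_left)
  then have b: "(LINT x|torus. f x \<bullet> (wave k \<theta> x *\<^sub>R b)) = 0" by (intro orth wave_C1_sigma k)
  have c: "(LINT x|torus. f x \<bullet> (wave k \<theta> x *\<^sub>R k)) = 0"
  proof (rule L2_sigma_orthogonal[OF f])
    \<comment> \<open>Shifting the phase by a quarter period and dividing by \<open>2 * pi\<close>
      gives a potential whose gradient is the wave in direction \<open>k\<close>.\<close>
    show "torus_periodic (\<lambda>x. wave k (\<theta> - pi / 2) x / (2 * pi))"
      using wave_periodic[OF k, of "\<theta> - pi/2"] by (simp add: torus_periodic_def)
    show "GDERIV (\<lambda>x. wave k (\<theta> - pi / 2) x / (2 * pi)) x :> wave k \<theta> x *\<^sub>R k" for x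
    proof -
      have "- sin (2 * pi * (k \<bullet> x) + (\<theta> - pi / 2)) = wave k \<theta> x"
        unfolding wave_def add_diff_eq by (simp add: sin_diff)
      then have "(wave k (\<theta> - pi / 2) has_derivative (\<lambda>h. wave k \<theta> x * (2 * pi * (k \<bullet> h)))) (at x)"
        using wave_has_derivative[of k "\<theta> - pi/2" x] by simp
      from has_derivative_mult_right[OF this, of "1 / (2 * pi)"] show ?thesis
        unfolding gderiv_def by (simp add: inner_commute)
    qed
    show "continuous_on UNIV (\<lambda>x. wave k \<theta> x *\<^sub>R k)" by (intro continuous_intros wave_continuous)
  qed
  have sq: "square_integrable (\<lambda>x. wave k \<theta> x *\<^sub>R c)" for c :: "real^'n"
    by (intro square_integrable_continuous continuous_intros wave_continuous)
  have "(LINT x|torus. (f x \<bullet> a) * wave k \<theta> x) =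
      (LINT x|torus. f x \<bullet> (wave k \<theta> x *\<^sub>R b) + l * (f x \<bullet> (wave k \<theta> x *\<^sub>R k)))"
    by (simp add: b_def inner_diff_right algebra_simps)
  also have "\<dots> = 0"
    using square_integrable_inner[OF L2_sigma_square_integrable[OF f] sq] b c
    by (subst Bochner_Integration.integral_add) auto
  finally show ?thesis .
qed

section \<open>The algebra of trigonometric polynomials\<close>

inductive trig_poly :: "(real^'n \<Rightarrow> real) \<Rightarrow> bool" where
  wave: "integer_vec k \<Longrightarrow> trig_poly (wave k \<theta>)"
| add: "trig_poly p \<Longrightarrow> trig_poly q \<Longrightarrow> trig_poly (\<lambda>x. p x + q x)"
| scale: "trig_poly p \<Longrightarrow> trig_poly (\<lambda>x. c * p x)"

lemma trig_poly_continuous: "trig_poly p \<Longrightarrow> continuous_on S p"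
  by (induction rule: trig_poly.induct) (auto intro!: continuous_intros wave_continuous)

lemma trig_poly_const: "trig_poly (\<lambda>x. c)"
  using trig_poly.scale[OF trig_poly.wave[of 0 0], of c] by (simp add: integer_vec_def wave_def[abs_def])

text \<open>The product formula for cosines turns two waves into waves of the integer frequencies
  \<open>k - l\<close> and \<open>k + l\<close>; bilinearity does the rest.\<close>

lemma trig_poly_mult:
  assumes "trig_poly p" "trig_poly q" shows "trig_poly (\<lambda>x. p x * q x)"
  using assms(1)
proof (induction rule: trig_poly.induct)
  case (wave k \<theta>)
  note k = wave
  show ?case using assms(2)
  proof (induction rule: trig_poly.induct)
    case (wave l \<eta>)
    have "trig_poly (\<lambda>x. (1/2) * (wave (k - l) (\<theta> - \<eta>) x + wave (k + l) (\<theta> + \<eta>) x))"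
      using k wave by (intro trig_poly.intros) (auto simp: integer_vec_def)
    also have "(\<lambda>x. (1/2) * (wave (k - l) (\<theta> - \<eta>) x + wave (k + l) (\<theta> + \<eta>) x)) = (\<lambda>x. wave k \<theta> x * wave l \<eta> x)"
    proof
      fix x
      have "2 * pi * ((k - l) \<bullet> x) + (\<theta> - \<eta>) = (2 * pi * (k \<bullet> x) + \<theta>) - (2 * pi * (l \<bullet> x) + \<eta>)"
        "2 * pi * ((k + l) \<bullet> x) + (\<theta> + \<eta>) = (2 * pi * (k \<bullet> x) + \<theta>) + (2 * pi * (l \<bullet> x) + \<eta>)"
        by (simp_all add: inner_diff_left inner_add_left algebra_simps)
      then show "(1/2) * (wave (k - l) (\<theta> - \<eta>) x + wave (k + l) (\<theta> + \<eta>) x) = wave k \<theta> x * wave l \<eta> x"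
        unfolding wave_def by (simp only: cos_times_cos)
    qed
    finally show ?case .
  next
    case (add p q)
    then show ?case using trig_poly.add by (simp add: distrib_left)
  next
    case (scale p c)
    then show ?case using trig_poly.scale[of _ c] by (simp add: mult.left_commute)
  qed
next
  case (add p q)
  then show ?case using trig_poly.add by (simp add: distrib_right)
next
  case (scale p c)
  then show ?case using trig_poly.scale[of _ c] by (simp add: mult.assoc)
qed

lemma trig_poly_sum: "finite A \<Longrightarrow> (\<And>i. i \<in> A \<Longrightarrow> trig_poly (p i)) \<Longrightarrow> trig_poly (\<lambda>x. \<Sum>i\<in>A. p i x)"
  by (induction A rule: finite_induct) (auto intro: trig_poly_const trig_poly.add)

text \<open>Each coordinate becomes a point of the unit circle, so opposite faces of the cube are
  identified. The image is a compact subset of a Euclidean space, on which polynomials can be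
  used.\<close>

definition torus_embedding :: "real^'n \<Rightarrow> (real^'n) \<times> (real^'n)" where
  "torus_embedding x = (\<chi> i. cos (2 * pi * x $ i), \<chi> i. sin (2 * pi * x $ i))"

lemma torus_embedding_continuous: "continuous_on S torus_embedding"
  unfolding torus_embedding_def by (intro continuous_intros)

lemma trig_poly_embedding:
  fixes P :: "(real^'n) \<times> (real^'n) \<Rightarrow> real"
  assumes "real_polynomial_function P" shows "trig_poly (\<lambda>x. P (torus_embedding x))"
  using assms
proof (induction rule: real_polynomial_function.induct)
  case (linear l)
  interpret bounded_linear l by fact
  have ax: "integer_vec (axis i 1 :: real^'n)" for i by (simp add: integer_vec_def axis_def)
  \<comment> \<open>Cosines are waves of phase 0 and sines are waves of phase
    \<open>- pi / 2\<close>; a linear function of the embedding combines only these.\<close>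
  have "l (torus_embedding x) = (\<Sum>i\<in>UNIV. l (axis i 1, 0) * wave (axis i 1) 0 x)
      + (\<Sum>i\<in>UNIV. l (0, axis i 1) * wave (axis i 1) (- pi / 2) x)" for x :: "real^'n"
  proof -
    have "torus_embedding x = (\<Sum>i\<in>UNIV. cos (2 * pi * x $ i) *\<^sub>R (axis i 1, 0))
        + (\<Sum>i\<in>UNIV. sin (2 * pi * x $ i) *\<^sub>R (0, axis i 1))"
      by (auto simp: torus_embedding_def prod_eq_iff fst_sum snd_sum vec_eq_iff axis_def if_distrib cong: if_cong)
    then show ?thesis
      by (simp add: add sum scaleR wave_def inner_axis' cos_diff mult.commute del: scaleR_Pair)
  qed
  moreover have "trig_poly (\<lambda>x. (\<Sum>i\<in>UNIV. l (axis i 1, 0) * wave (axis i 1) 0 x)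
      + (\<Sum>i\<in>UNIV. l (0, axis i 1) * wave (axis i 1) (- pi / 2) x))"
    by (intro trig_poly.intros trig_poly_sum ax finite)
  ultimately show ?case by simp
qed (auto intro: trig_poly_const trig_poly.add trig_poly_mult)

text \<open>Coordinates with equal image differ by an integer. Within the cube a nonzero difference
  is possible only between 0 and 1, which puts both points on the boundary.\<close>

lemma torus_embedding_eq:
  assumes xy: "x \<in> cbox 0 1" "y \<in> cbox 0 1" and eq: "torus_embedding x = torus_embedding y"
  shows "x = y \<or> (x \<notin> box 0 1 \<and> y \<notin> box 0 1)"
proof -
  have i: "x $ i = y $ i \<or> (x $ i \<in> {0, 1} \<and> y $ i \<in> {0, 1})" for i
  proof -
    have "sin (2 * pi * x $ i) = sin (2 * pi * y $ i) \<and> cos (2 * pi * x $ i) = cos (2 * pi * y $ i)"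
      using eq by (simp add: torus_embedding_def vec_eq_iff)
    then obtain n :: int where "2 * pi * x $ i = 2 * pi * y $ i + 2 * pi * n"
      using sin_cos_eq_iff by blast
    then have "2 * pi * x $ i = 2 * pi * (y $ i + n)" by (simp add: algebra_simps)
    then have n: "x $ i = y $ i + n" by simp
    have b: "0 \<le> x $ i" "x $ i \<le> 1" "0 \<le> y $ i" "y $ i \<le> 1" using xy by (auto simp: mem_box_cart)
    then have "real_of_int n \<le> 1" "-1 \<le> real_of_int n" using n by linarith+
    then have "n = 0 \<or> n = 1 \<or> n = -1" by linarith
    then show ?thesis using n b by auto
  qed
  show ?thesis
  proof (cases "x = y")
    case False
    then obtain i where "x $ i \<noteq> y $ i" by (auto simp: vec_eq_iff)
    then have "x $ i \<in> {0, 1}" "y $ i \<in> {0, 1}" using i by blast+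
    then have "x \<notin> box 0 1" "y \<notin> box 0 1" unfolding mem_box_cart by (auto intro!: exI[of _ i])
    then show ?thesis by simp
  qed simp
qed

text \<open>A continuous function on the cube vanishing on its boundary factors continuously through
  the image of the torus, where Stone-Weierstrass applies.\<close>

lemma trig_poly_approximation:
  fixes g :: "real^'n \<Rightarrow> real"
  assumes g: "continuous_on (cbox 0 1) g" and bd: "\<And>x. x \<in> cbox 0 1 - box 0 1 \<Longrightarrow> g x = 0" and e: "0 < \<epsilon>"
  obtains p where "trig_poly p" "\<And>x. x \<in> cbox 0 1 \<Longrightarrow> \<bar>g x - p x\<bar> < \<epsilon>"
proof -
  let ?E = "torus_embedding :: real^'n \<Rightarrow> _" and ?C = "cbox 0 1 :: (real^'n) set"
  \<comment> \<open>The arbitrary choice of a preimage is harmless: distinct preimages lie on the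
    boundary of the cube, where \<open>g\<close> vanishes.\<close>
  define G where "G y = g (SOME x. x \<in> ?C \<and> ?E x = y)" for y
  have G: "G (?E x) = g x" if x: "x \<in> ?C" for x
  proof -
    let ?x = "SOME z. z \<in> ?C \<and> ?E z = ?E x"
    have "?x \<in> ?C \<and> ?E ?x = ?E x" by (rule someI[of _ x]) (use x in simp)
    then have "?x = x \<or> (?x \<in> ?C - box 0 1 \<and> x \<in> ?C - box 0 1)"
      using torus_embedding_eq[of ?x x] x by blast
    then have "g ?x = g x" using bd[of ?x] bd[of x] by fastforce
    then show ?thesis by (simp add: G_def)
  qed
  have K: "compact (?E ` ?C)" by (intro compact_continuous_image torus_embedding_continuous compact_cbox)
  \<comment> \<open>Preimages of closed sets under \<open>G\<close> are images of compact sets under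
    the embedding, hence closed.\<close>
  have "continuous_on (?E ` ?C) G"
    unfolding continuous_on_closed_vimage[OF compact_imp_closed[OF K]]
  proof (intro allI impI)
    fix B :: "real set" assume "closed B"
    then have "closed (?C \<inter> g -` B)" using g by (intro continuous_closed_preimage) auto
    then have "compact (?C \<inter> (?C \<inter> g -` B))" by (intro compact_Int_closed compact_cbox)
    then have "compact (?C \<inter> g -` B)" by simp
    then have "compact (?E ` (?C \<inter> g -` B))" by (intro compact_continuous_image torus_embedding_continuous)
    moreover have "?E ` (?C \<inter> g -` B) = G -` B \<inter> ?E ` ?C" using G by auto
    ultimately show "closed (G -` B \<inter> ?E ` ?C)" by (simp add: compact_imp_closed)
  qed
  then obtain P where P: "real_polynomial_function P" "\<And>y. y \<in> ?E ` ?C \<Longrightarrow> \<bar>G y - P y\<bar> < \<epsilon>"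
    using Stone_Weierstrass_real_polynomial_function[OF K _ e] by metis
  show ?thesis
  proof (rule that[OF trig_poly_embedding[OF P(1)]])
    show "\<bar>g x - P (?E x)\<bar> < \<epsilon>" if "x \<in> ?C" for x
      using P(2)[OF imageI[OF that]] G[OF that] by simp
  qed
qed

section \<open>Totality of the solenoidal fields of class C1\<close>

text \<open>Inner regularity reduces the claim to closed sets \<open>C\<close> inside the open cube
  on which \<open>p\<close> is positive. Continuous cutoffs shrinking to \<open>C\<close> are
  admissible, so the integral of \<open>p\<close> over \<open>C\<close> with a positive weight is
  zero, and \<open>C\<close> is null.\<close>

lemma AE_torus_nonpos:
  fixes p :: "real^'n \<Rightarrow> real"
  assumes p: "square_integrable p"
    and orth: "\<And>g. continuous_on UNIV g \<Longrightarrow> (\<And>x. x \<in> cbox 0 1 - box 0 1 \<Longrightarrow> g x = 0)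
      \<Longrightarrow> (LINT x|torus. p x * g x) = 0"
  shows "AE x in torus. p x \<le> 0"
proof -
  let ?P = "{x \<in> box 0 1. 0 < p x}"
  have box: "box (0::real^'n) 1 \<subseteq> cbox 0 1" by (rule box_subset_cbox)
  have "(0 :: real^'n) \<in> - box 0 1" by (simp add: mem_box_cart)
  then have ne: "- box (0::real^'n) 1 \<noteq> {}" by blast
  have pint: "integrable torus (\<lambda>x. \<bar>p x\<bar>)" using square_integrable_integral_norm(1)[OF p] by simp
  have pm: "p \<in> borel_measurable torus" using p by (simp add: square_integrable_def)
  have null: "C \<in> null_sets lebesgue" if C: "closed C" "C \<subseteq> ?P" for C
  proof (cases "C = {}")
    case False
    \<comment> \<open>The distance to the complement of the open cube makes the test functions
      vanish on the boundary and is positive on \<open>C\<close>; the second factor of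
      \<open>?g\<close> decreases to the indicator of \<open>C\<close>.\<close>
    let ?b = "\<lambda>x :: real^'n. infdist x (- box 0 1)"
    let ?g = "\<lambda>n x. ?b x * max 0 (1 - real n * infdist x C)"
    let ?l = "\<lambda>x. p x * (?b x * indicator C x)"
    have b1: "?b x \<le> D" if "x \<in> cbox 0 1" "\<forall>x\<in>cbox 0 1. ?b x \<le> D" for x D using that by auto
    have cb: "continuous_on S ?b" for S by (intro continuous_intros)
    obtain D where D: "\<And>x. x \<in> cbox 0 1 \<Longrightarrow> ?b x \<le> D"
    proof -
      have "compact (?b ` cbox 0 1)" by (intro compact_continuous_image cb compact_cbox)
      then obtain D where "\<forall>y\<in>?b ` cbox 0 1. norm y \<le> D" using bounded_iff compact_imp_bounded by blast
      then show thesis by (intro that[of D]) auto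
    qed
    have CC: "C \<subseteq> cbox 0 1" using C(2) box by auto
    have Cs: "C \<in> sets torus"
      using C(1) CC by (auto simp: torus_def sets_restrict_space_iff intro!: borel_closed)
    have zero: "(LINT x|torus. p x * ?g n x) = 0" for n
    proof (rule orth)
      show "continuous_on UNIV (?g n)" by (intro continuous_intros)
      show "?g n x = 0" if "x \<in> cbox 0 1 - box 0 1" for x using that by simp
    qed
    have lm: "?l \<in> borel_measurable torus"
      using pm Cs continuous_imp_measurable_on_sets_lebesgue[OF cb, of "cbox 0 1"]
      by (auto simp: torus_def[symmetric] intro!: borel_measurable_times borel_measurable_indicator)
    have lim: "(\<lambda>n. p x * ?g n x) \<longlonglongrightarrow> ?l x" for x
    proof -
      have "(\<lambda>n. max 0 (1 - real n * infdist x C)) \<longlonglongrightarrow> indicator C x"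
      proof (cases "x \<in> C")
        case False
        then have d: "0 < infdist x C" using C(1) \<open>C \<noteq> {}\<close> by (intro infdist_pos_not_in_closed)
        have "\<forall>\<^sub>F n in sequentially. max 0 (1 - real n * infdist x C) = 0"
        proof (rule eventually_sequentiallyI[of "nat \<lceil>1 / infdist x C\<rceil>"])
          fix n assume "nat \<lceil>1 / infdist x C\<rceil> \<le> n"
          then have "1 / infdist x C \<le> real n" by linarith
          then show "max 0 (1 - real n * infdist x C) = 0" using d by (simp add: field_simps)
        qed
        then show ?thesis using False by (simp add: tendsto_eventually)
      qed simp
      then show ?thesis by (intro tendsto_intros)
    qed
    have bnd: "norm (p x * ?g n x) \<le> D * \<bar>p x\<bar>" if "x \<in> cbox 0 1" for x n
    proof -
      have "max 0 (1 - real n * infdist x C) \<le> 1" by (simp add: infdist_nonneg)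
      then have "?g n x \<le> D * 1" using D[OF that] infdist_nonneg[of x "- box 0 1"] by (intro mult_mono) auto
      moreover have "0 \<le> ?g n x" by (simp add: infdist_nonneg)
      ultimately show ?thesis
        by (simp add: abs_mult[of "p x"] mult.commute[of "\<bar>p x\<bar>"] mult_right_mono)
    qed
    have gm: "(\<lambda>x. p x * ?g n x) \<in> borel_measurable torus" for n
    proof -
      have "continuous_on (cbox 0 1) (?g n)" by (intro continuous_intros)
      then have "?g n \<in> borel_measurable torus"
        unfolding torus_def by (rule continuous_imp_measurable_on_sets_lebesgue) simp
      then show ?thesis using pm by simp
    qed
    have "(\<lambda>n. LINT x|torus. p x * ?g n x) \<longlonglongrightarrow> (LINT x|torus. ?l x)"
      by (rule integral_dominated_convergence[where w = "\<lambda>x. D * \<bar>p x\<bar>"])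
        (use lm gm lim bnd pint in \<open>auto intro!: AE_I2\<close>)
    then have l0: "(LINT x|torus. ?l x) = 0"
      unfolding zero by (rule LIMSEQ_unique) (rule tendsto_const)
    have "norm (?l x) \<le> norm (D * \<bar>p x\<bar>)" if "x \<in> cbox 0 1" for x
    proof -
      have "\<bar>?b x * indicator C x\<bar> \<le> D" "0 \<le> D"
        using D[OF that] infdist_nonneg[of x "- box 0 1"] by (auto simp: indicator_def)
      then have "\<bar>p x\<bar> * \<bar>?b x * indicator C x\<bar> \<le> \<bar>p x\<bar> * D" by (intro mult_left_mono) auto
      then show ?thesis using \<open>0 \<le> D\<close> by (simp add: abs_mult mult.commute[of D])
    qed
    then have lint: "integrable torus ?l"
      by (intro Bochner_Integration.integrable_bound[OF _ lm, of "\<lambda>x. D * \<bar>p x\<bar>"]) (use pint in \<open>auto intro!: AE_I2\<close>)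
    have pos: "0 < ?l x" if "x \<in> C" for x
    proof -
      have "0 < p x" "x \<notin> - box 0 1" using C(2) that by auto
      moreover have "0 < ?b x"
        using \<open>x \<notin> - box 0 1\<close> ne by (intro infdist_pos_not_in_closed) (auto simp: open_box)
      ultimately show ?thesis using that by simp
    qed
    then have "0 \<le> ?l x" for x by (cases "x \<in> C") (auto intro: less_imp_le)
    then have "AE x in torus. ?l x = 0"
      using l0 integral_nonneg_eq_0_iff_AE[OF lint] by auto
    moreover have "?l x \<noteq> 0" if "x \<in> C" for x using pos[OF that] by (rule less_imp_neq[symmetric])
    ultimately have "AE x in torus. x \<notin> C" by (auto elim: eventually_mono)
    then have "AE x in lebesgue. x \<in> cbox 0 1 \<longrightarrow> x \<notin> C"
      unfolding torus_def by (subst (asm) AE_restrict_space_iff) auto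
    then have "AE x in lebesgue. x \<notin> C" by eventually_elim (use CC in auto)
    then show ?thesis
      using C(1) by (subst AE_iff_null_sets) (auto intro: borel_closed)
  qed simp
  have Ps: "?P \<in> sets lebesgue"
  proof -
    have "p -` {0<..} \<inter> space torus \<in> sets torus" by (rule measurable_sets[OF pm]) simp
    then have "p -` {0<..} \<inter> cbox 0 1 \<in> sets lebesgue"
      by (simp add: torus_def sets_restrict_space_iff)
    then have "(p -` {0<..} \<inter> cbox 0 1) \<inter> box 0 1 \<in> sets lebesgue" by (rule sets.Int) simp
    moreover have "(p -` {0<..} \<inter> cbox 0 1) \<inter> box 0 1 = ?P" using box by auto
    ultimately show ?thesis by simp
  qed
  \<comment> \<open>The positive set is covered by a closed set, null by the above, and a remainder
    of measure below \<open>e\<close>.\<close>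
  have "emeasure lebesgue ?P \<le> ennreal e" if e: "0 < e" for e
  proof -
    obtain C where C: "closed C" "C \<subseteq> ?P" "?P - C \<in> lmeasurable" "emeasure lebesgue (?P - C) < ennreal e"
      using sets_lebesgue_inner_closed[OF Ps e] by blast
    have "emeasure lebesgue ?P \<le> emeasure lebesgue (C \<union> (?P - C))"
      using C Ps by (intro emeasure_mono) (auto intro: borel_closed)
    also have "\<dots> \<le> emeasure lebesgue C + emeasure lebesgue (?P - C)"
      using C(1,3) by (intro emeasure_subadditive) (auto intro: borel_closed)
    also have "\<dots> \<le> ennreal e" using null[OF C(1,2)] C(4) by (simp add: null_setsD1 less_imp_le)
    finally show ?thesis .
  qed
  then have "emeasure lebesgue ?P = 0"
    using ennreal_le_epsilon[of 0 "emeasure lebesgue ?P"] by simp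
  then have "?P \<in> null_sets lebesgue" using Ps by auto
  then have "?P \<union> (cbox 0 1 - box 0 1) \<in> null_sets lebesgue"
    using negligible_frontier_interval[of 0 "1 :: real^'n"] by (intro null_sets.Un) (auto simp: negligible_iff_null_sets)
  then have "AE x in lebesgue. x \<notin> ?P \<union> (cbox 0 1 - box 0 1)" by (rule AE_not_in)
  then have "AE x in lebesgue. x \<in> cbox 0 1 \<longrightarrow> p x \<le> 0"
    by eventually_elim (auto simp: not_less)
  then show ?thesis unfolding torus_def by (subst AE_restrict_space_iff) auto
qed

text \<open>Waves times constant vectors are orthogonal to \<open>f\<close>, hence so are
  trigonometric polynomials, and these approximate uniformly every continuous function vanishing on
  the boundary of the cube. Such functions detect \<open>f\<close> almost everywhere.\<close>

lemma C1_sigma_total: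
  fixes f :: "real^'n \<Rightarrow> real^'n"
  assumes f: "f \<in> L2_sigma" and orth: "\<And>\<phi>. \<phi> \<in> C1_sigma \<Longrightarrow> (LINT x|torus. f x \<bullet> \<phi> x) = 0"
  shows "AE x in torus. f x = 0"
proof -
  have sqf: "square_integrable f" by (rule L2_sigma_square_integrable[OF f])
  have sqa: "square_integrable (\<lambda>x. f x \<bullet> a)" for a
  proof -
    have m: "(\<lambda>x. f x \<bullet> a) \<in> borel_measurable torus"
      using sqf by (intro borel_measurable_inner) (auto simp: square_integrable_def)
    have "integrable torus (\<lambda>x. (norm (f x \<bullet> a))\<^sup>2)"
    proof (rule Bochner_Integration.integrable_bound)
      show "integrable torus (\<lambda>x. (norm a)\<^sup>2 * (norm (f x))\<^sup>2)" using sqf by (simp add: square_integrable_def)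
      show "(\<lambda>x. (norm (f x \<bullet> a))\<^sup>2) \<in> borel_measurable torus" using m by simp
      have "(f x \<bullet> a)\<^sup>2 \<le> (norm a)\<^sup>2 * (norm (f x))\<^sup>2" for x
        using Cauchy_Schwarz_ineq[of "f x" a] by (simp add: power2_norm_eq_inner mult.commute)
      then show "AE x in torus. norm ((norm (f x \<bullet> a))\<^sup>2) \<le> norm ((norm a)\<^sup>2 * (norm (f x))\<^sup>2)" by simp
    qed
    with m show ?thesis by (simp add: square_integrable_def)
  qed
  have trig: "(LINT x|torus. (f x \<bullet> a) * p x) = 0" if "trig_poly p" for p a
    using that
  proof (induction rule: trig_poly.induct)
    case (wave k \<theta>)
    show ?case by (rule orthogonal_waves[OF f orth wave])
  next
    case (add p q)
    have "integrable torus (\<lambda>x. (f x \<bullet> a) * p x)" "integrable torus (\<lambda>x. (f x \<bullet> a) * q x)"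
      using add.hyps square_integrable_inner[OF sqa[of a] square_integrable_continuous[OF trig_poly_continuous]] by auto
    then show ?case using add.IH by (simp add: distrib_left)
  next
    case (scale p c)
    have "(LINT x|torus. (f x \<bullet> a) * (c * p x)) = c * (LINT x|torus. (f x \<bullet> a) * p x)"
      by (simp add: mult.left_commute)
    then show ?case using scale.IH by simp
  qed
  have cont: "(LINT x|torus. (f x \<bullet> a) * g x) = 0"
    if g: "continuous_on UNIV g" "\<And>x. x \<in> cbox 0 1 - box 0 1 \<Longrightarrow> g x = 0" for g a
  proof -
    let ?I = "LINT x|torus. norm (f x \<bullet> a)"
    have I: "integrable torus (\<lambda>x. norm (f x \<bullet> a))" by (rule square_integrable_integral_norm(1)[OF sqa])
    have "\<bar>LINT x|torus. (f x \<bullet> a) * g x\<bar> \<le> \<epsilon> * ?I" if e: "0 < \<epsilon>" for \<epsilon>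
    proof -
      obtain p where p: "trig_poly p" "\<And>x. x \<in> cbox 0 1 \<Longrightarrow> \<bar>g x - p x\<bar> < \<epsilon>"
        by (rule trig_poly_approximation[OF continuous_on_subset[OF g(1) subset_UNIV] g(2) e]) (assumption, blast)
      have ig: "integrable torus (\<lambda>x. (f x \<bullet> a) * g x)" "integrable torus (\<lambda>x. (f x \<bullet> a) * p x)"
        using square_integrable_inner[OF sqa[of a] square_integrable_continuous[OF continuous_on_subset[OF g(1)]]]
          square_integrable_inner[OF sqa[of a] square_integrable_continuous[OF trig_poly_continuous[OF p(1)]]] by auto
      then have "(LINT x|torus. (f x \<bullet> a) * g x) = (LINT x|torus. (f x \<bullet> a) * g x - (f x \<bullet> a) * p x)"
        using trig[OF p(1)] by simp
      then have "\<bar>LINT x|torus. (f x \<bullet> a) * g x\<bar> \<le> (LINT x|torus. \<bar>(f x \<bullet> a) * g x - (f x \<bullet> a) * p x\<bar>)"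
        by (simp only: integral_abs_bound)
      also have "\<dots> \<le> (LINT x|torus. \<epsilon> * norm (f x \<bullet> a))"
      proof (rule integral_mono)
        fix x :: "real^'n" assume "x \<in> space torus"
        then have "\<bar>g x - p x\<bar> \<le> \<epsilon>" using p(2) by (simp add: less_imp_le)
        then have "\<bar>f x \<bullet> a\<bar> * \<bar>g x - p x\<bar> \<le> \<bar>f x \<bullet> a\<bar> * \<epsilon>" by (rule mult_left_mono) simp
        then show "\<bar>(f x \<bullet> a) * g x - (f x \<bullet> a) * p x\<bar> \<le> \<epsilon> * norm (f x \<bullet> a)"
          unfolding right_diff_distrib[symmetric] abs_mult real_norm_def by (simp only: mult.commute)
      qed (use ig I in auto)
      also have "\<dots> = \<epsilon> * ?I" by simp
      finally show ?thesis .
    qed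
    note bound = this
    have "0 \<le> ?I" by (rule Bochner_Integration.integral_nonneg) simp
    have "\<bar>LINT x|torus. (f x \<bullet> a) * g x\<bar> \<le> 0"
    proof (rule field_le_epsilon)
      fix e :: real assume "0 < e"
      \<comment> \<open>The approximation error is scaled by \<open>?I + 1\<close> because
        \<open>?I\<close> itself may vanish.\<close>
      have "e / (J + 1) * J \<le> e" if "0 \<le> J" for J :: real
        using that \<open>0 < e\<close> by (simp add: field_simps)
      from this[OF \<open>0 \<le> ?I\<close>] have "e / (?I + 1) * ?I \<le> e" .
      moreover have "\<bar>LINT x|torus. (f x \<bullet> a) * g x\<bar> \<le> e / (?I + 1) * ?I"
        by (intro bound divide_pos_pos \<open>0 < e\<close> add_nonneg_pos[OF \<open>0 \<le> ?I\<close>]) simp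
      ultimately show "\<bar>LINT x|torus. (f x \<bullet> a) * g x\<bar> \<le> 0 + e" by linarith
    qed
    then show ?thesis by simp
  qed
  \<comment> \<open>The one-sided statement for every direction \<open>a\<close> suffices: opposite
    directions give equality.\<close>
  have np: "AE x in torus. f x \<bullet> a \<le> 0" for a
    by (rule AE_torus_nonpos[OF sqa cont])
  have "AE x in torus. \<forall>i. f x $ i = 0"
  proof (subst AE_all_countable, intro allI)
    fix i
    from np[of "axis i 1"] np[of "- axis i 1"] show "AE x in torus. f x $ i = 0"
      by eventually_elim (simp add: inner_axis)
  qed
  then show ?thesis by eventually_elim (simp add: vec_eq_iff)
qed


section \<open>Separability\<close>

text \<open>Members of \<open>F\<close> are labelled by a finite net of \<open>S\<close>, an
  accuracy, and a table of values in a countable dense set. There are countably many labels, and one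
  member of \<open>F\<close> is picked for each label that occurs. This keeps the dense set inside
  \<open>F\<close>, where approximation by general continuous functions would leave it.\<close>

lemma countable_uniformly_dense:
  fixes F :: "('a::metric_space \<Rightarrow> 'b::{metric_space,second_countable_topology}) set"
  assumes S: "compact S" and F: "\<And>f. f \<in> F \<Longrightarrow> continuous_on S f"
  obtains D where "countable D" "D \<subseteq> F"
    "\<And>f \<epsilon>. f \<in> F \<Longrightarrow> 0 < \<epsilon> \<Longrightarrow> \<exists>g\<in>D. \<forall>x\<in>S. dist (f x) (g x) < \<epsilon>"
proof -
  let ?r = "\<lambda>n. inverse (real (Suc n))"
  obtain B :: "'b set" where B: "countable B" "\<And>X. open X \<Longrightarrow> X \<noteq> {} \<Longrightarrow> \<exists>d\<in>B. d \<in> X"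
    using countable_dense_exists by blast
  have "\<exists>C. finite C \<and> C \<subseteq> S \<and> S \<subseteq> (\<Union>c\<in>C. ball c (?r n))" for n
  proof -
    have "S \<subseteq> (\<Union>c\<in>S. ball c (?r n))" by force
    then obtain C where "C \<subseteq> S" "finite C" "S \<subseteq> (\<Union>c\<in>C. ball c (?r n))"
      by (rule compactE_image[OF S, rotated]) auto
    then show ?thesis by blast
  qed
  then have "\<forall>n. \<exists>C. finite C \<and> C \<subseteq> S \<and> S \<subseteq> (\<Union>c\<in>C. ball c (?r n))" by blast
  then obtain C where C: "\<And>n. finite (C n)" "\<And>n. C n \<subseteq> S" "\<And>n. S \<subseteq> (\<Union>c\<in>C n. ball c (?r n))"
    by metis
  \<comment> \<open>A function has the label \<open>(n, k, h)\<close> if on each ball of the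
    \<open>n\<close>-th net it is within \<open>?r k\<close> of the tabulated value.\<close>
  define P where "P = (\<lambda>(n, k, h) f. \<forall>c\<in>C n. \<forall>x\<in>S \<inter> ball c (?r n). dist (f x) (h c :: 'b) < ?r k)"
  define I where "I = (SIGMA n:UNIV. (UNIV :: nat set) \<times> (C n \<rightarrow>\<^sub>E B))"
  define D where "D = (\<lambda>i. SOME f. f \<in> F \<and> P i f) ` {i \<in> I. \<exists>f\<in>F. P i f}"
  have D: "(SOME f. f \<in> F \<and> P i f) \<in> F \<and> P i (SOME f. f \<in> F \<and> P i f)" if "\<exists>f\<in>F. P i f" for i
    using that by (intro someI_ex[where P = "\<lambda>f. f \<in> F \<and> P i f"]) blast
  have "countable I"
    unfolding I_def by (intro countable_SIGMA countable_PiE C B) auto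
  then have "countable D" unfolding D_def by (intro countable_image) (auto intro: countable_subset)
  moreover have "D \<subseteq> F" unfolding D_def using D by auto
  moreover have "\<exists>g\<in>D. \<forall>x\<in>S. dist (f x) (g x) < \<epsilon>" if f: "f \<in> F" and \<epsilon>: "0 < \<epsilon>" for f \<epsilon>
  proof -
    \<comment> \<open>Two functions sharing a label differ by less than twice \<open>?r k\<close>,
      whence \<open>\<epsilon> / 2\<close>.\<close>
    obtain k where k: "?r k < \<epsilon> / 2" using reals_Archimedean[of "\<epsilon> / 2"] \<epsilon> by auto
    have k2: "0 < ?r k / 2" by simp
    obtain \<delta> where \<delta>: "0 < \<delta>" "\<And>x y. x \<in> S \<Longrightarrow> y \<in> S \<Longrightarrow> dist x y < \<delta> \<Longrightarrow> dist (f x) (f y) < ?r k / 2"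
      using compact_uniformly_continuous[OF F[OF f] S, unfolded uniformly_continuous_on_def, rule_format, OF k2]
      by (auto simp: dist_commute)
    obtain n where n: "?r n < \<delta>" using reals_Archimedean[of \<delta>] \<delta>(1) by auto
    have "\<exists>b\<in>B. dist (f c) b < ?r k / 2" for c
      using B(2)[of "ball (f c) (?r k / 2)"] k2 by (force simp: ball_eq_empty)
    then obtain b where b: "\<And>c. b c \<in> B" "\<And>c. dist (f c) (b c) < ?r k / 2" by metis
    define i where "i = (n, k, restrict b (C n))"
    have "P i f"
      unfolding i_def P_def prod.case
    proof (intro ballI)
      fix c x assume c: "c \<in> C n" and x: "x \<in> S \<inter> ball c (?r n)"
      have "dist (f x) (f c) < ?r k / 2"
        using x c C(2)[of n] n by (intro \<delta>(2)) (auto simp: dist_commute)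
      moreover have "dist (f x) (b c) \<le> dist (f x) (f c) + dist (f c) (b c)" by (rule dist_triangle)
      ultimately show "dist (f x) (restrict b (C n) c) < ?r k" using b(2)[of c] c by simp
    qed
    moreover have "i \<in> I" using b(1) by (auto simp: I_def i_def)
    ultimately have iD: "(SOME f. f \<in> F \<and> P i f) \<in> D" using f by (auto simp: D_def)
    define g where "g = (SOME f. f \<in> F \<and> P i f)"
    have g: "P i g" unfolding g_def using D \<open>P i f\<close> f by blast
    have "dist (f x) (g x) < \<epsilon>" if "x \<in> S" for x
    proof -
      obtain c where c: "c \<in> C n" "x \<in> ball c (?r n)" using C(3)[of n] \<open>x \<in> S\<close> by auto
      have "dist (f x) (restrict b (C n) c) < ?r k" "dist (g x) (restrict b (C n) c) < ?r k"
        using \<open>P i f\<close> g c \<open>x \<in> S\<close> unfolding i_def P_def prod.case by blast+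
      then show ?thesis using k dist_triangle2[of "f x" "g x" "restrict b (C n) c"] by linarith
    qed
    then show ?thesis using iD g_def by blast
  qed
  ultimately show ?thesis by (rule that)
qed

text \<open>Separability applied to the pairs of field and gradient, so that the gradients are
  approximated uniformly as well; form and weight depend on them.\<close>

lemma C1_sigma_separable:
  obtains W :: "nat \<Rightarrow> real^'n \<Rightarrow> real^'n" where "\<And>n. W n \<in> C1_sigma"
    "\<And>\<phi> \<epsilon>. \<phi> \<in> C1_sigma \<Longrightarrow> 0 < \<epsilon> \<Longrightarrow>
       \<exists>n. \<forall>x\<in>cbox 0 1. norm (\<phi> x - W n x) < \<epsilon> \<and> norm (grad \<phi> x - grad (W n) x) < \<epsilon>"
proof -
  let ?J = "\<lambda>\<phi> (x :: real^'n). (\<phi> x, grad \<phi> x)"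
  obtain D where D: "countable D" "D \<subseteq> ?J ` C1_sigma"
    "\<And>f \<epsilon>. f \<in> ?J ` C1_sigma \<Longrightarrow> 0 < \<epsilon> \<Longrightarrow> \<exists>g\<in>D. \<forall>x\<in>cbox 0 1. dist (f x) (g x) < \<epsilon>"
    by (rule countable_uniformly_dense[of "cbox 0 1" "?J ` C1_sigma"])
      (auto intro!: continuous_on_Pair C1_sigma_continuous C1_sigma_grad_continuous)
  have z: "(\<lambda>_ :: real^'n. 0) \<in> C1_sigma"
    using wave_C1_sigma[of 0 "0 :: real^'n" 0] by (simp add: integer_vec_def)
  have "D \<noteq> {}" using D(3)[of "?J (\<lambda>_. 0)" 1] z by auto
  then have r: "range (from_nat_into D) = D" using D(1) by simp
  have "\<forall>n. \<exists>\<phi>\<in>C1_sigma. from_nat_into D n = ?J \<phi>" using D(2) r by (metis (no_types, lifting) image_iff rangeI subsetD)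
  then obtain W where W: "\<And>n. W n \<in> C1_sigma" "\<And>n. from_nat_into D n = ?J (W n)" by metis
  have "\<exists>n. \<forall>x\<in>cbox 0 1. norm (\<phi> x - W n x) < \<epsilon> \<and> norm (grad \<phi> x - grad (W n) x) < \<epsilon>"
    if \<phi>: "\<phi> \<in> C1_sigma" "0 < \<epsilon>" for \<phi> \<epsilon>
  proof -
    obtain g where g: "g \<in> D" "\<forall>x\<in>cbox 0 1. dist (?J \<phi> x) (g x) < \<epsilon>"
      using D(3)[OF imageI[OF \<phi>(1)] \<phi>(2)] by blast
    obtain n where n: "g = ?J (W n)" using g(1) r W(2) by (metis imageE)
    have "norm (\<phi> x - W n x) < \<epsilon> \<and> norm (grad \<phi> x - grad (W n) x) < \<epsilon>" if "x \<in> cbox 0 1" for x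
    proof -
      have "dist (?J \<phi> x) (?J (W n) x) < \<epsilon>" using g(2) that n by auto
      then show ?thesis
        using dist_fst_le[of "?J \<phi> x" "?J (W n) x"] dist_snd_le[of "?J \<phi> x" "?J (W n) x"] by (simp add: dist_norm)
    qed
    then show ?thesis by blast
  qed
  with W(1) show ?thesis by (rule that)
qed

section \<open>The spectral norm\<close>

text \<open>A maximiser of \<open>norm (A *v y)\<close> on the unit sphere is an eigenvector of
  \<open>transpose A ** A\<close> for its largest eigenvalue. So the \<open>GREATEST\<close> of the
  definition is attained, and the spectral norm is the operator norm.\<close>

lemma spectral_norm_attained:
  fixes A :: "real^'n^'n"
  obtains x where "norm x = 1" "spectral_norm A = norm (A *v x)"
    "\<And>y. norm (A *v y) \<le> norm (A *v x) * norm y"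
proof -
  let ?S = "sphere (0 :: real^'n) 1"
  have "?S \<noteq> {}" by (metis norm_axis_1 dist_0_norm empty_iff mem_sphere)
  moreover have "continuous_on ?S (\<lambda>y. norm (A *v y))"
    by (intro continuous_on_norm matrix_vector_mult_linear_continuous_on)
  ultimately obtain x where x: "x \<in> ?S" "\<And>y. y \<in> ?S \<Longrightarrow> norm (A *v y) \<le> norm (A *v x)"
    using continuous_attains_sup[of ?S "\<lambda>y. norm (A *v y)"] compact_sphere by blast
  have nx: "norm x = 1" using x(1) by simp
  have le: "norm (A *v y) \<le> norm (A *v x) * norm y" for y
  proof (cases "y = 0")
    case False
    then have "norm (A *v (y /\<^sub>R norm y)) \<le> norm (A *v x)" by (intro x(2)) simp
    then have "norm (A *v y) / norm y \<le> norm (A *v x)"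
      by (simp add: matrix_vector_mult_scaleR divide_inverse mult.commute)
    then show ?thesis using False by (simp add: pos_divide_le_eq)
  qed simp
  define l where "l = (norm (A *v x))\<^sup>2"
  have q: "(norm (A *v y))\<^sup>2 \<le> l * (norm y)\<^sup>2" for y
    using power_mono[OF le[of y] norm_ge_zero, of 2] by (simp add: l_def power_mult_distrib)
  have inner_sq: "((transpose A ** A) *v x) \<bullet> y = (A *v x) \<bullet> (A *v y)" for x y
    by (simp add: matrix_vector_mul_assoc[symmetric] dot_lmul_matrix)
  have eig: "(transpose A ** A) *v x = l *\<^sub>R x"
  proof -
    \<comment> \<open>\<open>d\<close> is the defect in the eigenvector equation. Moving the
      maximiser by \<open>t *\<^sub>R d\<close> changes a nonnegative gap, zero at
      \<open>t = 0\<close>, by \<open>2 * t * (d \<bullet> d)\<close> to first order.\<close>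
    define d where "d = l *\<^sub>R x - (transpose A ** A) *v x"
    have dd: "d \<bullet> d = l * (x \<bullet> d) - (A *v x) \<bullet> (A *v d)"
      by (metis d_def inner_diff_left inner_scaleR_left inner_sq)
    have pos: "0 \<le> 2 * t * (d \<bullet> d) + t\<^sup>2 * (l * (norm d)\<^sup>2 - (norm (A *v d))\<^sup>2)" for t
    proof -
      have "0 \<le> l * (norm (x + t *\<^sub>R d))\<^sup>2 - (norm (A *v (x + t *\<^sub>R d)))\<^sup>2" using q by simp
      also have "(norm (x + t *\<^sub>R d))\<^sup>2 = 1 + 2 * t * (x \<bullet> d) + t\<^sup>2 * (norm d)\<^sup>2"
        using nx unfolding power2_norm_eq_inner
        by (simp add: inner_add_left inner_add_right inner_commute power2_eq_square norm_eq_1)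
      also have "(norm (A *v (x + t *\<^sub>R d)))\<^sup>2 = l + 2 * t * ((A *v x) \<bullet> (A *v d)) + t\<^sup>2 * (norm (A *v d))\<^sup>2"
        unfolding l_def power2_norm_eq_inner matrix_vector_right_distrib matrix_vector_mult_scaleR
        by (simp add: inner_add_left inner_add_right inner_commute power2_eq_square)
      finally show ?thesis by (simp add: dd algebra_simps)
    qed
    let ?c = "l * (norm d)\<^sup>2 - (norm (A *v d))\<^sup>2"
    have "d \<bullet> d = 0"
    proof (rule ccontr)
      assume "d \<bullet> d \<noteq> 0"
      then have dp: "0 < d \<bullet> d" by simp
      \<comment> \<open>A negative \<open>t\<close> so small that the linear term beats the
        quadratic one; the 1 guards against \<open>?c = 0\<close>.\<close>
      define t where "t = - (d \<bullet> d) / (?c + 1)"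
      have c: "0 < ?c + 1" using q[of d] by linarith
      have t0: "t < 0" using dp c by (simp add: t_def divide_neg_pos)
      have "t * (?c + 1) = - (d \<bullet> d)" using c by (simp add: t_def)
      then have "t * ?c \<ge> - (d \<bullet> d)" using t0 by (simp add: algebra_simps)
      then have "0 < 2 * (d \<bullet> d) + t * ?c" using dp by linarith
      then have "t * (2 * (d \<bullet> d) + t * ?c) < 0" using t0 by (simp add: mult_neg_pos)
      then show False using pos[of t] by (simp add: power2_eq_square algebra_simps)
    qed
    then show ?thesis by (simp add: d_def)
  qed
  have "(GREATEST l. \<exists>x. x \<noteq> 0 \<and> (transpose A ** A) *v x = l *\<^sub>R x) = l"
  proof (rule Greatest_equality)
    show "\<exists>x. x \<noteq> 0 \<and> (transpose A ** A) *v x = l *\<^sub>R x" using eig nx by (intro exI[of _ x]) auto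
    fix m assume "\<exists>x. x \<noteq> 0 \<and> (transpose A ** A) *v x = m *\<^sub>R x"
    then obtain y where y: "y \<noteq> 0" "(transpose A ** A) *v y = m *\<^sub>R y" by blast
    have "m * (norm y)\<^sup>2 = (norm (A *v y))\<^sup>2"
      using inner_sq[of y y] y(2) by (simp add: power2_norm_eq_inner)
    also have "\<dots> \<le> l * (norm y)\<^sup>2" by (rule q)
    finally show "m \<le> l" using y(1) by simp
  qed
  then have "spectral_norm A = norm (A *v x)" by (simp add: spectral_norm_def l_def)
  with nx le show ?thesis by (intro that)
qed

lemma spectral_norm_nonneg: "0 \<le> spectral_norm A"
  by (metis norm_ge_zero spectral_norm_attained)

lemma spectral_norm_mult: "norm (A *v y) \<le> spectral_norm A * norm y"
  by (metis spectral_norm_attained)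

lemma spectral_norm_le:
  assumes "\<And>x. norm (A *v x) \<le> c * norm x" shows "spectral_norm A \<le> c"
  by (metis assms mult.right_neutral spectral_norm_attained)

text \<open>The spectral norm is subadditive and dominated by the Frobenius norm.\<close>

lemma spectral_norm_diff_le:
  fixes A B :: "real^'n^'n"
  shows "\<bar>spectral_norm A - spectral_norm B\<bar> \<le> norm (A - B)"
proof -
  have "spectral_norm A \<le> spectral_norm B + norm (A - B)" for A B :: "real^'n^'n"
  proof (rule spectral_norm_le)
    fix x
    have "A *v x = B *v x + (A - B) *v x" by (simp add: matrix_vector_mult_diff_rdistrib)
    then have "norm (A *v x) \<le> norm (B *v x) + norm ((A - B) *v x)" by (metis norm_triangle_ineq)
    then show "norm (A *v x) \<le> (spectral_norm B + norm (A - B)) * norm x"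
      using spectral_norm_mult[of B x] norm_matrix_vector_le[of "A - B" x] by (simp add: distrib_right)
  qed
  from this[of A B] this[of B A] show ?thesis by (simp add: norm_minus_commute)
qed

lemma continuous_on_spectral_norm:
  fixes \<Phi> :: "'b::topological_space \<Rightarrow> real^'n^'n"
  assumes "continuous_on S \<Phi>" shows "continuous_on S (\<lambda>x. spectral_norm (\<Phi> x))"
proof -
  have "1-lipschitz_on UNIV (spectral_norm :: real^'n^'n \<Rightarrow> real)"
    by (rule lipschitz_onI) (auto simp: dist_norm spectral_norm_diff_le)
  then have "continuous_on UNIV (spectral_norm :: real^'n^'n \<Rightarrow> real)" by (rule lipschitz_on_continuous_on)
  then show ?thesis using assms by (rule continuous_on_compose2) auto
qed

text \<open>\<open>real_of_ereal\<close> gives a meaningful value only for a finite essential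
  supremum. Compactness of the cube bounds it from above, and its positive measure bounds it from
  below by 0.\<close>

lemma Linfty_norm:
  fixes \<Phi> :: "real^'n \<Rightarrow> real^'n^'n"
  assumes \<Phi>: "continuous_on (cbox 0 1) \<Phi>"
  shows AE_le_Linfty_norm: "AE x in torus. spectral_norm (\<Phi> x) \<le> Linfty_norm \<Phi>"
    and Linfty_norm_nonneg: "0 \<le> Linfty_norm \<Phi>"
    and Linfty_norm_le: "(AE x in torus. spectral_norm (\<Phi> x) \<le> c) \<Longrightarrow> Linfty_norm \<Phi> \<le> c"
proof -
  let ?f = "\<lambda>x. ereal (spectral_norm (\<Phi> x))"
  have cf: "continuous_on (cbox 0 1) (\<lambda>x. spectral_norm (\<Phi> x))" by (rule continuous_on_spectral_norm[OF \<Phi>])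
  have m: "?f \<in> borel_measurable torus"
    unfolding torus_def using continuous_imp_measurable_on_sets_lebesgue[OF cf] by simp
  have "compact ((\<lambda>x. spectral_norm (\<Phi> x)) ` cbox 0 1)" by (intro compact_continuous_image cf compact_cbox)
  then obtain D where D: "\<forall>y\<in>(\<lambda>x. spectral_norm (\<Phi> x)) ` cbox 0 1. norm y \<le> D"
    using bounded_iff compact_imp_bounded by blast
  then have D: "\<forall>x\<in>cbox 0 1. spectral_norm (\<Phi> x) \<le> D" using abs_le_D1 by fastforce
  have up: "esssup torus ?f \<le> ereal d" if "AE x in torus. spectral_norm (\<Phi> x) \<le> d" for d
    by (rule esssup_I[OF m]) (use that in auto)
  have AE: "AE x in torus. ?f x \<le> esssup torus ?f" by (rule esssup_AE)
  have "emeasure torus (space torus :: (real^'n) set) \<noteq> 0"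
    using measure_torus[where 'n = 'n] by (auto simp: measure_def)
  then have "esssup torus (\<lambda>x :: real^'n. 0 :: ereal) = 0" by (rule esssup_const)
  moreover have "esssup torus (\<lambda>x :: real^'n. 0 :: ereal) \<le> esssup torus ?f"
    by (rule esssup_mono) (auto simp: spectral_norm_nonneg)
  ultimately have nonneg: "0 \<le> esssup torus ?f" by simp
  have "esssup torus ?f \<le> ereal D" by (rule up) (use D in \<open>fastforce intro!: AE_I2\<close>)
  then have fin: "\<bar>esssup torus ?f\<bar> \<noteq> \<infinity>" using nonneg by auto
  then have e: "ereal (Linfty_norm \<Phi>) = esssup torus ?f" by (simp add: Linfty_norm_def ereal_real)
  show "AE x in torus. spectral_norm (\<Phi> x) \<le> Linfty_norm \<Phi>" using AE unfolding e[symmetric] by simp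
  show "0 \<le> Linfty_norm \<Phi>" using nonneg unfolding e[symmetric] by simp
  show "Linfty_norm \<Phi> \<le> c" if "AE x in torus. spectral_norm (\<Phi> x) \<le> c"
    using up[OF that] unfolding e[symmetric] by simp
qed

lemma Linfty_norm_diff_le:
  assumes \<Phi>: "continuous_on (cbox 0 1) \<Phi>" and \<Psi>: "continuous_on (cbox 0 1) \<Psi>"
    and le: "\<And>x. x \<in> cbox 0 1 \<Longrightarrow> norm (\<Phi> x - \<Psi> x) \<le> \<delta>"
  shows "Linfty_norm \<Phi> \<le> Linfty_norm \<Psi> + \<delta>"
proof (rule Linfty_norm_le[OF \<Phi>])
  have "AE x in torus. x \<in> cbox 0 1" by (rule AE_I2) simp
  with AE_le_Linfty_norm[OF \<Psi>] show "AE x in torus. spectral_norm (\<Phi> x) \<le> Linfty_norm \<Psi> + \<delta>"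
  proof eventually_elim
    case (elim x)
    then show ?case using spectral_norm_diff_le[of "\<Phi> x" "\<Psi> x"] le[of x] by linarith
  qed
qed

section \<open>Symmetric and skew parts of matrices\<close>

lemma norm_transpose: "norm (transpose A) = norm (A :: real^'n^'m)"
  unfolding norm_eq_sqrt_inner inner_vec_def by (subst sum.swap) (simp add: transpose_def inner_vec_def)

lemma transpose_diff: "transpose (A - B) = transpose A - transpose (B :: real^'n^'m)"
  by (simp add: transpose_def vec_eq_iff)

lemma norm_sym_part_diff: "norm (sym_part A - sym_part B) \<le> norm (A - B)"
proof -
  have "sym_part A - sym_part B = (1/2) *\<^sub>R ((A - B) + transpose (A - B))"
    by (simp add: sym_part_def transpose_diff algebra_simps)
  then show ?thesis using norm_triangle_ineq[of "A - B" "transpose (A - B)"] by (simp add: norm_transpose)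
qed

lemma norm_skw_part_diff: "norm (skw_part A - skw_part B) \<le> norm (A - B)"
proof -
  have "skw_part A - skw_part B = (1/2) *\<^sub>R ((A - B) - transpose (A - B))"
    by (simp add: skw_part_def transpose_diff algebra_simps)
  then show ?thesis using norm_triangle_ineq4[of "A - B" "transpose (A - B)"] by (simp add: norm_transpose)
qed

lemma continuous_on_sym_part: "continuous_on S \<Phi> \<Longrightarrow> continuous_on S (\<lambda>x. sym_part (\<Phi> x))"
  unfolding sym_part_def transpose_def by (intro continuous_intros)

lemma continuous_on_skw_part: "continuous_on S \<Phi> \<Longrightarrow> continuous_on S (\<lambda>x. skw_part (\<Phi> x))"
  unfolding skw_part_def transpose_def by (intro continuous_intros)


section \<open>The magnetohydrodynamic form\<close>

lemma transport_cong_AE: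
  assumes "square_integrable f" "square_integrable f'" "square_integrable g" "square_integrable g'"
    and "AE x in torus. f x = f' x" "AE x in torus. g x = g' x" and \<phi>: "\<phi> \<in> C1_sigma"
  shows "transport f g \<phi> = transport f' g' \<phi>"
  unfolding transport_def
proof (rule integral_cong_AE)
  show "AE x in torus. f x \<bullet> (grad \<phi> x *v g x) = f' x \<bullet> (grad \<phi> x *v g' x)"
    using assms(5,6) by eventually_elim simp
qed (use transport_integrable(1)[OF _ _ C1_sigma_grad_continuous[OF \<phi>]] assms in blast)+

lemma transport_lincomb_field:
  assumes f: "square_integrable f" and g: "square_integrable g" and "\<phi> \<in> C1_sigma" "\<psi> \<in> C1_sigma"
  shows "transport f g (\<lambda>x. a *\<^sub>R \<phi> x + b *\<^sub>R \<psi> x) = a * transport f g \<phi> + b * transport f g \<psi>"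
proof -
  have "f x \<bullet> (grad (\<lambda>x. a *\<^sub>R \<phi> x + b *\<^sub>R \<psi> x) x *v g x)
      = a * (f x \<bullet> (grad \<phi> x *v g x)) + b * (f x \<bullet> (grad \<psi> x *v g x))" for x
    by (simp add: grad_lincomb[OF assms(3,4)] matrix_vector_mult_add_rdistrib
        scaleR_matrix_vector_assoc[symmetric] inner_add_right)
  then show ?thesis
    using transport_integrable(1)[OF f g C1_sigma_grad_continuous[OF assms(3)]]
      transport_integrable(1)[OF f g C1_sigma_grad_continuous[OF assms(4)]]
    by (simp add: transport_def)
qed

lemma transport_lincomb_left:
  assumes f: "square_integrable f" and f': "square_integrable f'" and g: "square_integrable g" and \<phi>: "\<phi> \<in> C1_sigma"
  shows "transport (\<lambda>x. a *\<^sub>R f x + b *\<^sub>R f' x) g \<phi> = a * transport f g \<phi> + b * transport f' g \<phi>"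
  using transport_integrable(1)[OF f g C1_sigma_grad_continuous[OF \<phi>]]
    transport_integrable(1)[OF f' g C1_sigma_grad_continuous[OF \<phi>]]
  by (simp add: transport_def inner_add_left)

lemma transport_lincomb_right:
  assumes f: "square_integrable f" and f': "square_integrable f'" and g: "square_integrable g" and \<phi>: "\<phi> \<in> C1_sigma"
  shows "transport g (\<lambda>x. a *\<^sub>R f x + b *\<^sub>R f' x) \<phi> = a * transport g f \<phi> + b * transport g f' \<phi>"
  using transport_integrable(1)[OF g f C1_sigma_grad_continuous[OF \<phi>]]
    transport_integrable(1)[OF g f' C1_sigma_grad_continuous[OF \<phi>]]
  by (simp add: transport_def matrix_vector_right_distrib matrix_vector_mult_scaleR inner_add_right)

lemma rep_sq: "square_integrable (rep u)"
  by (rule L2_sigma_square_integrable[OF rep_L2_sigma])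

text \<open>The transport form on classes. Representatives are needed to evaluate it, and
  \<open>transport_cong_AE\<close> makes their choice immaterial.\<close>

definition stress :: "(real^'n \<Rightarrow> real^'n) \<Rightarrow> 'n sfield \<Rightarrow> 'n sfield \<Rightarrow> real" where
  "stress \<phi> u w = transport (rep u) (rep w) \<phi>"

lemma stress_cls:
  assumes "f \<in> L2_sigma" "g \<in> L2_sigma" "\<phi> \<in> C1_sigma"
  shows "stress \<phi> (cls f) (cls g) = transport f g \<phi>"
  unfolding stress_def
  by (rule transport_cong_AE) (use assms rep_cls rep_sq L2_sigma_square_integrable in blast)+

lemma stress_bound:
  assumes "\<phi> \<in> C1_sigma" "\<And>x. x \<in> cbox 0 1 \<Longrightarrow> norm (grad \<phi> x) \<le> C"
  shows "\<bar>stress \<phi> u w\<bar> \<le> C * (norm u * norm w)"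
  using transport_integrable(2)[OF rep_sq rep_sq C1_sigma_grad_continuous[OF assms(1)] assms(2), of u w]
  by (simp add: stress_def transport_def norm_rep L2_norm_def)

lemma stress_bilinear:
  assumes \<phi>: "\<phi> \<in> C1_sigma" shows "bounded_bilinear (stress \<phi>)"
proof -
  have left: "stress \<phi> (a *\<^sub>R u + b *\<^sub>R u') w = a * stress \<phi> u w + b * stress \<phi> u' w" for a b u u' w
    unfolding stress_def transport_lincomb_left[OF rep_sq rep_sq rep_sq \<phi>, symmetric]
    by (rule transport_cong_AE) (auto intro!: rep_sq square_integrable_add square_integrable_scaleR rep_lincomb \<phi>)
  have right: "stress \<phi> w (a *\<^sub>R u + b *\<^sub>R u') = a * stress \<phi> w u + b * stress \<phi> w u'" for a b u u' w
    unfolding stress_def transport_lincomb_right[OF rep_sq rep_sq rep_sq \<phi>, symmetric]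
    by (rule transport_cong_AE) (auto intro!: rep_sq square_integrable_add square_integrable_scaleR rep_lincomb \<phi>)
  have "compact (grad \<phi> ` cbox 0 1)"
    by (intro compact_continuous_image C1_sigma_grad_continuous[OF \<phi>] compact_cbox)
  then obtain C where C: "\<And>x. x \<in> cbox 0 1 \<Longrightarrow> norm (grad \<phi> x) \<le> C"
    by (meson bounded_iff compact_imp_bounded imageI)
  show ?thesis
  proof
    show "stress \<phi> (u + u') w = stress \<phi> u w + stress \<phi> u' w" for u u' w using left[of 1 u 1 u' w] by simp
    show "stress \<phi> w (u + u') = stress \<phi> w u + stress \<phi> w u'" for u u' w using right[of w 1 u 1 u'] by simp
    show "stress \<phi> (r *\<^sub>R u) w = r *\<^sub>R stress \<phi> u w" for r u w using left[of r u 0 u w] by simp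
    show "stress \<phi> w (r *\<^sub>R u) = r *\<^sub>R stress \<phi> w u" for r u w using right[of w r u 0 u] by simp
    show "\<exists>K. \<forall>u w. norm (stress \<phi> u w) \<le> norm u * norm w * K"
      using stress_bound[OF \<phi> C] by (auto intro!: exI[of _ C] simp: mult.commute)
  qed
qed

text \<open>The magnetic field is rescaled: \<open>snd u\<close> stands for \<open>sqrt \<mu> * H\<close>, so that the energy is
  half the squared norm of \<open>u\<close>.\<close>

definition mhd :: "real \<Rightarrow> (real^'n \<Rightarrow> real^'n) \<Rightarrow> (real^'n \<Rightarrow> real^'n) \<Rightarrow>
    'n sfield \<times> 'n sfield \<Rightarrow> 'n sfield \<times> 'n sfield \<Rightarrow> real" where
  "mhd \<mu> \<phi> \<psi> u w = stress \<phi> (fst u) (fst w) - stress \<phi> (snd u) (snd w)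
     + 1 / sqrt \<mu> * (stress \<psi> (snd u) (fst w) - stress \<psi> (fst u) (snd w))"

lemma bounded_bilinear_lincomb:
  fixes f g :: "'a::real_normed_vector \<Rightarrow> 'b::real_normed_vector \<Rightarrow> real"
  assumes "bounded_bilinear f" "bounded_bilinear g"
  shows "bounded_bilinear (\<lambda>x y. f x y + c * g x y)"
proof -
  interpret f: bounded_bilinear f by fact
  interpret g: bounded_bilinear g by fact
  obtain K where K: "\<And>x y. norm (f x y) \<le> norm x * norm y * K" using f.bounded by blast
  obtain L where L: "\<And>x y. norm (g x y) \<le> norm x * norm y * L" using g.bounded by blast
  have "norm (f x y + c * g x y) \<le> norm x * norm y * (K + \<bar>c\<bar> * L)" for x y
  proof -
    have "\<bar>c\<bar> * \<bar>g x y\<bar> \<le> \<bar>c\<bar> * (norm x * norm y * L)" using L[of x y] by (intro mult_left_mono) auto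
    then show ?thesis
      using K[of x y] abs_triangle_ineq[of "f x y" "c * g x y"] by (simp add: abs_mult algebra_simps)
  qed
  then have "\<exists>K. \<forall>x y. norm (f x y + c * g x y) \<le> norm x * norm y * K" by blast
  then show ?thesis
    by (intro bounded_bilinear.intro)
      (simp_all add: f.add_left f.add_right g.add_left g.add_right f.scaleR_left f.scaleR_right
        g.scaleR_left g.scaleR_right distrib_left mult.left_commute)
qed

lemma mhd_bilinear:
  assumes "\<phi> \<in> C1_sigma" "\<psi> \<in> C1_sigma" shows "bounded_bilinear (mhd \<mu> \<phi> \<psi>)"
proof -
  note s = bounded_bilinear.comp[OF stress_bilinear[OF assms(1)]] bounded_bilinear.comp[OF stress_bilinear[OF assms(2)]]
  have "bounded_bilinear (\<lambda>u w. ((stress \<phi> (fst u) (fst w) + (-1) * stress \<phi> (snd u) (snd w))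
      + 1 / sqrt \<mu> * stress \<psi> (snd u) (fst w)) + (- 1 / sqrt \<mu>) * stress \<psi> (fst u) (snd w))"
    by (intro bounded_bilinear_lincomb s bounded_linear_fst bounded_linear_snd)
  then show ?thesis by (simp add: mhd_def[abs_def] algebra_simps)
qed

lemma mhd_lincomb:
  assumes "\<phi> \<in> C1_sigma" "\<phi>' \<in> C1_sigma" "\<psi> \<in> C1_sigma" "\<psi>' \<in> C1_sigma"
  shows "mhd \<mu> (\<lambda>x. a *\<^sub>R \<phi> x + b *\<^sub>R \<phi>' x) (\<lambda>x. a *\<^sub>R \<psi> x + b *\<^sub>R \<psi>' x) u w
     = a * mhd \<mu> \<phi> \<psi> u w + b * mhd \<mu> \<phi>' \<psi>' u w"
  by (simp add: mhd_def stress_def transport_lincomb_field[OF rep_sq rep_sq] assms algebra_simps add_divide_distrib diff_divide_distrib)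

lemma norm_prod_sq: "(norm u)\<^sup>2 = (norm (fst u))\<^sup>2 + (norm (snd u))\<^sup>2"
  by (cases u) (simp add: norm_Pair)

text \<open>Controls the dependence of the form on the test fields: applied to a difference of
  fields, \<open>\<epsilon>\<close> is the uniform distance of the gradients. Mixed products are
  absorbed by the sum of the squared norms.\<close>

lemma mhd_bound:
  assumes \<mu>: "0 < \<mu>" and \<phi>: "\<phi> \<in> C1_sigma" "\<psi> \<in> C1_sigma"
    and d: "\<And>x. x \<in> cbox 0 1 \<Longrightarrow> norm (grad \<phi> x) \<le> \<epsilon>" "\<And>x. x \<in> cbox 0 1 \<Longrightarrow> norm (grad \<psi> x) \<le> \<epsilon>"
  shows "\<bar>mhd \<mu> \<phi> \<psi> u u\<bar> \<le> \<epsilon> * (1 + 1 / sqrt \<mu>) * (norm u)\<^sup>2"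
proof -
  obtain v g where u: "u = (v, g)" by (cases u)
  have "norm (grad \<phi> 0) \<le> \<epsilon>" by (rule d) (simp add: mem_box_cart)
  then have \<epsilon>: "0 \<le> \<epsilon>" using norm_ge_zero[of "grad \<phi> 0"] by linarith
  have "\<bar>stress \<phi> v v - stress \<phi> g g\<bar> \<le> \<epsilon> * ((norm v)\<^sup>2 + (norm g)\<^sup>2)"
    using stress_bound[OF \<phi>(1) d(1), of v v] stress_bound[OF \<phi>(1) d(1), of g g]
    by (simp add: power2_eq_square distrib_left)
  moreover have "\<bar>stress \<psi> g v - stress \<psi> v g\<bar> \<le> \<epsilon> * ((norm v)\<^sup>2 + (norm g)\<^sup>2)"
  proof -
    have "\<epsilon> * (2 * norm v * norm g) \<le> \<epsilon> * ((norm v)\<^sup>2 + (norm g)\<^sup>2)"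
      by (intro mult_left_mono sum_squares_bound \<epsilon>)
    then show ?thesis
      using stress_bound[OF \<phi>(2) d(2), of v g] stress_bound[OF \<phi>(2) d(2), of g v] by (simp add: mult.commute)
  qed
  then have "1 / sqrt \<mu> * \<bar>stress \<psi> g v - stress \<psi> v g\<bar> \<le> 1 / sqrt \<mu> * (\<epsilon> * ((norm v)\<^sup>2 + (norm g)\<^sup>2))"
    using \<mu> by (intro mult_left_mono) auto
  moreover have "\<bar>1 / sqrt \<mu> * (stress \<psi> g v - stress \<psi> v g)\<bar> = 1 / sqrt \<mu> * \<bar>stress \<psi> g v - stress \<psi> v g\<bar>"
    using \<mu> by (simp add: abs_mult)
  moreover have "\<epsilon> * (1 + 1 / sqrt \<mu>) * ((norm v)\<^sup>2 + (norm g)\<^sup>2)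
      = \<epsilon> * ((norm v)\<^sup>2 + (norm g)\<^sup>2) + 1 / sqrt \<mu> * (\<epsilon> * ((norm v)\<^sup>2 + (norm g)\<^sup>2))"
    by (simp add: algebra_simps)
  ultimately show ?thesis
    unfolding norm_prod_sq u mhd_def fst_conv snd_conv by linarith
qed

lemma regularity_weight_nonneg:
  assumes "0 < \<mu>" "\<phi> \<in> C1_sigma" "\<psi> \<in> C1_sigma"
  shows "0 \<le> regularity_weight \<mu> \<phi> \<psi>"
  unfolding regularity_weight_def using assms
  by (intro add_nonneg_nonneg mult_nonneg_nonneg Linfty_norm_nonneg continuous_on_sym_part
      continuous_on_skw_part C1_sigma_grad_continuous) auto

text \<open>Each supremum norm is Lipschitz in the gradient with constant 1, so the prefactors
  \<open>2\<close> and \<open>2 / sqrt \<mu>\<close> of the weight add up to the constant.\<close>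

lemma regularity_weight_diff:
  assumes \<mu>: "0 < \<mu>" and \<phi>: "\<phi> \<in> C1_sigma" "\<psi> \<in> C1_sigma" "\<phi>' \<in> C1_sigma" "\<psi>' \<in> C1_sigma"
    and d: "\<And>x. x \<in> cbox 0 1 \<Longrightarrow> norm (grad \<phi> x - grad \<phi>' x) \<le> \<epsilon>"
      "\<And>x. x \<in> cbox 0 1 \<Longrightarrow> norm (grad \<psi> x - grad \<psi>' x) \<le> \<epsilon>"
  shows "\<bar>regularity_weight \<mu> \<phi> \<psi> - regularity_weight \<mu> \<phi>' \<psi>'\<bar> \<le> 2 * (\<epsilon> * (1 + 1 / sqrt \<mu>))"
proof -
  have le: "regularity_weight \<mu> \<phi> \<psi> \<le> regularity_weight \<mu> \<phi>' \<psi>' + 2 * (\<epsilon> * (1 + 1 / sqrt \<mu>))"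
    if "\<phi> \<in> C1_sigma" "\<psi> \<in> C1_sigma" "\<phi>' \<in> C1_sigma" "\<psi>' \<in> C1_sigma"
     "\<And>x. x \<in> cbox 0 1 \<Longrightarrow> norm (grad \<phi> x - grad \<phi>' x) \<le> \<epsilon>"
      "\<And>x. x \<in> cbox 0 1 \<Longrightarrow> norm (grad \<psi> x - grad \<psi>' x) \<le> \<epsilon>" for \<phi> \<psi> \<phi>' \<psi>' :: "real^'a \<Rightarrow> real^'a"
  proof -
    have 1: "Linfty_norm (\<lambda>x. sym_part (grad \<phi> x)) \<le> Linfty_norm (\<lambda>x. sym_part (grad \<phi>' x)) + \<epsilon>"
      using that by (intro Linfty_norm_diff_le continuous_on_sym_part C1_sigma_grad_continuous order_trans[OF norm_sym_part_diff]) auto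
    have 2: "Linfty_norm (\<lambda>x. skw_part (grad \<psi> x)) \<le> Linfty_norm (\<lambda>x. skw_part (grad \<psi>' x)) + \<epsilon>"
      using that by (intro Linfty_norm_diff_le continuous_on_skw_part C1_sigma_grad_continuous order_trans[OF norm_skw_part_diff]) auto
    have "2 / sqrt \<mu> * Linfty_norm (\<lambda>x. skw_part (grad \<psi> x)) \<le> 2 / sqrt \<mu> * (Linfty_norm (\<lambda>x. skw_part (grad \<psi>' x)) + \<epsilon>)"
      using 2 \<mu> by (intro mult_left_mono) auto
    then show ?thesis using 1 unfolding regularity_weight_def by (simp add: algebra_simps)
  qed
  show ?thesis
    using le[OF \<phi> d] le[OF \<phi>(3,4,1,2)] d by (simp add: norm_minus_commute abs_le_iff)
qed

text \<open>Pointwise, the symmetric part of \<open>\<nabla>\<phi>\<close> and the skew part of \<open>\<nabla>\<psi>\<close> control the quadratic form.\<close>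

lemma mhd_convex:
  assumes \<mu>: "0 < \<mu>" and \<phi>: "\<phi> \<in> C1_sigma" and \<psi>: "\<psi> \<in> C1_sigma"
  shows "0 \<le> mhd \<mu> \<phi> \<psi> u u + regularity_weight \<mu> \<phi> \<psi> / 2 * (norm u)\<^sup>2"
proof -
  define f g where "f = rep (fst u)" and "g = rep (snd u)"
  have sq: "square_integrable f" "square_integrable g" by (simp_all add: f_def g_def rep_sq)
  let ?S = "Linfty_norm (\<lambda>x. sym_part (grad \<phi> x))" and ?A = "Linfty_norm (\<lambda>x. skw_part (grad \<psi> x))"
  \<comment> \<open>Half of the regularity weight, the coefficient of the squared norm in the
    claim.\<close>
  let ?k = "?S + ?A / sqrt \<mu>"
  let ?I = "\<lambda>x. f x \<bullet> (grad \<phi> x *v f x) - g x \<bullet> (grad \<phi> x *v g x)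
      + 1 / sqrt \<mu> * (g x \<bullet> (grad \<psi> x *v f x) - f x \<bullet> (grad \<psi> x *v g x)) + ?k * ((norm (f x))\<^sup>2 + (norm (g x))\<^sup>2)"
  note gc = C1_sigma_grad_continuous[OF \<phi>] C1_sigma_grad_continuous[OF \<psi>]
  note ti = transport_integrable(1)[OF sq(1) sq(1) gc(1)] transport_integrable(1)[OF sq(2) sq(2) gc(1)]
    transport_integrable(1)[OF sq(2) sq(1) gc(2)] transport_integrable(1)[OF sq(1) sq(2) gc(2)]
  have int: "integrable torus (\<lambda>x. (norm (f x))\<^sup>2)" "integrable torus (\<lambda>x. (norm (g x))\<^sup>2)"
    using sq by (auto simp: square_integrable_def)
  have sym: "\<bar>a \<bullet> (M *v a)\<bar> \<le> spectral_norm (sym_part M) * (norm a)\<^sup>2" for a :: "real^'a" and M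
  proof -
    have "a \<bullet> (M *v a) = a \<bullet> (sym_part M *v a)"
      by (simp add: sym_part_def scaleR_matrix_vector_assoc[symmetric] matrix_vector_mult_add_rdistrib
          inner_add_right dot_lmul_matrix[symmetric] inner_commute)
    also have "\<bar>\<dots>\<bar> \<le> norm a * (spectral_norm (sym_part M) * norm a)"
      by (intro order_trans[OF Cauchy_Schwarz_ineq2] mult_left_mono spectral_norm_mult norm_ge_zero)
    finally show ?thesis by (simp add: power2_eq_square mult_ac)
  qed
  \<comment> \<open>Exchanging \<open>a\<close> and \<open>b\<close> doubles the skew part; the
    factor 2 is used up by the inequality \<open>2 * norm a * norm b \<le> (norm a)\<^sup>2 + (norm
    b)\<^sup>2\<close>, which leaves the coefficient 1 in front of the spectral norm.\<close>
  have skw: "\<bar>b \<bullet> (M *v a) - a \<bullet> (M *v b)\<bar> \<le> spectral_norm (skw_part M) * ((norm a)\<^sup>2 + (norm b)\<^sup>2)"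
    for a b :: "real^'a" and M
  proof -
    have "b \<bullet> (M *v a) - a \<bullet> (M *v b) = 2 * (b \<bullet> (skw_part M *v a))"
      by (simp add: skw_part_def scaleR_matrix_vector_assoc[symmetric] matrix_vector_mult_diff_rdistrib
          inner_diff_right dot_lmul_matrix[symmetric] inner_commute)
    also have "\<bar>\<dots>\<bar> \<le> 2 * (norm b * (spectral_norm (skw_part M) * norm a))"
      unfolding abs_mult
      by (intro mult_mono order_trans[OF Cauchy_Schwarz_ineq2] mult_left_mono spectral_norm_mult norm_ge_zero) auto
    also have "\<dots> = spectral_norm (skw_part M) * (2 * norm a * norm b)" by simp
    also have "\<dots> \<le> spectral_norm (skw_part M) * ((norm a)\<^sup>2 + (norm b)\<^sup>2)"
      by (intro mult_left_mono sum_squares_bound spectral_norm_nonneg)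
    finally show ?thesis .
  qed
  have "AE x in torus. 0 \<le> ?I x"
    using AE_le_Linfty_norm[OF continuous_on_sym_part[OF gc(1)]] AE_le_Linfty_norm[OF continuous_on_skw_part[OF gc(2)]]
  proof eventually_elim
    case (elim x)
    have 1: "\<bar>f x \<bullet> (grad \<phi> x *v f x)\<bar> \<le> ?S * (norm (f x))\<^sup>2" "\<bar>g x \<bullet> (grad \<phi> x *v g x)\<bar> \<le> ?S * (norm (g x))\<^sup>2"
      using elim(1) by (auto intro!: order_trans[OF sym] mult_right_mono)
    have 2: "\<bar>g x \<bullet> (grad \<psi> x *v f x) - f x \<bullet> (grad \<psi> x *v g x)\<bar> \<le> ?A * ((norm (f x))\<^sup>2 + (norm (g x))\<^sup>2)"
      using elim(2) by (intro order_trans[OF skw] mult_right_mono) auto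
    have "1 / sqrt \<mu> * \<bar>g x \<bullet> (grad \<psi> x *v f x) - f x \<bullet> (grad \<psi> x *v g x)\<bar>
        \<le> 1 / sqrt \<mu> * (?A * ((norm (f x))\<^sup>2 + (norm (g x))\<^sup>2))"
      using 2 \<mu> by (intro mult_left_mono) auto
    moreover have "\<bar>1 / sqrt \<mu> * (g x \<bullet> (grad \<psi> x *v f x) - f x \<bullet> (grad \<psi> x *v g x))\<bar>
        = 1 / sqrt \<mu> * \<bar>g x \<bullet> (grad \<psi> x *v f x) - f x \<bullet> (grad \<psi> x *v g x)\<bar>"
      using \<mu> by (simp add: abs_mult)
    moreover have "?k * ((norm (f x))\<^sup>2 + (norm (g x))\<^sup>2) = ?S * (norm (f x))\<^sup>2 + ?S * (norm (g x))\<^sup>2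
        + 1 / sqrt \<mu> * (?A * ((norm (f x))\<^sup>2 + (norm (g x))\<^sup>2))"
      by (simp add: algebra_simps)
    ultimately show ?case using 1 by linarith
  qed
  then have "0 \<le> (LINT x|torus. ?I x)" by (rule integral_nonneg_AE)
  also have "(LINT x|torus. ?I x) = transport f f \<phi> - transport g g \<phi>
      + 1 / sqrt \<mu> * (transport g f \<psi> - transport f g \<psi>)
      + ?k * ((LINT x|torus. (norm (f x))\<^sup>2) + (LINT x|torus. (norm (g x))\<^sup>2))"
    unfolding transport_def using ti int by simp
  also have "\<dots> = mhd \<mu> \<phi> \<psi> u u + regularity_weight \<mu> \<phi> \<psi> / 2 * (norm u)\<^sup>2"
    unfolding mhd_def stress_def regularity_weight_def norm_prod_sq f_def g_def
    by (simp add: norm_rep L2_norm_def)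
  finally show ?thesis .
qed

text \<open>Transport of a field by a solenoidal velocity does no work, and the work of the magnetic
  stress cancels the stretching term of the induction equation. The state is its own test vector, so
  the magnetic test field is \<open>\<mu> * H\<close>.\<close>

lemma mhd_cancel:
  assumes \<mu>: "0 < \<mu>" and \<phi>: "\<phi> \<in> C1_sigma" and \<psi>: "\<psi> \<in> C1_sigma"
    and u: "u = (cls \<phi>, (1 / sqrt \<mu>) *\<^sub>R cls \<psi>)"
  shows "mhd \<mu> \<phi> \<psi> u u = 0"
proof -
  have s: "\<phi> \<in> L2_sigma" "\<psi> \<in> L2_sigma" using C1_sigma_subset_L2_sigma \<phi> \<psi> by auto
  interpret p: bounded_bilinear "stress \<phi>" by (rule stress_bilinear[OF \<phi>])
  interpret q: bounded_bilinear "stress \<psi>" by (rule stress_bilinear[OF \<psi>])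
  have "transport \<phi> \<phi> \<phi> = 0" "transport \<psi> \<phi> \<psi> = 0" "transport \<phi> \<psi> \<psi> = - transport \<psi> \<psi> \<phi>"
    using transport_antisymmetric[OF \<phi> s(1) \<phi>] transport_antisymmetric[OF \<psi> s(1) \<psi>]
      transport_antisymmetric[OF \<phi> s(2) \<psi>] by auto
  then show ?thesis
    using \<mu> by (simp add: mhd_def u p.scaleR_left p.scaleR_right q.scaleR_left q.scaleR_right
        stress_cls s \<phi> \<psi> field_simps)
qed


section \<open>Solutions for test fields independent of time\<close>

text \<open>The set of disagreement in the open cube is open and null, hence empty; closure and
  periodicity give the other points. This allows the form and the weight to be functions of a
  Hilbert space vector.\<close>

lemma C1_sigma_cls_inj:
  fixes \<phi> \<psi> :: "real^'n \<Rightarrow> real^'n"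
  assumes \<phi>: "\<phi> \<in> C1_sigma" and \<psi>: "\<psi> \<in> C1_sigma" and eq: "cls \<phi> = cls \<psi>"
  shows "\<phi> = \<psi>"
proof -
  have AE: "AE x in torus. \<phi> x = \<psi> x"
    using eq cls_eq_iff C1_sigma_subset_L2_sigma \<phi> \<psi> by blast
  let ?N = "{x \<in> box 0 1. \<phi> x \<noteq> \<psi> x}"
  have "open ?N"
  proof -
    have "open (box 0 1 \<inter> (\<lambda>x. \<phi> x - \<psi> x) -` (- {0}))"
      by (intro continuous_open_preimage continuous_on_diff C1_sigma_continuous \<phi> \<psi>) (auto simp: open_box)
    moreover have "box 0 1 \<inter> (\<lambda>x. \<phi> x - \<psi> x) -` (- {0}) = ?N" by auto
    ultimately show ?thesis by simp
  qed
  moreover have "negligible ?N"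
  proof -
    have "AE x in lebesgue. x \<in> cbox 0 1 \<longrightarrow> \<phi> x = \<psi> x"
      using AE unfolding torus_def by (subst (asm) AE_restrict_space_iff) auto
    then have "AE x in lebesgue. x \<notin> ?N"
      by eventually_elim (use box_subset_cbox in blast)
    then show ?thesis
      using \<open>open ?N\<close> by (subst (asm) AE_iff_null_sets[symmetric]) (auto simp: negligible_iff_null_sets intro: borel_open)
  qed
  ultimately have "?N = {}" using open_not_negligible by blast
  then have box: "\<phi> x - \<psi> x = 0" if "x \<in> box 0 1" for x using that by auto
  have "box (0::real^'n) 1 \<noteq> {}" by (auto simp: box_ne_empty Basis_vec_def inner_axis)
  then have "closure (box (0::real^'n) 1) = cbox 0 1" by (rule closure_box)
  then have cbox: "\<phi> x = \<psi> x" if "x \<in> cbox 0 1" for x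
  proof -
    have "continuous_on (closure (box 0 1)) (\<lambda>x. \<phi> x - \<psi> x)"
      by (intro continuous_on_diff C1_sigma_continuous \<phi> \<psi>)
    then have "\<phi> x - \<psi> x = 0"
      by (rule continuous_constant_on_closure) (use box that \<open>closure (box 0 1) = cbox 0 1\<close> in auto)
    then show ?thesis by simp
  qed
  show ?thesis
  proof
    fix x :: "real^'n"
    \<comment> \<open>The integer part in each coordinate, so that \<open>x - k\<close> lies in the
      cube.\<close>
    define k where "k = (\<chi> i. (of_int \<lfloor>x $ i\<rfloor> :: real))"
    have "\<forall>i. k $ i \<in> \<int>" by (simp add: k_def)
    then have "\<phi> (x - k) = \<phi> x" "\<psi> (x - k) = \<psi> x"
      using \<phi> \<psi> by (auto simp: C1_sigma_def torus_periodic_def) (metis diff_add_cancel)+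
    moreover have "x - k \<in> cbox 0 1" by (auto simp: mem_box_cart k_def) linarith+
    ultimately show "\<phi> x = \<psi> x" using cbox by metis
  qed
qed

text \<open>The inverse of \<open>cls\<close> on \<open>C1\<close> fields. An arbitrary
  representative would have no gradient to insert into the form and the weight.\<close>

definition crep :: "'n sfield \<Rightarrow> real^'n \<Rightarrow> real^'n" where
  "crep x = (SOME \<phi>. \<phi> \<in> C1_sigma \<and> cls \<phi> = x)"

lemma crep_cls: "\<phi> \<in> C1_sigma \<Longrightarrow> crep (cls \<phi>) = \<phi>"
proof -
  assume \<phi>: "\<phi> \<in> C1_sigma"
  then have "crep (cls \<phi>) \<in> C1_sigma \<and> cls (crep (cls \<phi>)) = cls \<phi>"
    unfolding crep_def by (intro someI_ex[where P = "\<lambda>\<psi>. \<psi> \<in> C1_sigma \<and> cls \<psi> = cls \<phi>"]) blast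
  then show ?thesis using C1_sigma_cls_inj \<phi> by blast
qed

text \<open>Scaled inversely to the magnetic field, so that the inner product with the rescaled
  state is the integral of \<open>v \<bullet> \<phi> + H \<bullet> \<psi>\<close>.\<close>

definition test_pair :: "real \<Rightarrow> (real^'n \<Rightarrow> real^'n) \<Rightarrow> (real^'n \<Rightarrow> real^'n) \<Rightarrow> 'n sfield \<times> 'n sfield" where
  "test_pair \<mu> \<phi> \<psi> = (cls \<phi>, (1 / sqrt \<mu>) *\<^sub>R cls \<psi>)"

lemma crep_test_pair:
  assumes "0 < \<mu>" "\<phi> \<in> C1_sigma" "\<psi> \<in> C1_sigma"
  shows "crep (fst (test_pair \<mu> \<phi> \<psi>)) = \<phi>" "crep (sqrt \<mu> *\<^sub>R snd (test_pair \<mu> \<phi> \<psi>)) = \<psi>"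
  using assms by (simp_all add: test_pair_def crep_cls)

lemma test_pair_lincomb:
  assumes "\<phi> \<in> C1_sigma" "\<psi> \<in> C1_sigma" "\<phi>' \<in> C1_sigma" "\<psi>' \<in> C1_sigma"
  shows "a *\<^sub>R test_pair \<mu> \<phi> \<psi> + b *\<^sub>R test_pair \<mu> \<phi>' \<psi>'
    = test_pair \<mu> (\<lambda>x. a *\<^sub>R \<phi> x + b *\<^sub>R \<phi>' x) (\<lambda>x. a *\<^sub>R \<psi> x + b *\<^sub>R \<psi>' x)"
proof -
  have "\<phi> \<in> L2_sigma" "\<psi> \<in> L2_sigma" "\<phi>' \<in> L2_sigma" "\<psi>' \<in> L2_sigma"
    using assms C1_sigma_subset_L2_sigma by auto
  then show ?thesis by (simp add: test_pair_def cls_lincomb scaleR_add_right)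
qed

lemma norm_cls_diff_le:
  fixes f g :: "real^'n \<Rightarrow> real^'n"
  assumes f: "f \<in> L2_sigma" and g: "g \<in> L2_sigma" and le: "\<And>x. x \<in> cbox 0 1 \<Longrightarrow> norm (f x - g x) \<le> \<epsilon>"
  shows "norm (cls f - cls g) \<le> \<epsilon>"
proof -
  have d: "(\<lambda>x. f x - g x) \<in> L2_sigma" using L2_sigma_lincomb[OF f g, of 1 "-1"] by simp
  have "cls f - cls g = cls (\<lambda>x. f x - g x)" using cls_lincomb[OF f g, of 1 "-1"] by simp
  then have "norm (cls f - cls g) = sqrt (LINT x|torus. (norm (f x - g x))\<^sup>2)"
    by (simp add: norm_cls[OF d] L2_norm_def)
  also have "\<dots> \<le> sqrt (LINT x|(torus :: (real^'n) measure). \<epsilon>\<^sup>2)"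
  proof (rule real_sqrt_le_mono, rule integral_mono)
    show "integrable torus (\<lambda>x. (norm (f x - g x))\<^sup>2)"
      using L2_sigma_square_integrable[OF d] by (simp add: square_integrable_def)
    show "integrable (torus :: (real^'n) measure) (\<lambda>x. \<epsilon>\<^sup>2)"
      by (rule finite_measure.integrable_const[OF finite_measure_torus])
  qed (auto intro!: power_mono le)
  also have "\<dots> = \<epsilon>"
  proof -
    have "norm (f 0 - g 0) \<le> \<epsilon>" by (rule le) (simp add: mem_box_cart)
    then have "0 \<le> \<epsilon>" using norm_ge_zero[of "f 0 - g 0"] by linarith
    then show ?thesis by (simp add: measure_torus)
  qed
  finally show ?thesis .
qed

lemma test_pair_diff_le:
  assumes \<mu>: "0 < \<mu>" and "\<phi> \<in> C1_sigma" "\<psi> \<in> C1_sigma" "\<phi>' \<in> C1_sigma" "\<psi>' \<in> C1_sigma"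
    and "\<And>x. x \<in> cbox 0 1 \<Longrightarrow> norm (\<phi> x - \<phi>' x) \<le> \<epsilon>" "\<And>x. x \<in> cbox 0 1 \<Longrightarrow> norm (\<psi> x - \<psi>' x) \<le> \<epsilon>"
  shows "norm (test_pair \<mu> \<phi> \<psi> - test_pair \<mu> \<phi>' \<psi>') \<le> \<epsilon> * (1 + 1 / sqrt \<mu>)"
proof -
  have n: "norm (cls \<phi> - cls \<phi>') \<le> \<epsilon>" "norm (cls \<psi> - cls \<psi>') \<le> \<epsilon>"
    using assms C1_sigma_subset_L2_sigma by (auto intro!: norm_cls_diff_le)
  have "test_pair \<mu> \<phi> \<psi> - test_pair \<mu> \<phi>' \<psi>' = (cls \<phi> - cls \<phi>', (1 / sqrt \<mu>) *\<^sub>R (cls \<psi> - cls \<psi>'))"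
    by (simp add: test_pair_def scaleR_diff_right)
  also have "norm \<dots> \<le> norm (cls \<phi> - cls \<phi>') + norm ((1 / sqrt \<mu>) *\<^sub>R (cls \<psi> - cls \<psi>'))" by (rule norm_Pair_le)
  also have "\<dots> \<le> \<epsilon> + 1 / sqrt \<mu> * \<epsilon>"
    using n \<mu> by (intro add_mono) (auto simp: divide_right_mono)
  finally show ?thesis by (simp add: algebra_simps)
qed

text \<open>The part of the integrand without time derivatives, for the constant bound
  \<open>E = R / 2\<close>.\<close>

definition excess :: "real \<Rightarrow> real \<Rightarrow> (real^'n \<Rightarrow> real^'n) \<Rightarrow> (real^'n \<Rightarrow> real^'n) \<Rightarrow> 'n sfield \<times> 'n sfield \<Rightarrow> real" where
  "excess \<mu> R \<phi> \<psi> u = mhd \<mu> \<phi> \<psi> u u + regularity_weight \<mu> \<phi> \<psi> / 2 * ((norm u)\<^sup>2 - R)"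

text \<open>Both the form and the weight are Lipschitz in the gradients of the test fields. For
  states with squared norm at most \<open>R\<close> the last factor equals \<open>R\<close>, so the
  estimate is uniform; it serves density as well as freezing in time.\<close>

lemma excess_diff_le:
  assumes \<mu>: "0 < \<mu>" and \<phi>: "\<phi> \<in> C1_sigma" "\<psi> \<in> C1_sigma" "\<phi>' \<in> C1_sigma" "\<psi>' \<in> C1_sigma"
    and d: "\<And>x. x \<in> cbox 0 1 \<Longrightarrow> norm (grad \<phi> x - grad \<phi>' x) \<le> \<epsilon>"
      "\<And>x. x \<in> cbox 0 1 \<Longrightarrow> norm (grad \<psi> x - grad \<psi>' x) \<le> \<epsilon>"
  shows "\<bar>excess \<mu> R \<phi> \<psi> u - excess \<mu> R \<phi>' \<psi>' u\<bar> \<le> \<epsilon> * (1 + 1 / sqrt \<mu>) * ((norm u)\<^sup>2 + \<bar>(norm u)\<^sup>2 - R\<bar>)"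
proof -
  let ?\<phi> = "\<lambda>x. 1 *\<^sub>R \<phi> x + (-1) *\<^sub>R \<phi>' x" and ?\<psi> = "\<lambda>x. 1 *\<^sub>R \<psi> x + (-1) *\<^sub>R \<psi>' x"
  let ?w = "regularity_weight \<mu> \<phi> \<psi> - regularity_weight \<mu> \<phi>' \<psi>'"
  have "\<bar>mhd \<mu> ?\<phi> ?\<psi> u u\<bar> \<le> \<epsilon> * (1 + 1 / sqrt \<mu>) * (norm u)\<^sup>2"
  proof (rule mhd_bound[OF \<mu> C1_sigma_lincomb[OF \<phi>(1,3)] C1_sigma_lincomb[OF \<phi>(2,4)]])
    show "norm (grad ?\<phi> x) \<le> \<epsilon>" "norm (grad ?\<psi> x) \<le> \<epsilon>" if "x \<in> cbox 0 1" for x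
      unfolding grad_lincomb[OF \<phi>(1,3)] grad_lincomb[OF \<phi>(2,4)] using d[OF that] by simp_all
  qed
  moreover have "mhd \<mu> ?\<phi> ?\<psi> u u = mhd \<mu> \<phi> \<psi> u u - mhd \<mu> \<phi>' \<psi>' u u"
    using mhd_lincomb[OF \<phi>(1,3,2,4), of \<mu> 1 "-1" u u] by simp
  moreover have "\<bar>?w / 2 * ((norm u)\<^sup>2 - R)\<bar> \<le> \<epsilon> * (1 + 1 / sqrt \<mu>) * \<bar>(norm u)\<^sup>2 - R\<bar>"
  proof -
    have "\<bar>?w\<bar> \<le> 2 * (\<epsilon> * (1 + 1 / sqrt \<mu>))" by (rule regularity_weight_diff[OF \<mu> \<phi> d])
    moreover have "\<bar>a / 2\<bar> \<le> X" if "\<bar>a\<bar> \<le> 2 * X" for a X :: real using that by simp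
    ultimately have "\<bar>?w / 2\<bar> \<le> \<epsilon> * (1 + 1 / sqrt \<mu>)" by blast
    then show ?thesis unfolding abs_mult by (rule mult_right_mono) simp
  qed
  moreover have "excess \<mu> R \<phi> \<psi> u - excess \<mu> R \<phi>' \<psi>' u
      = (mhd \<mu> \<phi> \<psi> u u - mhd \<mu> \<phi>' \<psi>' u u) + ?w / 2 * ((norm u)\<^sup>2 - R)"
    unfolding excess_def by (simp add: diff_divide_distrib left_diff_distrib)
  ultimately show ?thesis unfolding distrib_left by linarith
qed

lemma excess_continuous:
  assumes "\<phi> \<in> C1_sigma" "\<psi> \<in> C1_sigma" shows "continuous_on A (excess \<mu> R \<phi> \<psi>)"
  unfolding excess_def
  by (intro continuous_intros bounded_bilinear.continuous_on[OF mhd_bilinear[OF assms]])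

lemma excess_bound:
  assumes "\<phi> \<in> C1_sigma" "\<psi> \<in> C1_sigma"
  shows "\<exists>M. \<forall>u. (norm u)\<^sup>2 \<le> R \<longrightarrow> \<bar>excess \<mu> R \<phi> \<psi> u\<bar> \<le> M"
proof -
  obtain C where C: "\<And>u w. \<bar>mhd \<mu> \<phi> \<psi> u w\<bar> \<le> norm u * norm w * C" "0 < C"
    using bounded_bilinear.pos_bounded[OF mhd_bilinear[OF assms], of \<mu>] by auto
  have "\<bar>excess \<mu> R \<phi> \<psi> u\<bar> \<le> R * C + \<bar>regularity_weight \<mu> \<phi> \<psi> / 2\<bar> * R" if "(norm u)\<^sup>2 \<le> R" for u
  proof -
    have "\<bar>mhd \<mu> \<phi> \<psi> u u\<bar> \<le> (norm u)\<^sup>2 * C" using C(1)[of u u] by (simp add: power2_eq_square)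
    also have "\<dots> \<le> R * C" using that C(2) by simp
    finally have 1: "\<bar>mhd \<mu> \<phi> \<psi> u u\<bar> \<le> R * C" .
    have "\<bar>(norm u)\<^sup>2 - R\<bar> \<le> R" using that by simp
    then have "\<bar>regularity_weight \<mu> \<phi> \<psi> / 2\<bar> * \<bar>(norm u)\<^sup>2 - R\<bar> \<le> \<bar>regularity_weight \<mu> \<phi> \<psi> / 2\<bar> * R"
      by (rule mult_left_mono) simp
    then have 2: "\<bar>regularity_weight \<mu> \<phi> \<psi> / 2 * ((norm u)\<^sup>2 - R)\<bar> \<le> \<bar>regularity_weight \<mu> \<phi> \<psi> / 2\<bar> * R"
      by (simp only: abs_mult)
    show ?thesis unfolding excess_def using 1 2 by linarith
  qed
  then show ?thesis by blast
qed

lemma (in orthobasis) weakly_continuous_integrable: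
  fixes g :: "real \<Rightarrow> 'h \<Rightarrow> real"
  assumes "\<And>j. continuous_on {a..b} (\<lambda>t. inner (u t) (e j))"
    and "continuous_on ({a..b} \<times> UNIV) (\<lambda>(t, x). g t x)" and "\<And>t. t \<in> {a..b} \<Longrightarrow> \<bar>g t (u t)\<bar> \<le> M"
  shows "(\<lambda>t. g t (u t)) integrable_on {a..b}"
  by (rule measurable_bounded_by_integrable_imp_integrable_real[OF weakly_continuous_measurable[OF assms(1,2)]
        integrable_const_ivl assms(3)]) auto

text \<open>The Galerkin limit gives the inequality for a sequence of test pairs dense in
  \<open>C1\<close>. Since the excess is continuous in the gradients, it extends to all pairs of
  \<open>C1_sigma\<close> fields.\<close>

lemma static_solution:
  fixes u0 :: "('n::finite) sfield \<times> 'n sfield"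
  assumes \<mu>: "0 < \<mu>" and T: "0 < T"
  obtains e :: "nat \<Rightarrow> 'n sfield \<times> 'n sfield" and u :: "real \<Rightarrow> 'n sfield \<times> 'n sfield" where
    "orthobasis e" "u 0 = u0" "\<And>t. t \<in> {0..T} \<Longrightarrow> norm (u t) \<le> norm u0"
    "\<And>y. continuous_on {0..T} (\<lambda>t. inner (u t) y)"
    "\<And>\<phi> \<psi> s t. \<phi> \<in> C1_sigma \<Longrightarrow> \<psi> \<in> C1_sigma \<Longrightarrow> 0 \<le> s \<Longrightarrow> s \<le> t \<Longrightarrow> t \<le> T \<Longrightarrow>
       integral {s..t} (\<lambda>\<tau>. excess \<mu> ((norm u0)\<^sup>2) \<phi> \<psi> (u \<tau>)) \<le> inner (u t - u s) (test_pair \<mu> \<phi> \<psi>)"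
proof -
  let ?c = "1 + 1 / sqrt \<mu>" and ?R = "(norm u0)\<^sup>2"
  have c: "0 < ?c" using \<mu> by (simp add: add_pos_pos)
  obtain W :: "nat \<Rightarrow> real^'n \<Rightarrow> real^'n" where W: "\<And>n. W n \<in> C1_sigma"
    and dense: "\<And>\<phi> \<epsilon>. \<phi> \<in> C1_sigma \<Longrightarrow> 0 < \<epsilon> \<Longrightarrow>
       \<exists>n. \<forall>x\<in>cbox 0 1. norm (\<phi> x - W n x) < \<epsilon> \<and> norm (grad \<phi> x - grad (W n) x) < \<epsilon>"
    using C1_sigma_separable by blast
  \<comment> \<open>Decoding a natural number into two indices enumerates all pairs of fields from
    the dense sequence.\<close>
  define wf where "wf n = W (fst (prod_decode n))" for n
  define wg where "wg n = W (snd (prod_decode n))" for n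
  define w where "w n = test_pair \<mu> (wf n) (wg n)" for n
  have wC: "wf n \<in> C1_sigma" "wg n \<in> C1_sigma" for n by (simp_all add: wf_def wg_def W)
  \<comment> \<open>Gradients must be uniformly close for the form and the weight; for the increment
    of \<open>u\<close> it is enough that the pairs are close in the Hilbert norm.\<close>
  have approx: "\<exists>n. (\<forall>x\<in>cbox 0 1. norm (grad \<phi> x - grad (wf n) x) \<le> \<epsilon> \<and> norm (grad \<psi> x - grad (wg n) x) \<le> \<epsilon>)
      \<and> norm (test_pair \<mu> \<phi> \<psi> - w n) \<le> \<epsilon> * ?c"
    if \<phi>: "\<phi> \<in> C1_sigma" "\<psi> \<in> C1_sigma" "0 < \<epsilon>" for \<phi> \<psi> \<epsilon>
  proof -
    obtain i j where i: "\<forall>x\<in>cbox 0 1. norm (\<phi> x - W i x) < \<epsilon> \<and> norm (grad \<phi> x - grad (W i) x) < \<epsilon>"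
      and j: "\<forall>x\<in>cbox 0 1. norm (\<psi> x - W j x) < \<epsilon> \<and> norm (grad \<psi> x - grad (W j) x) < \<epsilon>"
      using dense[OF \<phi>(1,3)] dense[OF \<phi>(2,3)] by blast
    have "norm (test_pair \<mu> \<phi> \<psi> - test_pair \<mu> (W i) (W j)) \<le> \<epsilon> * ?c"
      by (rule test_pair_diff_le[OF \<mu> \<phi>(1,2) W W]) (use i j in \<open>auto intro: less_imp_le\<close>)
    then show ?thesis
      using i j by (intro exI[of _ "prod_encode (i, j)"]) (auto simp: w_def wf_def wg_def less_imp_le)
  qed
  have zero: "(\<lambda>_ :: real^'n. 0) \<in> C1_sigma"
    using C1_sigma_lincomb[OF W W, of 0 0 0 0] by simp
  have cls0: "cls (\<lambda>_ :: real^'n. 0) = 0"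
    using cls_lincomb[OF zero_L2_sigma zero_L2_sigma, of 0 0] by simp
  have total_w: "total_sequence w"
    unfolding total_sequence_def
  proof (intro allI impI)
    fix x assume x: "\<forall>n. inner x (w n) = 0"
    have z: "inner x (test_pair \<mu> \<phi> \<psi>) = 0" if \<phi>: "\<phi> \<in> C1_sigma" "\<psi> \<in> C1_sigma" for \<phi> \<psi>
    proof -
      have "\<bar>inner x (test_pair \<mu> \<phi> \<psi>)\<bar> \<le> 0"
      proof (rule field_le_epsilon)
        fix \<epsilon> :: real assume \<epsilon>: "0 < \<epsilon>"
        define \<eta> where "\<eta> = \<epsilon> / ((norm x + 1) * ?c)"
        have nx: "0 < norm x + 1" by (simp add: add_nonneg_pos)
        have \<eta>: "0 < \<eta>" unfolding \<eta>_def by (intro divide_pos_pos mult_pos_pos \<epsilon> nx c)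
        obtain n where n: "norm (test_pair \<mu> \<phi> \<psi> - w n) \<le> \<eta> * ?c" using approx[OF \<phi> \<eta>] by blast
        have "inner x (test_pair \<mu> \<phi> \<psi>) = inner x (test_pair \<mu> \<phi> \<psi> - w n)" using x by (simp add: inner_diff_right)
        then have "\<bar>inner x (test_pair \<mu> \<phi> \<psi>)\<bar> \<le> norm x * norm (test_pair \<mu> \<phi> \<psi> - w n)"
          using Cauchy_Schwarz_ineq2 by metis
        also have "\<dots> \<le> (norm x + 1) * (\<eta> * ?c)" using n by (intro mult_mono) auto
        also have "\<dots> = \<epsilon>" using nx c by (simp add: \<eta>_def)
        finally show "\<bar>inner x (test_pair \<mu> \<phi> \<psi>)\<bar> \<le> 0 + \<epsilon>" by simp
      qed
      then show ?thesis by simp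
    qed
    have comp: "y = 0" if y: "\<And>\<phi>. \<phi> \<in> C1_sigma \<Longrightarrow> inner y (cls \<phi>) = 0" for y :: "'n sfield"
    proof -
      have "AE x in torus. rep y x = 0"
      proof (rule C1_sigma_total[OF rep_L2_sigma])
        fix \<phi> :: "real^'n \<Rightarrow> real^'n" assume \<phi>: "\<phi> \<in> C1_sigma"
        then show "(LINT x|torus. rep y x \<bullet> \<phi> x) = 0"
          using y[OF \<phi>] inner_cls[OF rep_L2_sigma, of \<phi> y] C1_sigma_subset_L2_sigma by auto
      qed
      then show "y = 0" using cls_eq_iff[OF rep_L2_sigma zero_L2_sigma, of y] cls0 by simp
    qed
    \<comment> \<open>Setting one of the two test fields to zero separates the components.\<close>
    have "fst x = 0"
      by (rule comp) (use z[OF _ zero] in \<open>simp add: test_pair_def inner_prod_def cls0\<close>)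
    moreover have "snd x = 0"
      by (rule comp) (use z[OF zero] \<mu> in \<open>simp add: test_pair_def inner_prod_def cls0\<close>)
    ultimately show "x = 0" by (simp add: prod_eq_iff)
  qed
  define e where "e = gram_schmidt w"
  define V :: "('n sfield \<times> 'n sfield) set" where "V = {test_pair \<mu> \<phi> \<psi> |\<phi> \<psi>. \<phi> \<in> C1_sigma \<and> \<psi> \<in> C1_sigma}"
  \<comment> \<open>The second component of a test vector is the class of the magnetic test field
    divided by \<open>sqrt \<mu>\<close>, which has to be undone before its \<open>C1\<close>
    representative is read off.\<close>
  define B where "B \<Phi> = mhd \<mu> (crep (fst \<Phi>)) (crep (sqrt \<mu> *\<^sub>R snd \<Phi>))" for \<Phi> :: "'n sfield \<times> 'n sfield"
  define K where "K \<Phi> = regularity_weight \<mu> (crep (fst \<Phi>)) (crep (sqrt \<mu> *\<^sub>R snd \<Phi>))" for \<Phi> :: "'n sfield \<times> 'n sfield"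
  have B: "B (test_pair \<mu> \<phi> \<psi>) = mhd \<mu> \<phi> \<psi>" and K: "K (test_pair \<mu> \<phi> \<psi>) = regularity_weight \<mu> \<phi> \<psi>"
    if "\<phi> \<in> C1_sigma" "\<psi> \<in> C1_sigma" for \<phi> \<psi> :: "real^'n \<Rightarrow> real^'n"
    by (simp_all add: B_def K_def crep_test_pair[OF \<mu> that])
  have Vlin: "a *\<^sub>R \<Phi> + b *\<^sub>R \<Psi> \<in> V \<and> B (a *\<^sub>R \<Phi> + b *\<^sub>R \<Psi>) x y = a * B \<Phi> x y + b * B \<Psi> x y"
    if "\<Phi> \<in> V" "\<Psi> \<in> V" for a b \<Phi> \<Psi> x y
  proof -
    obtain \<phi> \<psi> \<phi>' \<psi>' where f: "\<phi> \<in> C1_sigma" "\<psi> \<in> C1_sigma" "\<phi>' \<in> C1_sigma" "\<psi>' \<in> C1_sigma"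
      and eq: "\<Phi> = test_pair \<mu> \<phi> \<psi>" "\<Psi> = test_pair \<mu> \<phi>' \<psi>'" using \<open>\<Phi> \<in> V\<close> \<open>\<Psi> \<in> V\<close> by (auto simp: V_def)
    show ?thesis
      unfolding eq test_pair_lincomb[OF f]
      using C1_sigma_lincomb[OF f(1,3), of a b] C1_sigma_lincomb[OF f(2,4), of a b]
      by (auto simp: V_def B f mhd_lincomb)
  qed
  have w_V: "w n \<in> V" for n using wC by (auto simp: V_def w_def)
  have subV: "subspace V"
  proof (rule subspaceI)
    show "0 \<in> V" using Vlin[OF w_V w_V, of 0 0 0 0] by simp
    show "x + y \<in> V" if "x \<in> V" "y \<in> V" for x y using Vlin[OF that, of 1 1] by simp
    show "a *\<^sub>R x \<in> V" if "x \<in> V" for a x using Vlin[OF that that, of a 0] by simp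
  qed
  have e_V: "e n \<in> V" for n
    using gram_schmidt_in_span[of w n] span_minimal[OF _ subV, of "w ` {..n}"] w_V by (auto simp: e_def)
  interpret G: galerkin e V B K
  proof (intro galerkin.intro orthobasis.intro galerkin_axioms.intro)
    show "orthonormal0 e" by (simp add: e_def gram_schmidt_orthonormal0)
    show "total_sequence e" by (simp add: e_def total_sequence_gram_schmidt[OF total_w])
    show "subspace V" by (rule subV)
    show "e j \<in> V" for j by (rule e_V)
    show "bounded_bilinear (B \<Phi>)" if "\<Phi> \<in> V" for \<Phi>
      using that by (auto simp: V_def B mhd_bilinear)
    show "B (\<Phi> + \<Psi>) x y = B \<Phi> x y + B \<Psi> x y" if "\<Phi> \<in> V" "\<Psi> \<in> V" for \<Phi> \<Psi> x y
      using Vlin[OF that, of 1 1] by simp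
    show "B (a *\<^sub>R \<Phi>) x y = a * B \<Phi> x y" if "\<Phi> \<in> V" for a \<Phi> x y
      using Vlin[OF that that, of a 0] by simp
    show "B x x x = 0" if "x \<in> V" for x
    proof -
      obtain \<phi> \<psi> where f: "\<phi> \<in> C1_sigma" "\<psi> \<in> C1_sigma" "x = test_pair \<mu> \<phi> \<psi>"
        using \<open>x \<in> V\<close> by (auto simp: V_def)
      show ?thesis
        unfolding f(3) B[OF f(1,2)] by (rule mhd_cancel[OF \<mu> f(1,2)]) (rule test_pair_def)
    qed
    show "0 \<le> K \<Phi>" if "\<Phi> \<in> V" for \<Phi>
      using that by (auto simp: V_def K regularity_weight_nonneg[OF \<mu>])
    show "0 \<le> B \<Phi> x x + K \<Phi> / 2 * (norm x)\<^sup>2" if "\<Phi> \<in> V" for \<Phi> x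
    proof -
      obtain \<phi> \<psi> where f: "\<phi> \<in> C1_sigma" "\<psi> \<in> C1_sigma" "\<Phi> = test_pair \<mu> \<phi> \<psi>"
        using \<open>\<Phi> \<in> V\<close> by (auto simp: V_def)
      show ?thesis unfolding f(3) B[OF f(1,2)] K[OF f(1,2)] by (rule mhd_convex[OF \<mu> f(1,2)])
    qed
  qed
  obtain u where u: "u 0 = u0" "\<And>t. t \<in> {0..T} \<Longrightarrow> norm (u t) \<le> norm u0"
    "\<And>y. continuous_on {0..T} (\<lambda>t. inner (u t) y)"
    and ineq: "\<And>N \<Phi> s t. \<Phi> \<in> G.trial N \<Longrightarrow> 0 \<le> s \<Longrightarrow> s \<le> t \<Longrightarrow> t \<le> T \<Longrightarrow>
       integral {s..t} (\<lambda>\<tau>. G.cost \<Phi> (u \<tau>)) - K \<Phi> / 2 * ?R * (t - s) \<le> inner (u t - u s) \<Phi>"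
    using G.weak_solution_exists[OF T, of u0] by blast
  have uR: "(norm (u t))\<^sup>2 \<le> ?R" if "t \<in> {0..T}" for t
    using u(2)[OF that] by (simp add: power_mono)
  have int: "(\<lambda>\<tau>. excess \<mu> ?R \<phi> \<psi> (u \<tau>)) integrable_on {s..t}"
    if \<phi>: "\<phi> \<in> C1_sigma" "\<psi> \<in> C1_sigma" and st: "0 \<le> s" "t \<le> T" for \<phi> \<psi> s t
  proof -
    obtain M where M: "\<And>x. (norm x)\<^sup>2 \<le> ?R \<Longrightarrow> \<bar>excess \<mu> ?R \<phi> \<psi> x\<bar> \<le> M" using excess_bound[OF \<phi>] by blast
    show ?thesis
    proof (rule G.weakly_continuous_integrable)
      show "continuous_on {s..t} (\<lambda>\<tau>. inner (u \<tau>) (e j))" for j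
        by (rule continuous_on_subset[OF u(3)]) (use st in auto)
      show "continuous_on ({s..t} \<times> UNIV) (\<lambda>(\<tau>, x). excess \<mu> ?R \<phi> \<psi> x)"
        unfolding case_prod_beta
        by (rule continuous_on_compose2[OF excess_continuous[OF \<phi>]]) (auto intro: continuous_intros)
      show "\<bar>excess \<mu> ?R \<phi> \<psi> (u \<tau>)\<bar> \<le> M" if "\<tau> \<in> {s..t}" for \<tau>
        by (intro M uR) (use that st in auto)
    qed
  qed
  have base: "integral {s..t} (\<lambda>\<tau>. excess \<mu> ?R (wf n) (wg n) (u \<tau>)) \<le> inner (u t - u s) (w n)"
    if st: "0 \<le> s" "s \<le> t" "t \<le> T" for s t n
  proof -
    \<comment> \<open>\<open>w n\<close> is a combination of the first \<open>n + 1\<close> basis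
      vectors, hence the index \<open>Suc n\<close>.\<close>
    have wt: "w n \<in> G.trial (Suc n)"
      using in_span_gram_schmidt[of w n] unfolding G.trial_def lessThan_Suc_atMost by (simp only: e_def)
    have eq: "excess \<mu> ?R (wf n) (wg n) x = G.cost (w n) x - K (w n) / 2 * ?R" for x
      unfolding excess_def G.cost_def w_def B[OF wC] K[OF wC] right_diff_distrib by simp
    have "integral {s..t} (\<lambda>\<tau>. G.cost (w n) (u \<tau>))
        = integral {s..t} (\<lambda>\<tau>. excess \<mu> ?R (wf n) (wg n) (u \<tau>) + K (w n) / 2 * ?R)"
      by (simp add: eq)
    also have "\<dots> = integral {s..t} (\<lambda>\<tau>. excess \<mu> ?R (wf n) (wg n) (u \<tau>)) + K (w n) / 2 * ?R * (t - s)"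
      using st by (subst Henstock_Kurzweil_Integration.integral_add[OF int[OF wC] integrable_const_ivl]) auto
    finally show ?thesis using ineq[OF wt st] by linarith
  qed
  have main: "integral {s..t} (\<lambda>\<tau>. excess \<mu> ?R \<phi> \<psi> (u \<tau>)) \<le> inner (u t - u s) (test_pair \<mu> \<phi> \<psi>)"
    if \<phi>: "\<phi> \<in> C1_sigma" "\<psi> \<in> C1_sigma" and st: "0 \<le> s" "s \<le> t" "t \<le> T" for \<phi> \<psi> s t
  proof (rule field_le_epsilon)
    fix \<epsilon> :: real assume \<epsilon>: "0 < \<epsilon>"
    \<comment> \<open>Everything that multiplies \<open>\<eta>\<close> below: the error of the
      integrand over \<open>[s,t]\<close>, the error of the test vector, and 1 for
      positivity.\<close>
    define D where "D = ?c * ?R * (t - s) + norm (u t - u s) * ?c + 1"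
    define \<eta> where "\<eta> = \<epsilon> / D"
    have D: "0 < D" unfolding D_def using c st \<mu> by (intro add_nonneg_pos add_nonneg_nonneg mult_nonneg_nonneg) auto
    have \<eta>: "0 < \<eta>" using \<epsilon> D by (simp add: \<eta>_def)
    obtain n where n: "\<forall>x\<in>cbox 0 1. norm (grad \<phi> x - grad (wf n) x) \<le> \<eta> \<and> norm (grad \<psi> x - grad (wg n) x) \<le> \<eta>"
      and nw: "norm (test_pair \<mu> \<phi> \<psi> - w n) \<le> \<eta> * ?c" using approx[OF \<phi> \<eta>] by blast
    have "integral {s..t} (\<lambda>\<tau>. excess \<mu> ?R \<phi> \<psi> (u \<tau>))
        \<le> integral {s..t} (\<lambda>\<tau>. excess \<mu> ?R (wf n) (wg n) (u \<tau>) + \<eta> * ?c * ?R)"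
    proof (rule integral_le)
      show "(\<lambda>\<tau>. excess \<mu> ?R \<phi> \<psi> (u \<tau>)) integrable_on {s..t}" by (rule int[OF \<phi>]) (use st in auto)
      show "(\<lambda>\<tau>. excess \<mu> ?R (wf n) (wg n) (u \<tau>) + \<eta> * ?c * ?R) integrable_on {s..t}"
        by (intro integrable_add int[OF wC] integrable_const_ivl) (use st in auto)
      fix \<tau> assume "\<tau> \<in> {s..t}"
      then have "(norm (u \<tau>))\<^sup>2 \<le> ?R" using uR[of \<tau>] st by auto
      then have "(norm (u \<tau>))\<^sup>2 + \<bar>(norm (u \<tau>))\<^sup>2 - ?R\<bar> = ?R" by simp
      then show "excess \<mu> ?R \<phi> \<psi> (u \<tau>) \<le> excess \<mu> ?R (wf n) (wg n) (u \<tau>) + \<eta> * ?c * ?R"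
        using excess_diff_le[OF \<mu> \<phi> wC(1)[of n] wC(2)[of n], where \<epsilon> = \<eta> and R = ?R and u = "u \<tau>"] n by (simp add: abs_le_iff)
    qed
    also have "\<dots> = integral {s..t} (\<lambda>\<tau>. excess \<mu> ?R (wf n) (wg n) (u \<tau>)) + \<eta> * ?c * ?R * (t - s)"
      using st by (subst Henstock_Kurzweil_Integration.integral_add[OF int[OF wC] integrable_const_ivl]) auto
    also have "\<dots> \<le> inner (u t - u s) (w n) + \<eta> * ?c * ?R * (t - s)" using base[OF st, of n] by simp
    also have "inner (u t - u s) (w n) \<le> inner (u t - u s) (test_pair \<mu> \<phi> \<psi>) + norm (u t - u s) * (\<eta> * ?c)"
    proof -
      have "\<bar>inner (u t - u s) (test_pair \<mu> \<phi> \<psi> - w n)\<bar> \<le> norm (u t - u s) * (\<eta> * ?c)"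
        by (intro order_trans[OF Cauchy_Schwarz_ineq2] mult_left_mono nw norm_ge_zero)
      then show ?thesis by (simp add: inner_diff_right abs_le_iff)
    qed
    also have "inner (u t - u s) (test_pair \<mu> \<phi> \<psi>) + norm (u t - u s) * (\<eta> * ?c) + \<eta> * ?c * ?R * (t - s)
        \<le> inner (u t - u s) (test_pair \<mu> \<phi> \<psi>) + \<eta> * D"
    proof -
      have "I + N * (\<eta> * C) + \<eta> * C * R * d \<le> I + \<eta> * (C * R * d + N * C + 1)" for I C R d N :: real
        using \<eta> by (simp add: algebra_simps)
      then show ?thesis unfolding D_def .
    qed
    also have "\<eta> * D = \<epsilon>" using D by (simp add: \<eta>_def)
    finally show "integral {s..t} (\<lambda>\<tau>. excess \<mu> ?R \<phi> \<psi> (u \<tau>)) \<le> inner (u t - u s) (test_pair \<mu> \<phi> \<psi>) + \<epsilon>" by simp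
  qed
  show ?thesis by (rule that[OF G.orthobasis_axioms u main])
qed


section \<open>Test fields depending on time\<close>

text \<open>Telescoping over a partition finer than \<open>\<delta>\<close>: errors proportional to
  the length add up to the length of the whole interval. This replaces a derivative of
  \<open>G\<close>, which need not exist.\<close>

lemma integral_le_increment_local:
  fixes G h :: "real \<Rightarrow> real"
  assumes st: "s \<le> t" and h: "h integrable_on {s..t}"
    and loc: "\<And>\<epsilon>. 0 < \<epsilon> \<Longrightarrow> \<exists>\<delta>>0. \<forall>a b. s \<le> a \<longrightarrow> a \<le> b \<longrightarrow> b \<le> t \<longrightarrow> b - a < \<delta> \<longrightarrow>
      integral {a..b} h \<le> G b - G a + \<epsilon> * (b - a)"
  shows "integral {s..t} h \<le> G t - G s"
proof (rule field_le_epsilon)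
  fix \<epsilon> :: real assume \<epsilon>: "0 < \<epsilon>"
  \<comment> \<open>The added 1 covers the case \<open>s = t\<close>.\<close>
  define \<eta> where "\<eta> = \<epsilon> / (t - s + 1)"
  have "0 < \<eta>" using \<epsilon> st by (simp add: \<eta>_def)
  then obtain \<delta> where \<delta>: "0 < \<delta>" "\<And>a b. s \<le> a \<Longrightarrow> a \<le> b \<Longrightarrow> b \<le> t \<Longrightarrow> b - a < \<delta> \<Longrightarrow>
      integral {a..b} h \<le> G b - G a + \<eta> * (b - a)" using loc by blast
  obtain n :: nat where n: "(t - s) / \<delta> < real n" using reals_Archimedean2 by blast
  then have n0: "0 < real n" using st \<delta>(1) by (meson divide_nonneg_pos diff_ge_0_iff_ge order_le_less_trans)
  define p where "p k = s + real k * ((t - s) / real n)" for k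
  have p: "p 0 = s" "p n = t" "p (Suc k) - p k = (t - s) / real n" for k
    using n0 by (simp_all add: p_def distrib_right add_divide_distrib)
  have step: "(t - s) / real n < \<delta>" using n n0 \<delta>(1) by (simp add: field_simps)
  have step0: "0 \<le> (t - s) / real n" using st n0 by simp
  have pt: "p k \<le> t" "s \<le> p k" if "k \<le> n" for k
  proof -
    have "real k * ((t - s) / real n) \<le> real n * ((t - s) / real n)"
      using that step0 by (intro mult_right_mono) auto
    then show "p k \<le> t" using p(2) by (simp add: p_def)
    show "s \<le> p k" using st by (simp add: p_def)
  qed
  have "k \<le> n \<Longrightarrow> integral {s..p k} h \<le> G (p k) - G s + \<eta> * (p k - s)" for k
  proof (induction k)
    case (Suc k)
    have mono: "p k \<le> p (Suc k)" "p (Suc k) - p k < \<delta>" using p(3)[of k] step0 step by linarith+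
    have "integral {s..p (Suc k)} h = integral {s..p k} h + integral {p k..p (Suc k)} h"
      using Suc.prems pt[of k] pt[of "Suc k"] mono
      by (intro Henstock_Kurzweil_Integration.integral_combine[symmetric] integrable_on_subinterval[OF h]) auto
    also have "integral {p k..p (Suc k)} h \<le> G (p (Suc k)) - G (p k) + \<eta> * (p (Suc k) - p k)"
      using Suc.prems pt[of k] pt[of "Suc k"] mono by (intro \<delta>(2)) auto
    finally show ?case using Suc by (simp add: algebra_simps)
  qed (simp add: p(1))
  from this[of n] have "integral {s..t} h \<le> G t - G s + \<eta> * (t - s)" using p(2) by simp
  also have "\<eta> * (t - s) \<le> \<eta> * (t - s + 1)" using \<open>0 < \<eta>\<close> by simp
  also have "\<dots> = \<epsilon>" using st by (simp add: \<eta>_def)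
  finally show "integral {s..t} h \<le> G t - G s + \<epsilon>" by simp
qed

text \<open>Time derivatives of test fields enter only as continuous fields, so their pairing with
  the state is an integral rather than an inner product with a class.\<close>

definition pairing :: "real \<Rightarrow> (real^'n \<Rightarrow> real^'n) \<Rightarrow> (real^'n \<Rightarrow> real^'n) \<Rightarrow> 'n sfield \<times> 'n sfield \<Rightarrow> real" where
  "pairing \<mu> h k u = (LINT x|torus. rep (fst u) x \<bullet> h x) + 1 / sqrt \<mu> * (LINT x|torus. rep (snd u) x \<bullet> k x)"

lemma sfield_dual:
  fixes h :: "real^'n \<Rightarrow> real^'n"
  assumes h: "continuous_on (cbox 0 1) h"
  shows "bounded_linear (\<lambda>y. LINT x|torus. rep y x \<bullet> h x)"
    and "(\<And>x. x \<in> cbox 0 1 \<Longrightarrow> norm (h x) \<le> \<epsilon>) \<Longrightarrow> \<bar>LINT x|torus. rep y x \<bullet> h x\<bar> \<le> \<epsilon> * norm y"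
proof -
  have sqh: "square_integrable h" by (rule square_integrable_continuous[OF h])
  have int: "integrable torus (\<lambda>x. rep y x \<bullet> h x)" for y by (rule square_integrable_inner[OF rep_sq sqh])
  have bound: "\<bar>LINT x|torus. rep y x \<bullet> h x\<bar> \<le> \<epsilon> * norm y"
    if le: "\<And>x. x \<in> cbox 0 1 \<Longrightarrow> norm (h x) \<le> \<epsilon>" for \<epsilon> y
  proof -
    have "norm (h 0) \<le> \<epsilon>" by (rule le) (simp add: mem_box_cart)
    then have \<epsilon>: "0 \<le> \<epsilon>" using norm_ge_zero[of "h 0"] by linarith
    have "\<bar>LINT x|torus. rep y x \<bullet> h x\<bar> \<le> (LINT x|torus. \<bar>rep y x \<bullet> h x\<bar>)" by (rule integral_abs_bound)
    also have "\<dots> \<le> (LINT x|torus. \<epsilon> * norm (rep y x))"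
    proof (rule integral_mono)
      show "\<bar>rep y x \<bullet> h x\<bar> \<le> \<epsilon> * norm (rep y x)" if "x \<in> space torus" for x
      proof -
        have "\<bar>rep y x \<bullet> h x\<bar> \<le> norm (rep y x) * norm (h x)" by (rule Cauchy_Schwarz_ineq2)
        also have "\<dots> \<le> norm (rep y x) * \<epsilon>" using that by (intro mult_left_mono le) auto
        finally show ?thesis by (simp add: mult.commute)
      qed
    qed (use int square_integrable_integral_norm(1)[OF rep_sq] in auto)
    also have "\<dots> \<le> \<epsilon> * norm y"
      using mult_left_mono[OF square_integrable_integral_norm(2)[OF rep_sq, of y] \<epsilon>] by (simp add: norm_rep L2_norm_def)
    finally show ?thesis .
  qed
  then show "(\<And>x. x \<in> cbox 0 1 \<Longrightarrow> norm (h x) \<le> \<epsilon>) \<Longrightarrow> \<bar>LINT x|torus. rep y x \<bullet> h x\<bar> \<le> \<epsilon> * norm y" by blast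
  have lin: "(LINT x|torus. rep (a *\<^sub>R y + b *\<^sub>R z) x \<bullet> h x)
      = a * (LINT x|torus. rep y x \<bullet> h x) + b * (LINT x|torus. rep z x \<bullet> h x)" for a b y z
  proof -
    have "(LINT x|torus. rep (a *\<^sub>R y + b *\<^sub>R z) x \<bullet> h x) = (LINT x|torus. (a *\<^sub>R rep y x + b *\<^sub>R rep z x) \<bullet> h x)"
    proof (rule integral_cong_AE)
      show "AE x in torus. rep (a *\<^sub>R y + b *\<^sub>R z) x \<bullet> h x = (a *\<^sub>R rep y x + b *\<^sub>R rep z x) \<bullet> h x"
        using rep_lincomb[of a y b z] by eventually_elim simp
      show "(\<lambda>x. (a *\<^sub>R rep y x + b *\<^sub>R rep z x) \<bullet> h x) \<in> borel_measurable torus"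
        by (intro borel_measurable_integrable square_integrable_inner square_integrable_add square_integrable_scaleR rep_sq sqh)
    qed (use int in blast)
    then show ?thesis using int by (simp add: inner_add_left)
  qed
  have "compact (h ` cbox 0 1)" by (intro compact_continuous_image h compact_cbox)
  then obtain D where D: "\<And>x. x \<in> cbox 0 1 \<Longrightarrow> norm (h x) \<le> D" by (meson bounded_iff compact_imp_bounded imageI)
  show "bounded_linear (\<lambda>y. LINT x|torus. rep y x \<bullet> h x)"
  proof (rule bounded_linear_intro[where K = D])
    show "(LINT x|torus. rep (y + z) x \<bullet> h x) = (LINT x|torus. rep y x \<bullet> h x) + (LINT x|torus. rep z x \<bullet> h x)" for y z
      using lin[of 1 y 1 z] by simp
    show "(LINT x|torus. rep (r *\<^sub>R y) x \<bullet> h x) = r *\<^sub>R (LINT x|torus. rep y x \<bullet> h x)" for r y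
      using lin[of r y 0 y] by simp
    show "norm (LINT x|torus. rep y x \<bullet> h x) \<le> norm y * D" for y
      using bound[OF D, of y] by (simp add: mult.commute)
  qed
qed

lemma pairing_bounded_linear:
  assumes "continuous_on (cbox 0 1) h" "continuous_on (cbox 0 1) k"
  shows "bounded_linear (pairing \<mu> h k)"
  unfolding pairing_def
  by (intro bounded_linear_add bounded_linear_const_mult
      bounded_linear_compose[OF sfield_dual(1)[OF assms(1)] bounded_linear_fst]
      bounded_linear_compose[OF sfield_dual(1)[OF assms(2)] bounded_linear_snd])

lemma pairing_bound:
  assumes \<mu>: "0 < \<mu>" and h: "continuous_on (cbox 0 1) h" and k: "continuous_on (cbox 0 1) k"
    and le: "\<And>x. x \<in> cbox 0 1 \<Longrightarrow> norm (h x) \<le> \<epsilon>" "\<And>x. x \<in> cbox 0 1 \<Longrightarrow> norm (k x) \<le> \<epsilon>"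
  shows "\<bar>pairing \<mu> h k u\<bar> \<le> \<epsilon> * (1 + 1 / sqrt \<mu>) * norm u"
proof -
  let ?a = "LINT x|torus. rep (fst u) x \<bullet> h x" and ?b = "LINT x|torus. rep (snd u) x \<bullet> k x"
  have "norm (h 0) \<le> \<epsilon>" by (rule le) (simp add: mem_box_cart)
  then have \<epsilon>: "0 \<le> \<epsilon>" using norm_ge_zero[of "h 0"] by linarith
  have a: "\<bar>?a\<bar> \<le> \<epsilon> * norm u"
    using norm_fst_le[of "fst u" "snd u"]
    by (intro order_trans[OF sfield_dual(2)[OF h le(1)] mult_left_mono[OF _ \<epsilon>]]) auto
  have b: "\<bar>?b\<bar> \<le> \<epsilon> * norm u"
    using norm_snd_le[of "snd u" "fst u"]
    by (intro order_trans[OF sfield_dual(2)[OF k le(2)] mult_left_mono[OF _ \<epsilon>]]) auto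
  have "\<bar>1 / sqrt \<mu> * ?b\<bar> \<le> 1 / sqrt \<mu> * (\<epsilon> * norm u)"
    using mult_left_mono[OF b, of "1 / sqrt \<mu>"] \<mu> by (simp add: abs_mult)
  moreover have "\<epsilon> * (1 + 1 / sqrt \<mu>) * norm u = \<epsilon> * norm u + 1 / sqrt \<mu> * (\<epsilon> * norm u)"
    by (simp add: algebra_simps)
  ultimately show ?thesis unfolding pairing_def using a by linarith
qed

lemma pairing_lincomb:
  assumes "continuous_on (cbox 0 1) h" "continuous_on (cbox 0 1) h'" "continuous_on (cbox 0 1) k" "continuous_on (cbox 0 1) k'"
  shows "pairing \<mu> (\<lambda>x. a *\<^sub>R h x + b *\<^sub>R h' x) (\<lambda>x. a *\<^sub>R k x + b *\<^sub>R k' x) u = a * pairing \<mu> h k u + b * pairing \<mu> h' k' u"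
  using assms[THEN square_integrable_continuous, THEN square_integrable_inner[OF rep_sq, of _ "fst u"]]
    assms[THEN square_integrable_continuous, THEN square_integrable_inner[OF rep_sq, of _ "snd u"]]
  by (simp add: pairing_def inner_add_right algebra_simps add_divide_distrib)

lemma inner_test_pair:
  fixes \<phi> \<psi> :: "real^'n \<Rightarrow> real^'n"
  assumes "\<phi> \<in> C1_sigma" "\<psi> \<in> C1_sigma"
  shows "inner u (test_pair \<mu> \<phi> \<psi>) = pairing \<mu> \<phi> \<psi> u"
proof -
  have "inner y (cls f) = (LINT x|torus. rep y x \<bullet> f x)" if "f \<in> C1_sigma" for y and f :: "real^'n \<Rightarrow> real^'n"
    using inner_cls[OF rep_L2_sigma, of f y] that C1_sigma_subset_L2_sigma by auto
  then show ?thesis using assms by (simp add: test_pair_def pairing_def inner_prod_def)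
qed

section \<open>Uniform continuity of test fields in time\<close>

lemma continuous_on_slice:
  assumes "continuous_on (A \<times> UNIV) (\<lambda>(t, x). h t x)" "t \<in> A"
  shows "continuous_on S (h t)"
proof -
  have "continuous_on UNIV (\<lambda>x. case (t, x) of (t, x) \<Rightarrow> h t x)"
    by (rule continuous_on_compose2[OF assms(1)]) (use assms(2) in \<open>auto intro!: continuous_on_Pair\<close>)
  then show ?thesis by (auto intro: continuous_on_subset)
qed

lemma uniformly_continuous_slices:
  fixes h :: "real \<Rightarrow> real^'n \<Rightarrow> 'b::metric_space"
  assumes "continuous_on ({0..T} \<times> UNIV) (\<lambda>(t, x). h t x)" "0 < \<epsilon>"
  shows "\<exists>\<delta>>0. \<forall>s\<in>{0..T}. \<forall>t\<in>{0..T}. \<bar>s - t\<bar> < \<delta> \<longrightarrow> (\<forall>x\<in>cbox 0 1. dist (h s x) (h t x) < \<epsilon>)"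
proof -
  have "compact ({0..T} \<times> cbox (0 :: real^'n) 1)" by (intro compact_Times) auto
  moreover have "continuous_on ({0..T} \<times> cbox 0 1) (\<lambda>(t, x). h t x)"
    using assms(1) by (rule continuous_on_subset) auto
  ultimately have "uniformly_continuous_on ({0..T} \<times> cbox 0 1) (\<lambda>(t, x). h t x)"
    by (intro compact_uniformly_continuous)
  then obtain \<delta> where \<delta>: "\<delta> > 0" "\<And>p q. p \<in> {0..T} \<times> cbox 0 1 \<Longrightarrow> q \<in> {0..T} \<times> cbox 0 1 \<Longrightarrow> dist q p < \<delta> \<Longrightarrow>
      dist (case q of (t, x) \<Rightarrow> h t x) (case p of (t, x) \<Rightarrow> h t x) < \<epsilon>"
    unfolding uniformly_continuous_on_def using assms(2) by blast
  have "dist (h s x) (h t x) < \<epsilon>" if "s \<in> {0..T}" "t \<in> {0..T}" "\<bar>s - t\<bar> < \<delta>" "x \<in> cbox 0 1" for s t x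
    using \<delta>(2)[of "(t, x)" "(s, x)"] that by (auto simp: dist_Pair_Pair dist_real_def)
  then show ?thesis using \<delta>(1) by blast
qed

lemma test_fields_C1_sigma: "\<phi> \<in> test_fields T \<Longrightarrow> t \<in> {0..T} \<Longrightarrow> \<phi> t \<in> C1_sigma"
  unfolding test_fields_def C1_sigma_def
  by (auto intro: continuous_on_slice[of "{0..T}" "\<lambda>t. grad (\<phi> t)"])

text \<open>Mean value inequality for the linearisation at the right end point \<open>b\<close>, the
  time at which the state will be evaluated too.\<close>

lemma test_fields_increment:
  assumes \<phi>: "\<phi> \<in> test_fields T" and ab: "0 \<le> a" "a \<le> b" "b \<le> T"
    and le: "\<And>\<tau>. \<tau> \<in> {a..b} \<Longrightarrow> norm (time_deriv T \<phi> \<tau> x - time_deriv T \<phi> b x) \<le> \<epsilon>"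
  shows "norm (\<phi> b x - \<phi> a x - (b - a) *\<^sub>R time_deriv T \<phi> b x) \<le> (b - a) * \<epsilon>"
proof -
  have "norm (\<phi> b x - \<phi> a x - (b - a) *\<^sub>R time_deriv T \<phi> b x) \<le> norm (b - a) * \<epsilon>"
  proof (rule vector_differentiable_bound_linearization[where S = "{a..b}" and f' = "\<lambda>\<tau>. time_deriv T \<phi> \<tau> x"])
    fix \<tau> assume \<tau>: "\<tau> \<in> {a..b}"
    have "((\<lambda>\<tau>. \<phi> \<tau> x) has_vector_derivative time_deriv T \<phi> \<tau> x) (at \<tau> within {0..T})"
      using \<phi> \<tau> ab unfolding time_deriv_def test_fields_def by (subst vector_derivative_works[symmetric]) auto
    then show "((\<lambda>\<tau>. \<phi> \<tau> x) has_vector_derivative time_deriv T \<phi> \<tau> x) (at \<tau> within {a..b})"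
      by (rule has_vector_derivative_within_subset) (use ab in auto)
    show "norm (time_deriv T \<phi> \<tau> x - time_deriv T \<phi> b x) \<le> \<epsilon>" by (rule le[OF \<tau>])
  qed (use ab in \<open>auto simp: closed_segment_eq_real_ivl\<close>)
  then show ?thesis using ab by simp
qed


text \<open>Joint continuity from continuous slices and a modulus in time that is uniform up to
  quadratic growth in the state; quadratic growth is that of the excess.\<close>

lemma continuous_on_Times_slices:
  fixes F :: "real \<Rightarrow> 'h::real_normed_vector \<Rightarrow> real"
  assumes slices: "\<And>t. t \<in> A \<Longrightarrow> continuous_on UNIV (F t)"
    and unif: "\<And>\<epsilon>. 0 < \<epsilon> \<Longrightarrow> \<exists>\<delta>>0. \<forall>s\<in>A. \<forall>t\<in>A. \<bar>s - t\<bar> < \<delta> \<longrightarrow> (\<forall>x. \<bar>F s x - F t x\<bar> \<le> \<epsilon> * (1 + norm x)\<^sup>2)"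
  shows "continuous_on (A \<times> UNIV) (\<lambda>(t, x). F t x)"
  unfolding continuous_on_iff
proof (intro ballI allI impI)
  fix p :: "real \<times> 'h" and \<epsilon> :: real assume p: "p \<in> A \<times> UNIV" and \<epsilon>: "0 < \<epsilon>"
  obtain t0 x0 where p0: "p = (t0, x0)" "t0 \<in> A" using p by auto
  \<comment> \<open>Bounds the growth factor \<open>(1 + norm x)\<^sup>2\<close> for all
    \<open>x\<close> at distance less than 1 from \<open>x0\<close>.\<close>
  define b where "b = (2 + norm x0)\<^sup>2"
  have "0 < 2 + norm x0" using norm_ge_zero[of x0] by linarith
  then have b: "0 < b" unfolding b_def by (rule zero_less_power)
  then have "0 < \<epsilon> / (2 * b)" using \<epsilon> by simp
  from unif[OF this] obtain \<delta>1 where \<delta>1: "0 < \<delta>1"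
    "\<And>s t x. s \<in> A \<Longrightarrow> t \<in> A \<Longrightarrow> \<bar>s - t\<bar> < \<delta>1 \<Longrightarrow> \<bar>F s x - F t x\<bar> \<le> \<epsilon> / (2 * b) * (1 + norm x)\<^sup>2" by blast
  obtain \<delta>2 where \<delta>2: "0 < \<delta>2" "\<And>x. dist x x0 < \<delta>2 \<Longrightarrow> dist (F t0 x) (F t0 x0) < \<epsilon> / 2"
    using slices[OF p0(2), unfolded continuous_on_iff, rule_format, of x0 "\<epsilon> / 2"] \<epsilon> by auto
  have "dist (case q of (t, x) \<Rightarrow> F t x) (case p of (t, x) \<Rightarrow> F t x) < \<epsilon>"
    if q: "q \<in> A \<times> UNIV" and d: "dist q p < min \<delta>1 (min \<delta>2 1)" for q
  proof -
    obtain t x where q0: "q = (t, x)" "t \<in> A" using q by auto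
    have dt: "\<bar>t - t0\<bar> < \<delta>1" using d dist_fst_le[of q p] by (simp add: q0 p0 dist_real_def)
    have dx: "dist x x0 < \<delta>2" "dist x x0 < 1" using d dist_snd_le[of q p] by (auto simp: q0 p0)
    have "norm x \<le> norm x0 + 1" using dx(2) norm_triangle_ineq2[of x x0] by (simp add: dist_norm)
    then have "(1 + norm x)\<^sup>2 \<le> b" unfolding b_def by (intro power_mono) auto
    then have "\<epsilon> / (2 * b) * (1 + norm x)\<^sup>2 \<le> \<epsilon> / (2 * b) * b" using \<epsilon> b by (intro mult_left_mono) auto
    then have "\<bar>F t x - F t0 x\<bar> \<le> \<epsilon> / 2" using \<delta>1(2)[OF q0(2) p0(2) dt, of x] b by simp
    then show ?thesis using \<delta>2(2)[OF dx(1)] unfolding q0 p0 prod.case dist_real_def by linarith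
  qed
  then show "\<exists>\<delta>>0. \<forall>q\<in>A \<times> UNIV. dist q p < \<delta> \<longrightarrow>
      dist (case q of (t, x) \<Rightarrow> F t x) (case p of (t, x) \<Rightarrow> F t x) < \<epsilon>"
    using \<delta>1(1) \<delta>2(1) by (intro exI[of _ "min \<delta>1 (min \<delta>2 1)"]) auto
qed

lemma bounded_slices:
  fixes h :: "real \<Rightarrow> real^'n \<Rightarrow> 'b::real_normed_vector"
  assumes "continuous_on ({0..T} \<times> UNIV) (\<lambda>(t, x). h t x)"
  shows "\<exists>C. \<forall>t\<in>{0..T}. \<forall>x\<in>cbox 0 1. norm (h t x) \<le> C"
proof -
  have "compact ({0..T} \<times> cbox (0 :: real^'n) 1)" by (intro compact_Times) auto
  moreover have "continuous_on ({0..T} \<times> cbox 0 1) (\<lambda>(t, x). h t x)"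
    using assms by (rule continuous_on_subset) auto
  ultimately have "bounded ((\<lambda>(t, x). h t x) ` ({0..T} \<times> cbox 0 1))"
    by (intro compact_imp_bounded compact_continuous_image)
  then show ?thesis unfolding bounded_iff by fastforce
qed

lemma test_fields_continuous:
  assumes "\<phi> \<in> test_fields T"
  shows "continuous_on ({0..T} \<times> UNIV) (\<lambda>(t, x). grad (\<phi> t) x)"
    and "continuous_on ({0..T} \<times> UNIV) (\<lambda>(t, x). time_deriv T \<phi> t x)"
  using assms by (auto simp: test_fields_def)

lemma test_fields_uniform:
  fixes \<phi> \<psi> :: "real \<Rightarrow> real^'n \<Rightarrow> real^'n"
  assumes \<phi>: "\<phi> \<in> test_fields T" and \<psi>: "\<psi> \<in> test_fields T" and \<epsilon>: "0 < \<epsilon>"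
  obtains \<delta> where "0 < \<delta>" "\<And>s t x. s \<in> {0..T} \<Longrightarrow> t \<in> {0..T} \<Longrightarrow> \<bar>s - t\<bar> < \<delta> \<Longrightarrow> x \<in> cbox 0 1 \<Longrightarrow>
      norm (grad (\<phi> s) x - grad (\<phi> t) x) \<le> \<epsilon> \<and> norm (grad (\<psi> s) x - grad (\<psi> t) x) \<le> \<epsilon> \<and>
      norm (time_deriv T \<phi> s x - time_deriv T \<phi> t x) \<le> \<epsilon> \<and> norm (time_deriv T \<psi> s x - time_deriv T \<psi> t x) \<le> \<epsilon>"
proof -
  have "\<exists>\<delta>>0. \<forall>s\<in>{0..T}. \<forall>t\<in>{0..T}. \<bar>s - t\<bar> < \<delta> \<longrightarrow> (\<forall>x\<in>cbox 0 1. norm (grad (\<phi> s) x - grad (\<phi> t) x) < \<epsilon>)"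
    using uniformly_continuous_slices[OF test_fields_continuous(1)[OF \<phi>] \<epsilon>] unfolding dist_norm .
  then obtain \<delta>1 where d1: "0 < \<delta>1" "\<forall>s\<in>{0..T}. \<forall>t\<in>{0..T}. \<bar>s - t\<bar> < \<delta>1 \<longrightarrow> (\<forall>x\<in>cbox 0 1. norm (grad (\<phi> s) x - grad (\<phi> t) x) < \<epsilon>)"
    by blast
  have "\<exists>\<delta>>0. \<forall>s\<in>{0..T}. \<forall>t\<in>{0..T}. \<bar>s - t\<bar> < \<delta> \<longrightarrow> (\<forall>x\<in>cbox 0 1. norm (grad (\<psi> s) x - grad (\<psi> t) x) < \<epsilon>)"
    using uniformly_continuous_slices[OF test_fields_continuous(1)[OF \<psi>] \<epsilon>] unfolding dist_norm .
  then obtain \<delta>2 where d2: "0 < \<delta>2" "\<forall>s\<in>{0..T}. \<forall>t\<in>{0..T}. \<bar>s - t\<bar> < \<delta>2 \<longrightarrow> (\<forall>x\<in>cbox 0 1. norm (grad (\<psi> s) x - grad (\<psi> t) x) < \<epsilon>)"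
    by blast
  have "\<exists>\<delta>>0. \<forall>s\<in>{0..T}. \<forall>t\<in>{0..T}. \<bar>s - t\<bar> < \<delta> \<longrightarrow> (\<forall>x\<in>cbox 0 1. norm (time_deriv T \<phi> s x - time_deriv T \<phi> t x) < \<epsilon>)"
    using uniformly_continuous_slices[OF test_fields_continuous(2)[OF \<phi>] \<epsilon>] unfolding dist_norm .
  then obtain \<delta>3 where d3: "0 < \<delta>3" "\<forall>s\<in>{0..T}. \<forall>t\<in>{0..T}. \<bar>s - t\<bar> < \<delta>3 \<longrightarrow> (\<forall>x\<in>cbox 0 1. norm (time_deriv T \<phi> s x - time_deriv T \<phi> t x) < \<epsilon>)"
    by blast
  have "\<exists>\<delta>>0. \<forall>s\<in>{0..T}. \<forall>t\<in>{0..T}. \<bar>s - t\<bar> < \<delta> \<longrightarrow> (\<forall>x\<in>cbox 0 1. norm (time_deriv T \<psi> s x - time_deriv T \<psi> t x) < \<epsilon>)"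
    using uniformly_continuous_slices[OF test_fields_continuous(2)[OF \<psi>] \<epsilon>] unfolding dist_norm .
  then obtain \<delta>4 where d4: "0 < \<delta>4" "\<forall>s\<in>{0..T}. \<forall>t\<in>{0..T}. \<bar>s - t\<bar> < \<delta>4 \<longrightarrow> (\<forall>x\<in>cbox 0 1. norm (time_deriv T \<psi> s x - time_deriv T \<psi> t x) < \<epsilon>)"
    by blast
  show ?thesis
  proof (rule that[of "min (min \<delta>1 \<delta>2) (min \<delta>3 \<delta>4)"])
    show "0 < min (min \<delta>1 \<delta>2) (min \<delta>3 \<delta>4)" using d1(1) d2(1) d3(1) d4(1) by simp
    fix s t x assume s: "s \<in> {0..T}" and t: "t \<in> {0..T}"
      and d: "\<bar>s - t\<bar> < min (min \<delta>1 \<delta>2) (min \<delta>3 \<delta>4)" and x: "x \<in> cbox (0 :: real^'n) 1"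
    have d': "\<bar>s - t\<bar> < \<delta>1" "\<bar>s - t\<bar> < \<delta>2" "\<bar>s - t\<bar> < \<delta>3" "\<bar>s - t\<bar> < \<delta>4" using d by simp_all
    show "norm (grad (\<phi> s) x - grad (\<phi> t) x) \<le> \<epsilon> \<and> norm (grad (\<psi> s) x - grad (\<psi> t) x) \<le> \<epsilon> \<and>
      norm (time_deriv T \<phi> s x - time_deriv T \<phi> t x) \<le> \<epsilon> \<and> norm (time_deriv T \<psi> s x - time_deriv T \<psi> t x) \<le> \<epsilon>"
      by (intro conjI less_imp_le d1(2)[rule_format, OF s t d'(1) x] d2(2)[rule_format, OF s t d'(2) x]
          d3(2)[rule_format, OF s t d'(3) x] d4(2)[rule_format, OF s t d'(4) x])
  qed
qed

text \<open>The full integrand for \<open>E = R / 2\<close> as a function of time and of the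
  rescaled state. Its joint continuity can be treated separately from the merely weak continuity of
  the path.\<close>

definition time_excess where
  "time_excess \<mu> T R \<phi> \<psi> \<tau> x = excess \<mu> R (\<phi> \<tau>) (\<psi> \<tau>) x + pairing \<mu> (time_deriv T \<phi> \<tau>) (time_deriv T \<psi> \<tau>) x"

lemma pairing_diff_le:
  assumes \<mu>: "0 < \<mu>" and c: "continuous_on (cbox 0 1) h" "continuous_on (cbox 0 1) h'" "continuous_on (cbox 0 1) k" "continuous_on (cbox 0 1) k'"
    and "\<And>x. x \<in> cbox 0 1 \<Longrightarrow> norm (h x - h' x) \<le> \<epsilon>" "\<And>x. x \<in> cbox 0 1 \<Longrightarrow> norm (k x - k' x) \<le> \<epsilon>"
  shows "\<bar>pairing \<mu> h k u - pairing \<mu> h' k' u\<bar> \<le> \<epsilon> * (1 + 1 / sqrt \<mu>) * norm u"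
proof -
  have "pairing \<mu> (\<lambda>x. 1 *\<^sub>R h x + (-1) *\<^sub>R h' x) (\<lambda>x. 1 *\<^sub>R k x + (-1) *\<^sub>R k' x) u = pairing \<mu> h k u - pairing \<mu> h' k' u"
    unfolding pairing_lincomb[OF c] by simp
  moreover have "\<bar>pairing \<mu> (\<lambda>x. 1 *\<^sub>R h x + (-1) *\<^sub>R h' x) (\<lambda>x. 1 *\<^sub>R k x + (-1) *\<^sub>R k' x) u\<bar> \<le> \<epsilon> * (1 + 1 / sqrt \<mu>) * norm u"
    by (rule pairing_bound[OF \<mu>]) (use assms in \<open>auto intro!: continuous_intros\<close>)
  ultimately show ?thesis by simp
qed

text \<open>Split an increment of the product as \<open>inner (u b - u a) (\<Phi> a) + inner (u b)
  (\<Phi> b - \<Phi> a)\<close>, where \<open>\<Phi>\<close> is the test pair. The first part is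
  handled by the inequality with test fields frozen at \<open>a\<close>, the second is the time
  derivative up to a small error; short intervals are then summed.\<close>

lemma time_excess_inequality:
  fixes u :: "real \<Rightarrow> ('n::finite) sfield \<times> 'n sfield" and u0 :: "'n sfield \<times> 'n sfield"
    and e :: "nat \<Rightarrow> 'n sfield \<times> 'n sfield"
  assumes \<mu>: "0 < \<mu>" and e: "orthobasis e"
    and u_norm: "\<And>t. t \<in> {0..T} \<Longrightarrow> norm (u t) \<le> norm u0"
    and u_cont: "\<And>y. continuous_on {0..T} (\<lambda>t. inner (u t) y)"
    and ineq: "\<And>\<phi> \<psi> s t. \<phi> \<in> C1_sigma \<Longrightarrow> \<psi> \<in> C1_sigma \<Longrightarrow> 0 \<le> s \<Longrightarrow> s \<le> t \<Longrightarrow> t \<le> T \<Longrightarrow>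
       integral {s..t} (\<lambda>\<tau>. excess \<mu> ((norm u0)\<^sup>2) \<phi> \<psi> (u \<tau>)) \<le> inner (u t - u s) (test_pair \<mu> \<phi> \<psi>)"
    and \<phi>: "\<phi> \<in> test_fields T" and \<psi>: "\<psi> \<in> test_fields T" and st: "0 \<le> s" "s \<le> t" "t \<le> T"
  shows "integrable (lebesgue_on {s..t}) (\<lambda>\<tau>. time_excess \<mu> T ((norm u0)\<^sup>2) \<phi> \<psi> \<tau> (u \<tau>))"
    and "(LINT \<tau>|lebesgue_on {s..t}. time_excess \<mu> T ((norm u0)\<^sup>2) \<phi> \<psi> \<tau> (u \<tau>))
      \<le> inner (u t) (test_pair \<mu> (\<phi> t) (\<psi> t)) - inner (u s) (test_pair \<mu> (\<phi> s) (\<psi> s))"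
proof -
  interpret orthobasis e by (rule e)
  let ?c = "1 + 1 / sqrt \<mu>" and ?R = "(norm u0)\<^sup>2"
  let ?D = "time_excess \<mu> T ?R \<phi> \<psi>" and ?q = "\<lambda>\<tau>. pairing \<mu> (time_deriv T \<phi> \<tau>) (time_deriv T \<psi> \<tau>)"
  have c: "0 < ?c" using \<mu> by (simp add: add_pos_pos)
  have uR: "(norm (u t))\<^sup>2 \<le> ?R" if "t \<in> {0..T}" for t
    using u_norm[OF that] by (simp add: power_mono)
  note C1 = test_fields_C1_sigma[OF \<phi>] test_fields_C1_sigma[OF \<psi>]
  have dc: "continuous_on S (time_deriv T \<phi> \<tau>)" "continuous_on S (time_deriv T \<psi> \<tau>)" if "\<tau> \<in> {0..T}" for \<tau> S
    using continuous_on_slice[OF test_fields_continuous(2)[OF \<phi>] that] continuous_on_slice[OF test_fields_continuous(2)[OF \<psi>] that] by auto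
  have Dcont: "continuous_on ({0..T} \<times> UNIV) (\<lambda>(\<tau>, x). ?D \<tau> x)"
  proof (rule continuous_on_Times_slices)
    fix \<tau> assume \<tau>: "\<tau> \<in> {0..T}"
    show "continuous_on UNIV (?D \<tau>)"
      unfolding time_excess_def
      by (intro continuous_on_add excess_continuous C1 linear_continuous_on pairing_bounded_linear dc \<tau>)
  next
    fix \<epsilon> :: real assume \<epsilon>: "0 < \<epsilon>"
    define \<eta> where "\<eta> = \<epsilon> / (?c * (3 + ?R))"
    have cR: "0 < ?c * (3 + ?R)" by (rule mult_pos_pos[OF c]) (simp add: add_pos_nonneg)
    have \<eta>: "0 < \<eta>" using \<epsilon> cR by (simp add: \<eta>_def)
    obtain \<delta> where \<delta>: "0 < \<delta>" "\<And>s t x. s \<in> {0..T} \<Longrightarrow> t \<in> {0..T} \<Longrightarrow> \<bar>s - t\<bar> < \<delta> \<Longrightarrow> x \<in> cbox 0 1 \<Longrightarrow>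
      norm (grad (\<phi> s) x - grad (\<phi> t) x) \<le> \<eta> \<and> norm (grad (\<psi> s) x - grad (\<psi> t) x) \<le> \<eta> \<and>
      norm (time_deriv T \<phi> s x - time_deriv T \<phi> t x) \<le> \<eta> \<and> norm (time_deriv T \<psi> s x - time_deriv T \<psi> t x) \<le> \<eta>"
      using test_fields_uniform[OF \<phi> \<psi> \<eta>] by blast
    have "\<bar>?D s x - ?D t x\<bar> \<le> \<epsilon> * (1 + norm x)\<^sup>2" if s: "s \<in> {0..T}" "t \<in> {0..T}" "\<bar>s - t\<bar> < \<delta>" for s t x
    proof -
      have "\<bar>excess \<mu> ?R (\<phi> s) (\<psi> s) x - excess \<mu> ?R (\<phi> t) (\<psi> t) x\<bar> \<le> \<eta> * ?c * ((norm x)\<^sup>2 + \<bar>(norm x)\<^sup>2 - ?R\<bar>)"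
        by (rule excess_diff_le[OF \<mu>]) (use C1[OF s(1)] C1[OF s(2)] \<delta>(2)[OF s] in auto)
      moreover have "\<bar>?q s x - ?q t x\<bar> \<le> \<eta> * ?c * norm x"
        by (rule pairing_diff_le[OF \<mu> dc(1)[OF s(1)] dc(1)[OF s(2)] dc(2)[OF s(1)] dc(2)[OF s(2)]]) (use \<delta>(2)[OF s] in auto)
      ultimately have "\<bar>?D s x - ?D t x\<bar> \<le> \<eta> * ?c * ((norm x)\<^sup>2 + \<bar>(norm x)\<^sup>2 - ?R\<bar>) + \<eta> * ?c * norm x"
        unfolding time_excess_def by linarith
      also have "\<dots> = \<eta> * ?c * ((norm x)\<^sup>2 + \<bar>(norm x)\<^sup>2 - ?R\<bar> + norm x)" by (simp only: distrib_left)
      also have "\<dots> \<le> \<eta> * ?c * ((3 + ?R) * (1 + norm x)\<^sup>2)"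
      proof (rule mult_left_mono)
        have "\<bar>(norm x)\<^sup>2 - ?R\<bar> \<le> (norm x)\<^sup>2 + ?R"
          using zero_le_power2[of "norm x"] zero_le_power2[of "norm u0"] by linarith
        \<comment> \<open>An elementary bound that dominates the quadratic, constant and linear
          terms at once; it explains the factor \<open>3 + ?R\<close> in
          \<open>\<eta>\<close>.\<close>
        moreover have "2 * a\<^sup>2 + R + a \<le> (3 + R) * (1 + a)\<^sup>2" if "0 \<le> a" "0 \<le> R" for a R :: real
        proof -
          have "(3 + R) * (1 + a)\<^sup>2 = 3 + 6 * a + 3 * a\<^sup>2 + R + 2 * (R * a) + R * a\<^sup>2"
            by (simp add: power2_eq_square algebra_simps)
          then show ?thesis using that mult_nonneg_nonneg[of R a] mult_nonneg_nonneg[of R "a\<^sup>2"] zero_le_power2[of a] by linarith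
        qed
        from this[of "norm x" ?R] have "2 * (norm x)\<^sup>2 + ?R + norm x \<le> (3 + ?R) * (1 + norm x)\<^sup>2" by simp
        ultimately show "(norm x)\<^sup>2 + \<bar>(norm x)\<^sup>2 - ?R\<bar> + norm x \<le> (3 + ?R) * (1 + norm x)\<^sup>2" by linarith
        show "0 \<le> \<eta> * ?c" using \<eta> c by (intro mult_nonneg_nonneg) auto
      qed
      also have "\<dots> = \<epsilon> * (1 + norm x)\<^sup>2"
      proof -
        have "e / (C * K) * C * (K * X) = e * X" if "0 < C * K" for e C K X :: real
          using that by (auto simp: field_simps)
        then show ?thesis unfolding \<eta>_def using cR by blast
      qed
      finally show ?thesis .
    qed
    then show "\<exists>\<delta>>0. \<forall>s\<in>{0..T}. \<forall>t\<in>{0..T}. \<bar>s - t\<bar> < \<delta> \<longrightarrow> (\<forall>x. \<bar>?D s x - ?D t x\<bar> \<le> \<epsilon> * (1 + norm x)\<^sup>2)"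
      using \<delta>(1) by blast
  qed
  obtain M where M: "\<And>\<tau>. \<tau> \<in> {0..T} \<Longrightarrow> \<bar>?D \<tau> (u \<tau>)\<bar> \<le> M"
  proof -
    obtain C1 C2 C3 C4 where B: "\<forall>t\<in>{0..T}. \<forall>x\<in>cbox 0 1. norm (grad (\<phi> t) x) \<le> C1"
      "\<forall>t\<in>{0..T}. \<forall>x\<in>cbox 0 1. norm (grad (\<psi> t) x) \<le> C2"
      "\<forall>t\<in>{0..T}. \<forall>x\<in>cbox 0 1. norm (time_deriv T \<phi> t x) \<le> C3"
      "\<forall>t\<in>{0..T}. \<forall>x\<in>cbox 0 1. norm (time_deriv T \<psi> t x) \<le> C4"
      using bounded_slices[OF test_fields_continuous(1)[OF \<phi>]] bounded_slices[OF test_fields_continuous(1)[OF \<psi>]]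
        bounded_slices[OF test_fields_continuous(2)[OF \<phi>]] bounded_slices[OF test_fields_continuous(2)[OF \<psi>]] by blast
    define C where "C = max (max C1 C2) (max C3 C4)"
    have le: "norm (grad (\<phi> \<tau>) x) \<le> C" "norm (grad (\<psi> \<tau>) x) \<le> C"
      "norm (time_deriv T \<phi> \<tau> x) \<le> C" "norm (time_deriv T \<psi> \<tau> x) \<le> C"
      if "\<tau> \<in> {0..T}" "x \<in> cbox 0 1" for \<tau> x
      unfolding C_def using B[THEN bspec, OF that(1), THEN bspec, OF that(2)] by linarith+
    have zero: "(\<lambda>_ :: real^'n. 0 :: real^'n) \<in> C1_sigma"
      using C1_sigma_lincomb[of "\<lambda>x. wave 0 0 x *\<^sub>R (0 :: real^'n)" "\<lambda>x. wave 0 0 x *\<^sub>R (0 :: real^'n)" 0 0]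
        wave_C1_sigma[of 0 "0 :: real^'n" 0] by (simp add: integer_vec_def)
    have g0: "grad (\<lambda>_ :: real^'n. 0 :: real^'n) x = 0" for x
      by (rule grad_eqI) simp
    obtain M0 where M0: "\<And>x :: 'n sfield \<times> 'n sfield. (norm x)\<^sup>2 \<le> ?R \<Longrightarrow> \<bar>excess \<mu> ?R (\<lambda>_. 0) (\<lambda>_. 0) x\<bar> \<le> M0"
      using excess_bound[OF zero zero] by blast
    \<comment> \<open>Comparison with zero test fields: all gradients differ from zero by at most
      \<open>C\<close>, so one constant works for all times.\<close>
    have "\<bar>?D \<tau> (u \<tau>)\<bar> \<le> M0 + C * ?c * ?R + \<bar>C * ?c\<bar> * norm u0" if \<tau>: "\<tau> \<in> {0..T}" for \<tau>
    proof -
      have "\<bar>excess \<mu> ?R (\<phi> \<tau>) (\<psi> \<tau>) (u \<tau>) - excess \<mu> ?R (\<lambda>_. 0) (\<lambda>_. 0) (u \<tau>)\<bar>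
          \<le> C * ?c * ((norm (u \<tau>))\<^sup>2 + \<bar>(norm (u \<tau>))\<^sup>2 - ?R\<bar>)"
        by (rule excess_diff_le[OF \<mu>]) (use C1[OF \<tau>] zero le[OF \<tau>] in \<open>auto simp: g0\<close>)
      moreover have "(norm (u \<tau>))\<^sup>2 + \<bar>(norm (u \<tau>))\<^sup>2 - ?R\<bar> = ?R" using uR[OF \<tau>] by simp
      moreover have "\<bar>?q \<tau> (u \<tau>)\<bar> \<le> C * ?c * norm (u \<tau>)"
        by (rule pairing_bound[OF \<mu> dc[OF \<tau>] le(3,4)[OF \<tau>]])
      moreover have "C * ?c * norm (u \<tau>) \<le> \<bar>C * ?c\<bar> * norm u0" using u_norm[OF \<tau>] by (intro mult_mono) auto
      ultimately show ?thesis using M0[OF uR[OF \<tau>]] unfolding time_excess_def by auto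
    qed
    then show thesis by (rule that)
  qed
  have sub: "{s..t} \<subseteq> {0..T}" using st by auto
  have meas: "(\<lambda>\<tau>. ?D \<tau> (u \<tau>)) \<in> borel_measurable (lebesgue_on {s..t})"
  proof (rule weakly_continuous_measurable[where g = ?D])
    show "continuous_on {s..t} (\<lambda>\<tau>. inner (u \<tau>) (e j))" for j by (rule continuous_on_subset[OF u_cont sub])
    show "continuous_on ({s..t} \<times> UNIV) (\<lambda>(\<tau>, x). ?D \<tau> x)"
      by (rule continuous_on_subset[OF Dcont]) (use sub in auto)
  qed
  show int: "integrable (lebesgue_on {s..t}) (\<lambda>\<tau>. ?D \<tau> (u \<tau>))"
  proof (rule measurable_bounded_by_integrable_imp_lebesgue_integrable[OF meas])
    show "integrable (lebesgue_on {s..t}) (\<lambda>\<tau>. M)" by (rule continuous_imp_integrable_real) simp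
  qed (use M sub in auto)
  have hk: "(\<lambda>\<tau>. ?D \<tau> (u \<tau>)) integrable_on {s..t}"
    by (rule measurable_bounded_by_integrable_imp_integrable_real[OF meas integrable_const_ivl M]) (use sub in auto)
  \<comment> \<open>Freezing the time derivative turns the pairing into an inner product with a
    fixed vector, which is continuous along the path; the error of freezing is uniform because the
    path is bounded.\<close>
  have q_cont: "continuous_on {0..T} (\<lambda>\<tau>. ?q \<tau> (u \<tau>))"
    unfolding continuous_on_iff
  proof (intro ballI allI impI)
    fix \<tau>0 \<epsilon> :: real assume \<tau>0: "\<tau>0 \<in> {0..T}" and \<epsilon>: "0 < \<epsilon>"
    define \<eta> where "\<eta> = \<epsilon> / (2 * (?c * (norm u0 + 1)))"
    have cu: "0 < ?c * (norm u0 + 1)" by (rule mult_pos_pos[OF c]) (simp add: add_nonneg_pos)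
    have \<eta>: "0 < \<eta>" using \<epsilon> cu by (simp add: \<eta>_def)
    obtain \<delta>1 where \<delta>1: "0 < \<delta>1" "\<And>s t x. s \<in> {0..T} \<Longrightarrow> t \<in> {0..T} \<Longrightarrow> \<bar>s - t\<bar> < \<delta>1 \<Longrightarrow> x \<in> cbox 0 1 \<Longrightarrow>
      norm (grad (\<phi> s) x - grad (\<phi> t) x) \<le> \<eta> \<and> norm (grad (\<psi> s) x - grad (\<psi> t) x) \<le> \<eta> \<and>
      norm (time_deriv T \<phi> s x - time_deriv T \<phi> t x) \<le> \<eta> \<and> norm (time_deriv T \<psi> s x - time_deriv T \<psi> t x) \<le> \<eta>"
      using test_fields_uniform[OF \<phi> \<psi> \<eta>] by blast
    obtain y where y: "\<And>x. ?q \<tau>0 x = inner x y"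
      using Riesz[OF pairing_bounded_linear[OF dc[OF \<tau>0]]] by blast
    obtain \<delta>2 where \<delta>2: "0 < \<delta>2" "\<And>\<tau>. \<tau> \<in> {0..T} \<Longrightarrow> dist \<tau> \<tau>0 < \<delta>2 \<Longrightarrow> dist (inner (u \<tau>) y) (inner (u \<tau>0) y) < \<epsilon> / 2"
      using u_cont[of y, unfolded continuous_on_iff, rule_format, OF \<tau>0, of "\<epsilon> / 2"] \<epsilon> by auto
    have "dist (?q \<tau> (u \<tau>)) (?q \<tau>0 (u \<tau>0)) < \<epsilon>" if \<tau>: "\<tau> \<in> {0..T}" "dist \<tau> \<tau>0 < min \<delta>1 \<delta>2" for \<tau>
    proof -
      have d1: "\<bar>\<tau> - \<tau>0\<bar> < \<delta>1" using \<tau>(2) by (simp add: dist_real_def)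
      have "\<bar>?q \<tau> (u \<tau>) - ?q \<tau>0 (u \<tau>)\<bar> \<le> \<eta> * ?c * norm (u \<tau>)"
        by (rule pairing_diff_le[OF \<mu> dc(1)[OF \<tau>(1)] dc(1)[OF \<tau>0] dc(2)[OF \<tau>(1)] dc(2)[OF \<tau>0]])
            (use \<delta>1(2)[OF \<tau>(1) \<tau>0 d1] in auto)
      also have "\<dots> \<le> \<eta> * ?c * (norm u0 + 1)"
        using u_norm[OF \<tau>(1)] \<eta> c by (intro mult_left_mono mult_nonneg_nonneg) auto
      also have "\<dots> = \<epsilon> / 2"
      proof -
        have "e / (2 * (C * K)) * C * K = e / 2" if "0 < C * K" for e C K :: real
          using that by (auto simp: field_simps)
        then show ?thesis unfolding \<eta>_def using cu by blast
      qed
      finally show ?thesis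
        using \<delta>2(2)[OF \<tau>(1)] \<tau>(2) unfolding dist_real_def y[of "u \<tau>"] y[of "u \<tau>0"] by linarith
    qed
    then show "\<exists>\<delta>>0. \<forall>\<tau>\<in>{0..T}. dist \<tau> \<tau>0 < \<delta> \<longrightarrow> dist (?q \<tau> (u \<tau>)) (?q \<tau>0 (u \<tau>0)) < \<epsilon>"
      using \<delta>1(1) \<delta>2(1) by (intro exI[of _ "min \<delta>1 \<delta>2"]) auto
  qed
  let ?G = "\<lambda>\<tau>. inner (u \<tau>) (test_pair \<mu> (\<phi> \<tau>) (\<psi> \<tau>))"
  have "integral {s..t} (\<lambda>\<tau>. ?D \<tau> (u \<tau>)) \<le> ?G t - ?G s"
  proof (rule integral_le_increment_local[OF st(2) hk])
    fix \<epsilon> :: real assume \<epsilon>: "0 < \<epsilon>"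
    \<comment> \<open>The summands stem from freezing the excess, from the oscillation of the
      pairing, and from linearising the test fields.\<close>
    define L where "L = ?c * ?R + 1 + ?c * norm u0"
    have L: "0 < L"
      unfolding L_def using mult_nonneg_nonneg[OF less_imp_le[OF c] zero_le_power2[of "norm u0"]]
        mult_nonneg_nonneg[OF less_imp_le[OF c] norm_ge_zero[of u0]] by linarith
    define \<eta> where "\<eta> = \<epsilon> / L"
    have \<eta>: "0 < \<eta>" using \<epsilon> L by (simp add: \<eta>_def)
    obtain \<delta>1 where \<delta>1: "0 < \<delta>1" "\<And>s t x. s \<in> {0..T} \<Longrightarrow> t \<in> {0..T} \<Longrightarrow> \<bar>s - t\<bar> < \<delta>1 \<Longrightarrow> x \<in> cbox 0 1 \<Longrightarrow>
      norm (grad (\<phi> s) x - grad (\<phi> t) x) \<le> \<eta> \<and> norm (grad (\<psi> s) x - grad (\<psi> t) x) \<le> \<eta> \<and>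
      norm (time_deriv T \<phi> s x - time_deriv T \<phi> t x) \<le> \<eta> \<and> norm (time_deriv T \<psi> s x - time_deriv T \<psi> t x) \<le> \<eta>"
      using test_fields_uniform[OF \<phi> \<psi> \<eta>] by blast
    have "uniformly_continuous_on {0..T} (\<lambda>\<tau>. ?q \<tau> (u \<tau>))"
      using q_cont by (intro compact_uniformly_continuous) auto
    then obtain \<delta>2 where \<delta>2: "0 < \<delta>2"
      "\<And>a b. a \<in> {0..T} \<Longrightarrow> b \<in> {0..T} \<Longrightarrow> dist b a < \<delta>2 \<Longrightarrow> dist (?q b (u b)) (?q a (u a)) < \<eta>"
      unfolding uniformly_continuous_on_def using \<eta> by blast
    have "integral {a..b} (\<lambda>\<tau>. ?D \<tau> (u \<tau>)) \<le> ?G b - ?G a + \<epsilon> * (b - a)"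
      if ab: "s \<le> a" "a \<le> b" "b \<le> t" "b - a < min \<delta>1 \<delta>2" for a b
    proof -
      have ab': "a \<in> {0..T}" "b \<in> {0..T}" using ab st by auto
      have sub': "{a..b} \<subseteq> {0..T}" using ab st by auto
      have ei: "(\<lambda>\<tau>. excess \<mu> ?R (\<phi> a) (\<psi> a) (u \<tau>)) integrable_on {a..b}"
      proof -
        obtain M' where M': "\<And>x. (norm x)\<^sup>2 \<le> ?R \<Longrightarrow> \<bar>excess \<mu> ?R (\<phi> a) (\<psi> a) x\<bar> \<le> M'"
          using excess_bound[OF C1[OF ab'(1)]] by blast
        show ?thesis
        proof (rule weakly_continuous_integrable)
          show "continuous_on {a..b} (\<lambda>\<tau>. inner (u \<tau>) (e j))" for j by (rule continuous_on_subset[OF u_cont sub'])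
          show "continuous_on ({a..b} \<times> UNIV) (\<lambda>(\<tau>, x). excess \<mu> ?R (\<phi> a) (\<psi> a) x)"
            unfolding case_prod_beta
            by (rule continuous_on_compose2[OF excess_continuous[OF C1[OF ab'(1)]]]) (auto intro: continuous_intros)
          show "\<bar>excess \<mu> ?R (\<phi> a) (\<psi> a) (u \<tau>)\<bar> \<le> M'" if "\<tau> \<in> {a..b}" for \<tau>
            by (intro M' uR) (use that sub' in auto)
        qed
      qed
      have "integral {a..b} (\<lambda>\<tau>. ?D \<tau> (u \<tau>))
          \<le> integral {a..b} (\<lambda>\<tau>. excess \<mu> ?R (\<phi> a) (\<psi> a) (u \<tau>) + (\<eta> * ?c * ?R + (?q b (u b) + \<eta>)))"
      proof (rule integral_le)
        show "(\<lambda>\<tau>. ?D \<tau> (u \<tau>)) integrable_on {a..b}" by (rule integrable_on_subinterval[OF hk]) (use ab in auto)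
        show "(\<lambda>\<tau>. excess \<mu> ?R (\<phi> a) (\<psi> a) (u \<tau>) + (\<eta> * ?c * ?R + (?q b (u b) + \<eta>))) integrable_on {a..b}"
          by (intro integrable_add ei integrable_const_ivl)
        fix \<tau> assume \<tau>: "\<tau> \<in> {a..b}"
        then have \<tau>': "\<tau> \<in> {0..T}" "\<bar>\<tau> - a\<bar> < \<delta>1" using sub' ab by auto
        have "\<bar>excess \<mu> ?R (\<phi> \<tau>) (\<psi> \<tau>) (u \<tau>) - excess \<mu> ?R (\<phi> a) (\<psi> a) (u \<tau>)\<bar>
            \<le> \<eta> * ?c * ((norm (u \<tau>))\<^sup>2 + \<bar>(norm (u \<tau>))\<^sup>2 - ?R\<bar>)"
          by (rule excess_diff_le[OF \<mu>]) (use C1[OF \<tau>'(1)] C1[OF ab'(1)] \<delta>1(2)[OF \<tau>'(1) ab'(1) \<tau>'(2)] in auto)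
        moreover have "(norm (u \<tau>))\<^sup>2 + \<bar>(norm (u \<tau>))\<^sup>2 - ?R\<bar> = ?R" using uR[OF \<tau>'(1)] by simp
        moreover have "dist (?q \<tau> (u \<tau>)) (?q b (u b)) < \<eta>"
          using \<tau> ab by (intro \<delta>2(2) ab' \<tau>') (auto simp: dist_real_def)
        ultimately show "?D \<tau> (u \<tau>) \<le> excess \<mu> ?R (\<phi> a) (\<psi> a) (u \<tau>) + (\<eta> * ?c * ?R + (?q b (u b) + \<eta>))"
          unfolding time_excess_def dist_real_def by auto
      qed
      also have "\<dots> = integral {a..b} (\<lambda>\<tau>. excess \<mu> ?R (\<phi> a) (\<psi> a) (u \<tau>)) + (\<eta> * ?c * ?R + (?q b (u b) + \<eta>)) * (b - a)"
        using ab by (subst Henstock_Kurzweil_Integration.integral_add[OF ei integrable_const_ivl]) auto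
      also have "\<dots> \<le> inner (u b - u a) (test_pair \<mu> (\<phi> a) (\<psi> a)) + (\<eta> * ?c * ?R + (?q b (u b) + \<eta>)) * (b - a)"
        using ineq[OF C1[OF ab'(1)], of a b] ab st by simp
      finally have I: "integral {a..b} (\<lambda>\<tau>. ?D \<tau> (u \<tau>))
          \<le> inner (u b - u a) (test_pair \<mu> (\<phi> a) (\<psi> a)) + (\<eta> * ?c * ?R + (?q b (u b) + \<eta>)) * (b - a)" .
      \<comment> \<open>The increment of the test fields is replaced by its linearisation at
        \<open>b\<close>, so that it meets the state at the same time in
        \<open>?q b (u b)\<close>.\<close>
      have J: "(b - a) * ?q b (u b) \<le> inner (u b) (test_pair \<mu> (\<phi> b) (\<psi> b)) - inner (u b) (test_pair \<mu> (\<phi> a) (\<psi> a))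
          + (b - a) * \<eta> * ?c * norm u0"
      proof -
        let ?h = "\<lambda>x. 1 *\<^sub>R \<phi> b x + (-1) *\<^sub>R \<phi> a x" and ?k = "\<lambda>x. 1 *\<^sub>R \<psi> b x + (-1) *\<^sub>R \<psi> a x"
        \<comment> \<open>The summand with coefficient 0 only brings the linearisation into the
          shape required by \<open>pairing_lincomb\<close>.\<close>
        let ?h' = "\<lambda>x. (b - a) *\<^sub>R time_deriv T \<phi> b x + 0 *\<^sub>R time_deriv T \<phi> b x"
        let ?k' = "\<lambda>x. (b - a) *\<^sub>R time_deriv T \<psi> b x + 0 *\<^sub>R time_deriv T \<psi> b x"
        note cc = C1_sigma_continuous[OF C1(1)[OF ab'(1)]] C1_sigma_continuous[OF C1(1)[OF ab'(2)]]
          C1_sigma_continuous[OF C1(2)[OF ab'(1)]] C1_sigma_continuous[OF C1(2)[OF ab'(2)]]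
        have near: "\<bar>\<tau> - b\<bar> < \<delta>1" "\<tau> \<in> {0..T}" if "\<tau> \<in> {a..b}" for \<tau> using that ab sub' by auto
        have "\<bar>pairing \<mu> ?h' ?k' (u b) - pairing \<mu> ?h ?k (u b)\<bar> \<le> ((b - a) * \<eta>) * ?c * norm (u b)"
        proof (rule pairing_diff_le[OF \<mu>])
          fix x :: "real^'n" assume x: "x \<in> cbox 0 1"
          have "norm (\<phi> b x - \<phi> a x - (b - a) *\<^sub>R time_deriv T \<phi> b x) \<le> (b - a) * \<eta>"
            by (rule test_fields_increment[OF \<phi>]) (use ab st \<delta>1(2)[OF near(2) ab'(2) near(1) x] in auto)
          then show "norm (?h' x - ?h x) \<le> (b - a) * \<eta>" by (simp add: norm_minus_commute)
          have "norm (\<psi> b x - \<psi> a x - (b - a) *\<^sub>R time_deriv T \<psi> b x) \<le> (b - a) * \<eta>"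
            by (rule test_fields_increment[OF \<psi>]) (use ab st \<delta>1(2)[OF near(2) ab'(2) near(1) x] in auto)
          then show "norm (?k' x - ?k x) \<le> (b - a) * \<eta>" by (simp add: norm_minus_commute)
        qed (intro continuous_intros cc dc ab')+
        moreover have "pairing \<mu> ?h' ?k' (u b) = (b - a) * ?q b (u b)"
          unfolding pairing_lincomb[OF dc(1)[OF ab'(2)] dc(1)[OF ab'(2)] dc(2)[OF ab'(2)] dc(2)[OF ab'(2)]] by simp
        moreover have "pairing \<mu> ?h ?k (u b) = inner (u b) (test_pair \<mu> (\<phi> b) (\<psi> b)) - inner (u b) (test_pair \<mu> (\<phi> a) (\<psi> a))"
          unfolding pairing_lincomb[OF cc(2,1,4,3)] inner_test_pair[OF C1[OF ab'(1)]] inner_test_pair[OF C1[OF ab'(2)]] by simp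
        moreover have "((b - a) * \<eta>) * ?c * norm (u b) \<le> ((b - a) * \<eta>) * ?c * norm u0"
          using u_norm[OF ab'(2)] \<eta> c ab by (intro mult_left_mono mult_nonneg_nonneg) auto
        ultimately show ?thesis by linarith
      qed
      have "(\<eta> * C * R + (Q + \<eta>)) * d + d * \<eta> * C * N = d * Q + \<eta> * (C * R + 1 + C * N) * d" for C R Q d N :: real
        by (simp add: algebra_simps)
      from this[of ?c ?R "?q b (u b)" "b - a" "norm u0"]
      have "(\<eta> * ?c * ?R + (?q b (u b) + \<eta>)) * (b - a) + (b - a) * \<eta> * ?c * norm u0 = (b - a) * ?q b (u b) + \<eta> * L * (b - a)"
        unfolding L_def .
      moreover have "\<eta> * L * (b - a) = \<epsilon> * (b - a)" using L by (simp add: \<eta>_def)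
      moreover have "inner (u b - u a) (test_pair \<mu> (\<phi> a) (\<psi> a)) = inner (u b) (test_pair \<mu> (\<phi> a) (\<psi> a)) - ?G a"
        by (simp add: inner_diff_left)
      ultimately show ?thesis using I J by linarith
    qed
    then show "\<exists>\<delta>>0. \<forall>a b. s \<le> a \<longrightarrow> a \<le> b \<longrightarrow> b \<le> t \<longrightarrow> b - a < \<delta> \<longrightarrow>
        integral {a..b} (\<lambda>\<tau>. ?D \<tau> (u \<tau>)) \<le> ?G b - ?G a + \<epsilon> * (b - a)"
      using \<delta>1(1) \<delta>2(1) by (intro exI[of _ "min \<delta>1 \<delta>2"]) auto
  qed
  then show "(LINT \<tau>|lebesgue_on {s..t}. ?D \<tau> (u \<tau>)) \<le> ?G t - ?G s"
    using lebesgue_integral_eq_integral[OF int] by simp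
qed


section \<open>Existence of energy-variational solutions\<close>

text \<open>On a bounded interval the floor takes finitely many values with measurable level sets,
  and any function of it inherits this.\<close>

lemma simple_function_floor:
  fixes h :: "real \<Rightarrow> 'b"
  shows "simple_function (lebesgue_on {0<..<T}) (\<lambda>t. h (real_of_int \<lfloor>t * c\<rfloor> / c))"
proof -
  have "simple_function (lebesgue_on {0<..<T}) (\<lambda>t. \<lfloor>t * c\<rfloor>)"
    unfolding simple_function_def
  proof (intro conjI ballI)
    have "(\<lambda>t. \<lfloor>t * c\<rfloor>) ` {0<..<T} \<subseteq> {\<lfloor>- \<bar>T * c\<bar>\<rfloor>..\<lfloor>\<bar>T * c\<bar>\<rfloor>}"
    proof (rule image_subsetI)
      fix t assume t: "t \<in> {0<..<T}"
      have "\<bar>t\<bar> * \<bar>c\<bar> \<le> \<bar>T\<bar> * \<bar>c\<bar>" by (rule mult_right_mono) (use t in auto)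
      then have "\<bar>t * c\<bar> \<le> \<bar>T * c\<bar>" by (simp only: abs_mult)
      then have "- \<bar>T * c\<bar> \<le> t * c" "t * c \<le> \<bar>T * c\<bar>" by linarith+
      then show "\<lfloor>t * c\<rfloor> \<in> {\<lfloor>- \<bar>T * c\<bar>\<rfloor>..\<lfloor>\<bar>T * c\<bar>\<rfloor>}"
        unfolding atLeastAtMost_iff by (intro conjI floor_mono)
    qed
    from finite_subset[OF this finite_atLeastAtMost_int]
    show "finite ((\<lambda>t. \<lfloor>t * c\<rfloor>) ` space (lebesgue_on {0<..<T}))" by simp
    show "(\<lambda>t. \<lfloor>t * c\<rfloor>) -` {x} \<inter> space (lebesgue_on {0<..<T}) \<in> sets (lebesgue_on {0<..<T})" for x
    proof -
      have "(\<lambda>t :: real. \<lfloor>t * c\<rfloor>) \<in> measurable borel (count_space UNIV)" by measurable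
      from measurable_sets[OF this, of "{x}"]
      have "(\<lambda>t. \<lfloor>t * c\<rfloor>) -` {x} \<in> sets borel" by simp
      then have "(\<lambda>t. \<lfloor>t * c\<rfloor>) -` {x} \<inter> {0<..<T} \<in> sets lebesgue"
        by (intro sets.Int sets_completionI_sets) simp_all
      then show ?thesis by (simp add: sets_restrict_space_iff)
    qed
  qed
  from simple_function_compose1[OF this, of "\<lambda>m. h (real_of_int m / c)"] show ?thesis by simp
qed

text \<open>The argument of Pettis' theorem: projections of the path to finitely many basis vectors
  are continuous in norm, so sampling them on a fine grid gives simple functions, and the
  projections converge to the path.\<close>

lemma (in orthobasis) weakly_continuous_simple_approximation:
  fixes u :: "real \<Rightarrow> 'h"
  assumes "\<And>y. continuous_on {0..T} (\<lambda>t. inner (u t) y)"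
  shows "\<exists>s. (\<forall>k :: nat. simple_function (lebesgue_on {0<..<T}) (s k)) \<and>
    (\<forall>t\<in>{0<..<T}. (\<lambda>k. s k t) \<longlonglongrightarrow> u t)"
proof -
  have "\<exists>n>0. \<forall>a\<in>{0..T}. \<forall>b\<in>{0..T}. \<bar>a - b\<bar> < 1 / real n \<longrightarrow> dist (partial k (u a)) (partial k (u b)) < 1 / real (Suc k)" for k
  proof -
    have "continuous_on {0..T} (\<lambda>t. partial k (u t))" unfolding partial_def by (intro continuous_intros assms)
    then have "uniformly_continuous_on {0..T} (\<lambda>t. partial k (u t))" by (intro compact_uniformly_continuous) auto
    then obtain \<delta> where \<delta>: "0 < \<delta>" "\<forall>a\<in>{0..T}. \<forall>b\<in>{0..T}. dist b a < \<delta> \<longrightarrow> dist (partial k (u b)) (partial k (u a)) < 1 / real (Suc k)"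
      unfolding uniformly_continuous_on_def by (metis of_nat_0_less_iff zero_less_Suc zero_less_divide_1_iff)
    obtain n where n: "n > 0" "inverse (real n) < \<delta>" using ex_inverse_of_nat_less[OF \<delta>(1)] by blast
    have "dist (partial k (u a)) (partial k (u b)) < 1 / real (Suc k)"
      if "a \<in> {0..T}" "b \<in> {0..T}" "\<bar>a - b\<bar> < 1 / real n" for a b
    proof -
      have "dist a b < \<delta>" using that(3) n(2) by (simp add: dist_real_def inverse_eq_divide)
      then show ?thesis using \<delta>(2) that(1,2) by blast
    qed
    then show ?thesis using n(1) by blast
  qed
  then obtain n where n: "\<And>k. n k > 0" "\<And>k a b. a \<in> {0..T} \<Longrightarrow> b \<in> {0..T} \<Longrightarrow> \<bar>a - b\<bar> < 1 / real (n k) \<Longrightarrow>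
      dist (partial k (u a)) (partial k (u b)) < 1 / real (Suc k)" by metis
  \<comment> \<open>Sampling at the grid point to the left stays inside \<open>[0,T]\<close>, also
    near \<open>T\<close>.\<close>
  define s where "s k t = partial k (u (real_of_int \<lfloor>t * real (n k)\<rfloor> / real (n k)))" for k t
  have "simple_function (lebesgue_on {0<..<T}) (s k)" for k
    unfolding s_def by (rule simple_function_floor)
  moreover have "(\<lambda>k. s k t) \<longlonglongrightarrow> u t" if t: "t \<in> {0<..<T}" for t
  proof -
    have "dist (s k t) (partial k (u t)) \<le> 1 / real (Suc k)" for k
    proof -
      let ?a = "real_of_int \<lfloor>t * real (n k)\<rfloor> / real (n k)"
      have nk: "0 < real (n k)" using n(1) by simp
      have le: "?a \<le> t" using nk by (simp add: pos_divide_le_eq)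
      have "0 \<le> t * real (n k)" using t by simp
      then have ge: "0 \<le> ?a" using nk by simp
      have "t * real (n k) < real_of_int \<lfloor>t * real (n k)\<rfloor> + 1" by linarith
      then have "t < (real_of_int \<lfloor>t * real (n k)\<rfloor> + 1) / real (n k)" using nk by (simp add: pos_less_divide_eq)
      then have "\<bar>?a - t\<bar> < 1 / real (n k)" using le by (simp add: add_divide_distrib)
      then show ?thesis unfolding s_def using le ge t by (intro less_imp_le n(2)) auto
    qed
    then have "(\<lambda>k. dist (s k t) (partial k (u t))) \<longlonglongrightarrow> 0"
      by (intro tendsto_sandwich[OF _ _ tendsto_const LIMSEQ_Suc[OF lim_1_over_n]] always_eventually) auto
    then have "(\<lambda>k. s k t - partial k (u t)) \<longlonglongrightarrow> 0"
      unfolding dist_norm by (rule tendsto_norm_zero_cancel)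
    then show ?thesis by (rule Lim_transform[OF partial_tendsto])
  qed
  ultimately show ?thesis by blast
qed

section \<open>From Hilbert space vectors back to fields\<close>

lemma L2_norm_scaleR: "L2_norm (\<lambda>x. c *\<^sub>R f x) = \<bar>c\<bar> * L2_norm f"
  by (simp add: L2_norm_def power_mult_distrib real_sqrt_mult)

lemma L2_norm_rep_diff: "L2_norm (\<lambda>x. rep y x - rep z x) = norm (y - z)"
  by (simp add: L2_norm_def norm_diff_rep)

lemma L2_norm_rep_minus:
  fixes f :: "real^'n \<Rightarrow> real^'n"
  assumes f: "f \<in> L2_sigma"
  shows "L2_norm (\<lambda>x. rep y x - f x) = norm (y - cls f)"
proof -
  have "(\<lambda>x. 1 *\<^sub>R rep y x + (-1) *\<^sub>R f x) \<in> L2_sigma" by (intro L2_sigma_lincomb rep_L2_sigma f)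
  from norm_cls[OF this] show ?thesis by (simp add: cls_lincomb[OF rep_L2_sigma f, of 1 y "-1", simplified])
qed

lemma inner_tensor: "(a \<otimes>\<^sub>v b) \<bullet> A = a \<bullet> (A *v b)"
  by (simp add: tensor_def inner_vec_def matrix_vector_mult_def sum_distrib_left algebra_simps)

lemma scaleR_rep_L2_sigma: "(\<lambda>x. c *\<^sub>R rep y x) \<in> L2_sigma"
  using L2_sigma_lincomb[OF rep_L2_sigma rep_L2_sigma, of c y 0 y] by simp

lemma cls_scaleR_rep: "cls (\<lambda>x. c *\<^sub>R rep y x) = c *\<^sub>R y"
  using cls_lincomb[OF rep_L2_sigma rep_L2_sigma, of c y 0 y] by simp

lemma norm_components_le: "norm (fst z) \<le> norm z" "norm (snd z) \<le> norm z"
  using norm_fst_le[of "fst z" "snd z"] norm_snd_le[of "snd z" "fst z"] by simp_all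

text \<open>Composition with \<open>rep\<close> turns simple functions with values in the quotient
  into simple functions with values in \<open>L2_sigma\<close>; the factor \<open>c\<close> undoes
  the rescaling of the magnetic field.\<close>

lemma Linfty_L2_sigma_rep:
  fixes u :: "real \<Rightarrow> ('n::finite) sfield" and s :: "nat \<Rightarrow> real \<Rightarrow> 'n sfield"
  assumes s: "\<And>k. simple_function (lebesgue_on {0<..<T}) (s k)"
    and lim: "\<And>t. t \<in> {0<..<T} \<Longrightarrow> (\<lambda>k. s k t) \<longlonglongrightarrow> u t"
    and bound: "\<And>t. t \<in> {0<..<T} \<Longrightarrow> norm (u t) \<le> C"
  shows "(\<lambda>t x. c *\<^sub>R rep (u t) x) \<in> Linfty_L2_sigma T"
proof -
  note mem = scaleR_rep_L2_sigma[of c]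
  have simple: "simple_function (lebesgue_on {0<..<T}) (\<lambda>t x. c *\<^sub>R rep (s k t) x)" for k
    using simple_function_compose1[OF s, of "\<lambda>y x. c *\<^sub>R rep y x" k] by simp
  have conv: "(\<lambda>k. L2_norm (\<lambda>x. c *\<^sub>R rep (s k t) x - c *\<^sub>R rep (u t) x)) \<longlonglongrightarrow> 0" if "t \<in> {0<..<T}" for t
  proof -
    have "(\<lambda>k. norm (s k t - u t)) \<longlonglongrightarrow> 0"
      using lim[OF that] by (simp add: LIM_zero_iff tendsto_norm_zero_iff)
    from tendsto_mult_right_zero[OF this, of "\<bar>c\<bar>"] show ?thesis
      unfolding scaleR_diff_right[symmetric] L2_norm_scaleR L2_norm_rep_diff .
  qed
  have bd: "L2_norm (\<lambda>x. c *\<^sub>R rep (u t) x) \<le> \<bar>c\<bar> * C" if "t \<in> {0<..<T}" for t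
    using mult_left_mono[OF bound[OF that], of "\<bar>c\<bar>"] by (simp add: L2_norm_scaleR norm_rep)
  have AE: "AE t in lebesgue_on {0<..<T}. P t" if "\<And>t. t \<in> {0<..<T} \<Longrightarrow> P t" for P
    by (rule AE_I2) (use that in simp)
  show ?thesis
    unfolding Linfty_L2_sigma_def mem_Collect_eq
  proof (intro conjI exI)
    show "AE t in lebesgue_on {0<..<T}. (\<lambda>x. c *\<^sub>R rep (u t) x) \<in> L2_sigma" by (rule AE[OF mem])
    show "\<forall>k. simple_function (lebesgue_on {0<..<T}) (\<lambda>t x. c *\<^sub>R rep (s k t) x)" by (rule allI[OF simple])
    show "\<forall>k. \<forall>t\<in>{0<..<T}. (\<lambda>x. c *\<^sub>R rep (s k t) x) \<in> L2_sigma" by (intro allI ballI mem)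
    show "AE t in lebesgue_on {0<..<T}. (\<lambda>k. L2_norm (\<lambda>x. c *\<^sub>R rep (s k t) x - c *\<^sub>R rep (u t) x)) \<longlonglongrightarrow> 0" by (rule AE[OF conv])
    show "AE t in lebesgue_on {0<..<T}. L2_norm (\<lambda>x. c *\<^sub>R rep (u t) x) \<le> \<bar>c\<bar> * C" by (rule AE[OF bd])
  qed
qed

lemma const_BV: "(\<lambda>_. c) \<in> BV T"
proof -
  have "integrable (lebesgue_on {0..T}) (\<lambda>_. c)" by (rule continuous_imp_integrable_real) simp
  then show ?thesis by (auto simp: BV_def)
qed

lemma L2_sigma_pair_functional_lincomb:
  assumes "L2_sigma_pair_functional l" "f \<in> L2_sigma" "g \<in> L2_sigma" "f' \<in> L2_sigma" "g' \<in> L2_sigma"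
  shows "l (\<lambda>x. a *\<^sub>R f x + b *\<^sub>R f' x, \<lambda>x. a *\<^sub>R g x + b *\<^sub>R g' x) = a * l (f, g) + b * l (f', g')"
  by (rule assms(1)[unfolded L2_sigma_pair_functional_def, THEN conjunct1, rule_format, OF assms(2-5)])

text \<open>A difference of vanishing norm gets the value 0 by the bound, and linearity separates
  it; so the functional descends to classes.\<close>

lemma L2_sigma_pair_functional_cong_AE:
  assumes l: "L2_sigma_pair_functional l"
    and mem: "f \<in> L2_sigma" "g \<in> L2_sigma" "f' \<in> L2_sigma" "g' \<in> L2_sigma"
    and eq: "cls f = cls f'" "cls g = cls g'"
  shows "l (f, g) = l (f', g')"
proof -
  let ?f = "\<lambda>x. 1 *\<^sub>R f x + (-1) *\<^sub>R f' x" and ?g = "\<lambda>x. 1 *\<^sub>R g x + (-1) *\<^sub>R g' x"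
  obtain C where C: "\<And>f g. f \<in> L2_sigma \<Longrightarrow> g \<in> L2_sigma \<Longrightarrow> \<bar>l (f, g)\<bar> \<le> C * sqrt ((L2_norm f)\<^sup>2 + (L2_norm g)\<^sup>2)"
    using l unfolding L2_sigma_pair_functional_def by blast
  have m: "?f \<in> L2_sigma" "?g \<in> L2_sigma" by (intro L2_sigma_lincomb mem)+
  have "L2_norm ?f = 0" "L2_norm ?g = 0"
    unfolding norm_cls[OF m(1), symmetric] norm_cls[OF m(2), symmetric] cls_lincomb[OF mem(1,3)] cls_lincomb[OF mem(2,4)] eq by simp_all
  then have "l (?f, ?g) = 0" using C[OF m] by simp
  moreover have "l (?f, ?g) = 1 * l (f, g) + (-1) * l (f', g')"
    by (rule L2_sigma_pair_functional_lincomb[OF l mem])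
  ultimately show ?thesis by simp
qed

text \<open>Pulls a functional on pairs of functions back to the Hilbert space of rescaled states,
  where Riesz representation applies.\<close>

lemma L2_sigma_pair_functional_bounded_linear:
  fixes l :: "(real^'n \<Rightarrow> real^'n) \<times> (real^'n \<Rightarrow> real^'n) \<Rightarrow> real"
  assumes l: "L2_sigma_pair_functional l"
  shows "bounded_linear (\<lambda>z. l (rep (fst z), \<lambda>x. c *\<^sub>R rep (snd z) x))"
proof -
  note mem = scaleR_rep_L2_sigma[of c]
  obtain C0 where C0: "\<And>f g. f \<in> L2_sigma \<Longrightarrow> g \<in> L2_sigma \<Longrightarrow> \<bar>l (f, g)\<bar> \<le> C0 * sqrt ((L2_norm f)\<^sup>2 + (L2_norm g)\<^sup>2)"
    using l unfolding L2_sigma_pair_functional_def by blast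
  let ?l = "\<lambda>z :: 'n sfield \<times> 'n sfield. l (rep (fst z), \<lambda>x. c *\<^sub>R rep (snd z) x)"
  have lin: "?l (a *\<^sub>R y + b *\<^sub>R z) = a * ?l y + b * ?l z" for a b and y z :: "'n sfield \<times> 'n sfield"
  proof -
    let ?f = "\<lambda>x. a *\<^sub>R rep (fst y) x + b *\<^sub>R rep (fst z) x"
    let ?g = "\<lambda>x. a *\<^sub>R (c *\<^sub>R rep (snd y) x) + b *\<^sub>R (c *\<^sub>R rep (snd z) x)"
    have "?l (a *\<^sub>R y + b *\<^sub>R z) = l (?f, ?g)"
    proof (rule L2_sigma_pair_functional_cong_AE[OF l])
      show "cls (rep (fst (a *\<^sub>R y + b *\<^sub>R z))) = cls ?f" by (simp add: cls_lincomb rep_L2_sigma)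
      show "cls (\<lambda>x. c *\<^sub>R rep (snd (a *\<^sub>R y + b *\<^sub>R z)) x) = cls ?g"
        unfolding cls_lincomb[OF mem mem] cls_scaleR_rep by (simp add: algebra_simps)
    qed (intro mem rep_L2_sigma L2_sigma_lincomb)+
    also have "\<dots> = a * ?l y + b * ?l z"
      by (rule L2_sigma_pair_functional_lincomb[OF l rep_L2_sigma mem rep_L2_sigma mem])
    finally show ?thesis .
  qed
  have bound: "\<bar>?l z\<bar> \<le> norm z * (\<bar>C0\<bar> * (1 + \<bar>c\<bar>))" for z
  proof -
    have "\<bar>?l z\<bar> \<le> C0 * sqrt ((L2_norm (rep (fst z)))\<^sup>2 + (L2_norm (\<lambda>x. c *\<^sub>R rep (snd z) x))\<^sup>2)"
      by (rule C0[OF rep_L2_sigma mem])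
    also have "\<dots> = C0 * norm (fst z, c *\<^sub>R snd z)"
      using norm_rep[of "c *\<^sub>R snd z"] norm_rep[of "snd z"] norm_rep[of "fst z"]
      by (simp only: norm_Pair L2_norm_scaleR norm_scaleR)
    also have "\<dots> \<le> \<bar>C0\<bar> * norm (fst z, c *\<^sub>R snd z)" by (intro mult_right_mono) auto
    also have "\<dots> \<le> \<bar>C0\<bar> * (norm (fst z) + \<bar>c\<bar> * norm (snd z))"
      using norm_Pair_le[of "fst z" "c *\<^sub>R snd z"] by (intro mult_left_mono) auto
    also have "\<dots> \<le> \<bar>C0\<bar> * (norm z + \<bar>c\<bar> * norm z)"
      using norm_components_le[of z] by (intro mult_left_mono add_mono) auto
    also have "\<dots> = norm z * (\<bar>C0\<bar> * (1 + \<bar>c\<bar>))" by (simp add: algebra_simps)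
    finally show ?thesis .
  qed
  show ?thesis
  proof (rule bounded_linear_intro[where K = "\<bar>C0\<bar> * (1 + \<bar>c\<bar>)"])
    show "?l (y + z) = ?l y + ?l z" for y z using lin[of 1 y 1 z] by simp
    show "?l (r *\<^sub>R y) = r *\<^sub>R ?l y" for r y using lin[of r y 0 y] by simp
    show "norm (?l z) \<le> norm z * (\<bar>C0\<bar> * (1 + \<bar>c\<bar>))" for z using bound[of z] by simp
  qed
qed

text \<open>Expanding the square and using the norm bound, the squared distance is at most
  \<open>2 * (norm w)\<^sup>2 - 2 * inner (u t) w\<close>, which tends to 0.\<close>

lemma tendsto_norm_of_inner:
  fixes u :: "'a \<Rightarrow> 'h::real_inner"
  assumes lim: "((\<lambda>t. inner (u t) w) \<longlongrightarrow> inner w w) F" and le: "\<forall>\<^sub>F t in F. norm (u t) \<le> norm w"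
  shows "((\<lambda>t. norm (u t - w)) \<longlongrightarrow> 0) F"
proof -
  have "((\<lambda>t. (norm (u t - w))\<^sup>2) \<longlongrightarrow> 0) F"
  proof (rule tendsto_sandwich[OF _ _ tendsto_const])
    show "((\<lambda>t. 2 * (norm w)\<^sup>2 - 2 * inner (u t) w) \<longlongrightarrow> 0) F"
      using tendsto_diff[OF tendsto_const[of "2 * (norm w)\<^sup>2"] tendsto_mult_left[OF lim, of 2]]
      by (simp add: power2_norm_eq_inner)
    show "\<forall>\<^sub>F t in F. (norm (u t - w))\<^sup>2 \<le> 2 * (norm w)\<^sup>2 - 2 * inner (u t) w"
      using le
    proof eventually_elim
      case (elim t)
      have "(norm (u t - w))\<^sup>2 = (norm (u t))\<^sup>2 - 2 * inner (u t) w + (norm w)\<^sup>2"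
        by (simp add: power2_norm_eq_inner inner_diff_left inner_diff_right inner_commute)
      moreover have "(norm (u t))\<^sup>2 \<le> (norm w)\<^sup>2" using elim by (simp add: power_mono)
      ultimately show ?case by linarith
    qed
  qed simp
  from tendsto_real_sqrt[OF this] show ?thesis by simp
qed

lemma shifted_energy_eq:
  fixes w G :: "real^'n \<Rightarrow> real^'n"
  assumes \<mu>: "0 < \<mu>" and w: "w \<in> L2_sigma" "G \<in> L2_sigma" and \<phi>: "\<phi> \<in> C1_sigma" "\<psi> \<in> C1_sigma"
  shows "shifted_energy e w G \<phi> \<psi> = e - inner (cls w, sqrt \<mu> *\<^sub>R cls G) (test_pair \<mu> \<phi> \<psi>)"
proof -
  note \<phi>' = subsetD[OF C1_sigma_subset_L2_sigma \<phi>(1)] subsetD[OF C1_sigma_subset_L2_sigma \<phi>(2)]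
  have "(LINT x|torus. w x \<bullet> \<phi> x + G x \<bullet> \<psi> x) = inner (cls w) (cls \<phi>) + inner (cls G) (cls \<psi>)"
    unfolding inner_cls[OF w(1) \<phi>'(1)] inner_cls[OF w(2) \<phi>'(2)]
    by (intro Bochner_Integration.integral_add square_integrable_inner L2_sigma_square_integrable w \<phi>')
  moreover have "inner (cls w, sqrt \<mu> *\<^sub>R cls G) (test_pair \<mu> \<phi> \<psi>) = inner (cls w) (cls \<phi>) + inner (cls G) (cls \<psi>)"
    using \<mu> by (simp add: test_pair_def inner_prod_def)
  ultimately show ?thesis unfolding shifted_energy_def by simp
qed


lemma ev_integrand_eq:
  fixes u :: "real \<Rightarrow> ('n::finite) sfield \<times> 'n sfield"
  assumes \<mu>: "0 < \<mu>" and \<phi>: "\<phi> \<in> test_fields T" and \<psi>: "\<psi> \<in> test_fields T" and \<tau>: "\<tau> \<in> {0..T}"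
  shows "ev_integrand \<mu> T (\<lambda>t. rep (fst (u t))) (\<lambda>t x. (1 / sqrt \<mu>) *\<^sub>R rep (snd (u t)) x) (\<lambda>_. R / 2) \<phi> \<psi> \<tau>
    = time_excess \<mu> T R \<phi> \<psi> \<tau> (u \<tau>)"
proof -
  define f g where "f = rep (fst (u \<tau>))" and "g = rep (snd (u \<tau>))"
  define c where "c = 1 / sqrt \<mu>"
  \<comment> \<open>With the magnetic field \<open>c *\<^sub>R g x\<close> the factor
    \<open>\<mu>\<close> of the magnetic stress cancels against \<open>c * c\<close>, while the
    mixed terms keep a single \<open>c\<close>.\<close>
  have c: "\<mu> * (c * c) = 1" using \<mu> by (simp add: c_def)
  note sq = rep_sq[of "fst (u \<tau>)", folded f_def] rep_sq[of "snd (u \<tau>)", folded g_def]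
  note C1 = test_fields_C1_sigma[OF \<phi> \<tau>] test_fields_C1_sigma[OF \<psi> \<tau>]
  note C1_sq = C1[THEN C1_sigma_grad_continuous]
  have dt: "square_integrable (time_deriv T \<phi> \<tau>)" "square_integrable (time_deriv T \<psi> \<tau>)"
    using continuous_on_slice[OF test_fields_continuous(2)[OF \<phi>] \<tau>] continuous_on_slice[OF test_fields_continuous(2)[OF \<psi>] \<tau>]
    by (auto intro: square_integrable_continuous)
  have pw: "f x \<bullet> time_deriv T \<phi> \<tau> x + (f x \<otimes>\<^sub>v f x - \<mu> *\<^sub>R ((c *\<^sub>R g x) \<otimes>\<^sub>v (c *\<^sub>R g x))) \<bullet> grad (\<phi> \<tau>) x
      + (c *\<^sub>R g x) \<bullet> time_deriv T \<psi> \<tau> x + ((c *\<^sub>R g x) \<otimes>\<^sub>v f x - f x \<otimes>\<^sub>v (c *\<^sub>R g x)) \<bullet> grad (\<psi> \<tau>) x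
    = f x \<bullet> time_deriv T \<phi> \<tau> x + (f x \<bullet> (grad (\<phi> \<tau>) x *v f x) - g x \<bullet> (grad (\<phi> \<tau>) x *v g x))
      + c * (g x \<bullet> time_deriv T \<psi> \<tau> x) + c * (g x \<bullet> (grad (\<psi> \<tau>) x *v f x) - f x \<bullet> (grad (\<psi> \<tau>) x *v g x))" for x
  proof -
    have "\<mu> * (c * (c * r)) = r" for r using c by (metis mult.assoc mult_1)
    then show ?thesis
      by (simp add: inner_diff_left inner_tensor matrix_vector_mult_scaleR right_diff_distrib)
  qed
  note int = square_integrable_inner[OF sq(1) dt(1)] square_integrable_inner[OF sq(2) dt(2)]
    transport_integrable(1)[OF sq(1) sq(1) C1_sq(1)] transport_integrable(1)[OF sq(2) sq(2) C1_sq(1)]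
    transport_integrable(1)[OF sq(2) sq(1) C1_sq(2)] transport_integrable(1)[OF sq(1) sq(2) C1_sq(2)]
  have "(LINT x|torus. f x \<bullet> time_deriv T \<phi> \<tau> x + (f x \<otimes>\<^sub>v f x - \<mu> *\<^sub>R ((c *\<^sub>R g x) \<otimes>\<^sub>v (c *\<^sub>R g x))) \<bullet> grad (\<phi> \<tau>) x
      + (c *\<^sub>R g x) \<bullet> time_deriv T \<psi> \<tau> x + ((c *\<^sub>R g x) \<otimes>\<^sub>v f x - f x \<otimes>\<^sub>v (c *\<^sub>R g x)) \<bullet> grad (\<psi> \<tau>) x)
    = mhd \<mu> (\<phi> \<tau>) (\<psi> \<tau>) (u \<tau>) (u \<tau>) + pairing \<mu> (time_deriv T \<phi> \<tau>) (time_deriv T \<psi> \<tau>) (u \<tau>)"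
    unfolding pw mhd_def stress_def transport_def pairing_def f_def[symmetric] g_def[symmetric] c_def[symmetric]
    using int by simp
  moreover have "energy \<mu> f (\<lambda>x. c *\<^sub>R g x) = (norm (u \<tau>))\<^sup>2 / 2"
  proof -
    have "\<mu> / 2 * (\<bar>c\<bar> * r)\<^sup>2 = \<mu> * (c * c) * (r\<^sup>2 / 2)" for r
      by (simp add: power_mult_distrib power2_eq_square)
    then have "\<mu> / 2 * (\<bar>c\<bar> * r)\<^sup>2 = r\<^sup>2 / 2" for r unfolding c by simp
    then show ?thesis
      unfolding energy_def L2_norm_scaleR f_def g_def norm_rep[symmetric] norm_prod_sq by (simp add: add_divide_distrib)
  qed
  moreover have "regularity_weight \<mu> (\<phi> \<tau>) (\<psi> \<tau>) * ((norm (u \<tau>))\<^sup>2 / 2 - R / 2)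
      = regularity_weight \<mu> (\<phi> \<tau>) (\<psi> \<tau>) / 2 * ((norm (u \<tau>))\<^sup>2 - R)" by (simp add: algebra_simps)
  ultimately show ?thesis
    unfolding ev_integrand_def time_excess_def excess_def f_def[symmetric] g_def[symmetric] c_def[symmetric] by simp
qed

theorem theorem4p3:
  fixes T \<mu> :: real and v0 H0 :: "real^'n \<Rightarrow> real^'n"
  assumes "0 < T" and "0 < \<mu>"
    and "v0 \<in> L2_sigma" and "H0 \<in> L2_sigma"
  shows "\<exists>(v :: real \<Rightarrow> real^'n \<Rightarrow> real^'n) (H :: real \<Rightarrow> real^'n \<Rightarrow> real^'n) (E :: real \<Rightarrow> real).
    energy_variational_solution \<mu> T v0 H0 v H E \<and>
    (E \<longlongrightarrow> energy \<mu> v0 H0) (at_right 0) \<and>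
    (\<lambda>t. (v t, H t)) \<in> Cw_L2_sigma_pair T \<and>
    ((\<lambda>t. L2_norm (\<lambda>x. v t x - v0 x)) \<longlongrightarrow> 0) (at_right 0) \<and>
    ((\<lambda>t. L2_norm (\<lambda>x. H t x - H0 x)) \<longlongrightarrow> 0) (at_right 0)"
proof -
  note T = \<open>0 < T\<close> and \<mu> = \<open>0 < \<mu>\<close> and v0 = \<open>v0 \<in> L2_sigma\<close> and H0 = \<open>H0 \<in> L2_sigma\<close>
  define u0 :: "'n sfield \<times> 'n sfield" where "u0 = (cls v0, sqrt \<mu> *\<^sub>R cls H0)"
  let ?R = "(norm u0)\<^sup>2"
  obtain e :: "nat \<Rightarrow> 'n sfield \<times> 'n sfield" and u where e: "orthobasis e" and u_init: "u 0 = u0"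
    and u_norm: "\<And>t. t \<in> {0..T} \<Longrightarrow> norm (u t) \<le> norm u0"
    and u_cont: "\<And>y. continuous_on {0..T} (\<lambda>t. inner (u t) y)"
    and ineq: "\<And>\<phi> \<psi> s t. \<phi> \<in> C1_sigma \<Longrightarrow> \<psi> \<in> C1_sigma \<Longrightarrow> 0 \<le> s \<Longrightarrow> s \<le> t \<Longrightarrow> t \<le> T \<Longrightarrow>
       integral {s..t} (\<lambda>\<tau>. excess \<mu> ?R \<phi> \<psi> (u \<tau>)) \<le> inner (u t - u s) (test_pair \<mu> \<phi> \<psi>)"
    by (rule static_solution[OF \<mu> T, of u0]) blast
  interpret orthobasis e by (rule e)
  define v where "v t = rep (fst (u t))" for t
  define H where "H t = (\<lambda>x. (1 / sqrt \<mu>) *\<^sub>R rep (snd (u t)) x)" for t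
  define E :: "real \<Rightarrow> real" where "E = (\<lambda>_. ?R / 2)"
  have mem: "v t \<in> L2_sigma" "H t \<in> L2_sigma" for t
    unfolding v_def H_def by (rule rep_L2_sigma scaleR_rep_L2_sigma)+
  have cls_u: "(cls (v t), sqrt \<mu> *\<^sub>R cls (H t)) = u t" for t
    unfolding v_def H_def cls_scaleR_rep cls_rep using \<mu> by (simp add: prod_eq_iff)
  have energy_eq: "energy \<mu> w G = (norm (cls w, sqrt \<mu> *\<^sub>R cls G))\<^sup>2 / 2" if "w \<in> L2_sigma" "G \<in> L2_sigma" for w G :: "real^'n \<Rightarrow> real^'n"
    using \<mu> that by (simp add: energy_def norm_prod_sq norm_cls power_mult_distrib add_divide_distrib)
  have E_eq: "E t = energy \<mu> v0 H0" for t
    by (simp add: E_def energy_eq[OF v0 H0] u0_def)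
  have sub: "{0<..<T} \<subseteq> {0..T}" by auto
  have spaces: "v \<in> Linfty_L2_sigma T" "H \<in> Linfty_L2_sigma T"
  proof -
    obtain s where s: "\<And>k :: nat. simple_function (lebesgue_on {0<..<T}) (s k)"
      "\<And>t. t \<in> {0<..<T} \<Longrightarrow> (\<lambda>k. s k t) \<longlonglongrightarrow> u t"
      using weakly_continuous_simple_approximation[OF u_cont] by blast
    have "(\<lambda>t x. 1 *\<^sub>R rep (fst (u t)) x) \<in> Linfty_L2_sigma T"
    proof (rule Linfty_L2_sigma_rep[where C = "norm u0"])
      show "simple_function (lebesgue_on {0<..<T}) (\<lambda>t. fst (s k t))" for k by (rule simple_function_compose1[OF s(1)])
      show "(\<lambda>k. fst (s k t)) \<longlonglongrightarrow> fst (u t)" if "t \<in> {0<..<T}" for t by (rule tendsto_fst[OF s(2)[OF that]])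
      show "norm (fst (u t)) \<le> norm u0" if "t \<in> {0<..<T}" for t
        using norm_components_le(1)[of "u t"] u_norm[OF subsetD[OF sub that]] by linarith
    qed
    then show "v \<in> Linfty_L2_sigma T" by (simp add: v_def[abs_def])
    have "(\<lambda>t x. (1 / sqrt \<mu>) *\<^sub>R rep (snd (u t)) x) \<in> Linfty_L2_sigma T"
    proof (rule Linfty_L2_sigma_rep[where C = "norm u0"])
      show "simple_function (lebesgue_on {0<..<T}) (\<lambda>t. snd (s k t))" for k by (rule simple_function_compose1[OF s(1)])
      show "(\<lambda>k. snd (s k t)) \<longlonglongrightarrow> snd (u t)" if "t \<in> {0<..<T}" for t by (rule tendsto_snd[OF s(2)[OF that]])
      show "norm (snd (u t)) \<le> norm u0" if "t \<in> {0<..<T}" for t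
        using norm_components_le(2)[of "u t"] u_norm[OF subsetD[OF sub that]] by linarith
    qed
    then show "H \<in> Linfty_L2_sigma T" by (simp only: H_def[abs_def])
  qed
  \<comment> \<open>The values at time \<open>s\<close> enter only through their classes. This
    covers \<open>s = 0\<close>, where \<open>v0\<close> and \<open>H0\<close> agree with
    \<open>v 0\<close> and \<open>H 0\<close> merely almost everywhere, together with positive
    times.\<close>
  have ev: "ev_inequality \<mu> T v H E s (?R / 2) w G t"
    if st: "0 \<le> s" "s \<le> t" "t \<le> T" and w: "w \<in> L2_sigma" "G \<in> L2_sigma" "(cls w, sqrt \<mu> *\<^sub>R cls G) = u s" for s t w G
    unfolding ev_inequality_def
  proof (intro ballI)
    fix \<phi> \<psi> :: "real \<Rightarrow> real^'n \<Rightarrow> real^'n" assume test: "\<phi> \<in> test_fields T" "\<psi> \<in> test_fields T"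
    have s0: "s \<in> {0..T}" "t \<in> {0..T}" using st by auto
    note C1 = test_fields_C1_sigma[OF test(1)] test_fields_C1_sigma[OF test(2)]
    have "(LINT \<tau>|lebesgue_on {s..t}. ev_integrand \<mu> T v H E \<phi> \<psi> \<tau>)
        = (LINT \<tau>|lebesgue_on {s..t}. time_excess \<mu> T ?R \<phi> \<psi> \<tau> (u \<tau>))"
    proof (rule Bochner_Integration.integral_cong[OF refl])
      fix \<tau> assume "\<tau> \<in> space (lebesgue_on {s..t})"
      then have "\<tau> \<in> {0..T}" using st by auto
      from ev_integrand_eq[OF \<mu> test this] show "ev_integrand \<mu> T v H E \<phi> \<psi> \<tau> = time_excess \<mu> T ?R \<phi> \<psi> \<tau> (u \<tau>)"
        by (simp only: v_def[abs_def] H_def[abs_def] E_def)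
    qed
    moreover have "shifted_energy (E t) (v t) (H t) (\<phi> t) (\<psi> t) = ?R / 2 - inner (u t) (test_pair \<mu> (\<phi> t) (\<psi> t))"
      by (simp add: shifted_energy_eq[OF \<mu> mem C1[OF s0(2)]] cls_u E_def)
    moreover have "shifted_energy (?R / 2) w G (\<phi> s) (\<psi> s) = ?R / 2 - inner (u s) (test_pair \<mu> (\<phi> s) (\<psi> s))"
      by (simp add: shifted_energy_eq[OF \<mu> w(1,2) C1[OF s0(1)]] w(3))
    ultimately show "shifted_energy (E t) (v t) (H t) (\<phi> t) (\<psi> t) - shifted_energy (?R / 2) w G (\<phi> s) (\<psi> s)
        + (LINT \<tau>|lebesgue_on {s..t}. ev_integrand \<mu> T v H E \<phi> \<psi> \<tau>) \<le> 0"
      using time_excess_inequality(2)[OF \<mu> e u_norm u_cont ineq test st] by simp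
  qed
  have "Lim (at_right 0) E = ?R / 2"
    unfolding E_def by (rule tendsto_Lim) auto
  then have solution: "energy_variational_solution \<mu> T v0 H0 v H E"
    unfolding energy_variational_solution_def
  \<comment> \<open>The inequality holds at all times, so the exceptional null set can be
    empty.\<close>
  proof (intro conjI spaces bexI[of _ "{}"] ballI impI)
    show "E \<in> BV T" unfolding E_def by (rule const_BV)
    show "AE t in lebesgue_on {0<..<T}. energy \<mu> (v t) (H t) \<le> E t"
    proof (rule AE_I2)
      fix t assume "t \<in> space (lebesgue_on {0<..<T})"
      then have "norm (u t) \<le> norm u0" by (intro u_norm) auto
      then show "energy \<mu> (v t) (H t) \<le> E t" by (simp add: energy_eq[OF mem] cls_u E_def power_mono)
    qed
    show "ev_inequality \<mu> T v H E s (E s) (v s) (H s) t" if "s \<in> {0<..<T} - {}" "t \<in> {0<..<T} - {}" "s < t" for s t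
    proof -
      have "E s = ?R / 2" by (simp add: E_def)
      show ?thesis unfolding \<open>E s = ?R / 2\<close> by (rule ev) (use that mem cls_u in auto)
    qed
    show "ev_inequality \<mu> T v H E 0 (Lim (at_right 0) E) v0 H0 t" if "t \<in> {0<..<T} - {}" for t
      unfolding \<open>Lim (at_right 0) E = ?R / 2\<close> by (rule ev) (use that v0 H0 u_init in \<open>auto simp: u0_def\<close>)
  qed simp
  have weak: "(\<lambda>t. (v t, H t)) \<in> Cw_L2_sigma_pair T"
    unfolding Cw_L2_sigma_pair_def mem_Collect_eq
  proof (intro conjI ballI allI impI)
    show "(v t, H t) \<in> L2_sigma \<times> L2_sigma" for t using mem by simp
    fix l :: "(real^'n \<Rightarrow> real^'n) \<times> (real^'n \<Rightarrow> real^'n) \<Rightarrow> real" assume l: "L2_sigma_pair_functional l"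
    obtain y where "\<And>z. l (rep (fst z), \<lambda>x. (1 / sqrt \<mu>) *\<^sub>R rep (snd z) x) = inner z y"
      using Riesz[OF L2_sigma_pair_functional_bounded_linear[OF l]] by blast
    then have "l (v t, H t) = inner (u t) y" for t unfolding v_def H_def by blast
    then show "continuous_on {0..T} (\<lambda>t. l (v t, H t))" using u_cont[of y] by simp
  qed
  have near: "eventually (\<lambda>t. t \<in> {0..T}) (at_right (0 :: real))"
    using eventually_at_right_less[of 0] eventually_at_right[OF T] by (auto simp: eventually_at_right[OF T] intro!: exI[of _ T] T)
  have strong: "((\<lambda>t. norm (u t - u0)) \<longlongrightarrow> 0) (at_right 0)"
  proof (rule tendsto_norm_of_inner)
    have "((\<lambda>t. inner (u t) u0) \<longlongrightarrow> inner (u 0) u0) (at 0 within {0..T})"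
      using u_cont[of u0] T by (simp add: continuous_on_def)
    then show "((\<lambda>t. inner (u t) u0) \<longlongrightarrow> inner u0 u0) (at_right 0)"
      using T by (simp add: at_within_Icc_at_right u_init)
    show "\<forall>\<^sub>F t in at_right 0. norm (u t) \<le> norm u0" using near by eventually_elim (rule u_norm)
  qed
  have v_init: "((\<lambda>t. L2_norm (\<lambda>x. v t x - v0 x)) \<longlongrightarrow> 0) (at_right 0)"
  proof (rule tendsto_sandwich[OF _ _ tendsto_const strong])
    have "L2_norm (\<lambda>x. v t x - v0 x) \<le> norm (u t - u0)" for t
      using norm_components_le(1)[of "u t - u0"] unfolding v_def L2_norm_rep_minus[OF v0] fst_diff by (simp add: u0_def)
    then show "\<forall>\<^sub>F t in at_right 0. L2_norm (\<lambda>x. v t x - v0 x) \<le> norm (u t - u0)" by simp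
  qed (simp add: L2_norm_def)
  have H_init: "((\<lambda>t. L2_norm (\<lambda>x. H t x - H0 x)) \<longlongrightarrow> 0) (at_right 0)"
  proof (rule tendsto_sandwich[OF _ _ tendsto_const tendsto_mult_right_zero[OF strong, of "1 / sqrt \<mu>"]])
    have "L2_norm (\<lambda>x. H t x - H0 x) \<le> 1 / sqrt \<mu> * norm (u t - u0)" for t
    proof -
      \<comment> \<open>The summand with coefficient 0 puts the rescaled datum into the form of
        \<open>L2_sigma_lincomb\<close>.\<close>
      let ?G = "\<lambda>x. sqrt \<mu> *\<^sub>R H0 x + 0 *\<^sub>R H0 x"
      have "(\<lambda>x. H t x - H0 x) = (\<lambda>x. (1 / sqrt \<mu>) *\<^sub>R (rep (snd (u t)) x - ?G x))"
        using \<mu> by (simp add: H_def scaleR_diff_right)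
      then have "L2_norm (\<lambda>x. H t x - H0 x) = 1 / sqrt \<mu> * norm (snd (u t) - cls ?G)"
        using \<mu> by (simp only: L2_norm_scaleR L2_norm_rep_minus[OF L2_sigma_lincomb[OF H0 H0]]) simp
      also have "cls ?G = snd u0" using cls_lincomb[OF H0 H0, of "sqrt \<mu>" 0] by (simp add: u0_def)
      also have "1 / sqrt \<mu> * norm (snd (u t) - snd u0) \<le> 1 / sqrt \<mu> * norm (u t - u0)"
        using norm_components_le(2)[of "u t - u0"] \<mu> by (intro mult_left_mono) (simp_all add: snd_diff)
      finally show ?thesis .
    qed
    then show "\<forall>\<^sub>F t in at_right 0. L2_norm (\<lambda>x. H t x - H0 x) \<le> 1 / sqrt \<mu> * norm (u t - u0)" by simp
  qed (simp add: L2_norm_def)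
  have "(E \<longlongrightarrow> energy \<mu> v0 H0) (at_right 0)"
    using tendsto_const by (simp add: E_eq[abs_def] E_eq)
  then show ?thesis using solution weak v_init H_init by blast
qed

end
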